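(* For every formula of weighted $\mathrm{WMSO{+}U}$ over a weighted alphabet $\Sigma$ there is a weighted max-automaton over $\Sigma$ accepting exactly the weighted words satisfying the formula, and vice versa.
   Context: A weighted alphabet is a finite set $\Sigma$ partitioned into label symbols $\Sigma_{\mathrm{lab}}$ and weight symbols $\Sigma_{\mathrm{wei}}$. A weighted word over $\Sigma$ is an infinite ($\omega$-)word over the (infinite) alphabet $\Sigma_{\mathrm{lab}}\times\bar{\mathbb N}^{\Sigma_{\mathrm{wei}}}$, where $\bar{\mathbb N}=\mathbb N\cup\{\infty\}$. For a weight symbol $b$, the $b$-weight of a position is its $b$-coordinate, and the $b$-weight of a set of positions is the sum of the $b$-weights of its positions. Weighted $\mathrm{WMSO{+}U}$: the syntax of weak MSO over $\omega$-words (quantification over positions and finite sets of positions, order on positions, label predicates for $\Sigma_{\mathrm{lab}}$, membership) with the unbounding quantifier $\mathsf U X\,\psi(X)$ (true iff for every $n$ some finite set of size $\ge n$ satisfies $\psi$), extended, for every weight symbol $b$, by a predicate $b(x)$, true at positions of nonzero $b$-weight, and a quantifier $\mathsf U_b X\,\psi(X)$, true iff the $b$-weights of the finite sets $X$ satisfying $\psi(X)$ are unbounded (which may be achieved by a single set of $b$-weight $\infty$). Weighted max-automaton: the profile of a position is its label, the set of weight symbols at which it has nonzero weight, and the set at which it has infinite weight. The automaton has a finite set $C$ of counters, a deterministic finite automaton over the alphabet of profiles, for each transition a sequence of counter operations among $c:=c+1$, $c:=c+b$, $c:=0$, $c:=\max(d,e)$ ($c,d,e\in C$, $b$ a weight symbol),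 and an acceptance condition $\mathcal U$, a family of subsets of $C$. On a weighted word it starts in the initial state with all counters $0$ and at the $n$-th position takes the transition for the profile of that position and executes its counter operations, $c:=c+b$ adding the $b$-weight of that position; letting $v_n$ be the valuation after $n$ steps, it accepts iff $\{c\in C:\limsup_n v_n(c)=\infty\}\in\mathcal U$. *)

theory Defs
  imports Main "HOL-Library.FuncSet" "HOL-Library.Extended_Nat" "HOL-Library.Liminf_Limsup"
begin

text \<open>A weighted alphabet is given by its two parts: the label symbols \<open>Lab\<close> and the weight
  symbols \<open>Wei\<close>. Either part may be empty.\<close>

definition weighted_alphabet :: "'a set \<Rightarrow> 'a set \<Rightarrow> bool" where
  "weighted_alphabet Lab Wei \<longleftrightarrow> finite (Lab \<union> Wei) \<and> Lab \<inter> Wei = {}"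

type_synonym 'a wword = "nat \<Rightarrow> 'a \<times> ('a \<Rightarrow> enat)"

definition weighted_words :: "'a set \<Rightarrow> 'a set \<Rightarrow> 'a wword set" where
  "weighted_words Lab Wei = {w. \<forall>n. w n \<in> Lab \<times> (Wei \<rightarrow>\<^sub>E UNIV)}"

definition label :: "'a wword \<Rightarrow> nat \<Rightarrow> 'a" where
  "label w n = fst (w n)"

definition weight :: "'a wword \<Rightarrow> 'a \<Rightarrow> nat \<Rightarrow> enat" where
  "weight w b n = snd (w n) b"

definition set_weight :: "'a wword \<Rightarrow> 'a \<Rightarrow> nat set \<Rightarrow> enat" where
  "set_weight w b X = (\<Sum>n\<in>X. weight w b n)"


subsection \<open>Weighted WMSO+U\<close>

text \<open>Position variables and set variables are two separate sorts, each named by natural numbers.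
  The remaining Boolean connectives, the universal quantifiers and the equality of positions are
  definable from the constructors below.\<close>

datatype 'a formula =
    Lab_at 'a nat                 \<comment> \<open>position \<open>x\<close> has label \<open>a\<close>\<close>
  | Wei_at 'a nat                 \<comment> \<open>position \<open>x\<close> has nonzero \<open>b\<close>-weight\<close>
  | Less nat nat
  | Mem nat nat                   \<comment> \<open>the position variable comes first\<close>
  | Neg "'a formula"
  | Disj "'a formula" "'a formula"
  | Ex_pos nat "'a formula"
  | Ex_set nat "'a formula"
  | Unb nat "'a formula"
  | Unb_wei 'a nat "'a formula"

primrec over_alphabet :: "'a set \<Rightarrow> 'a set \<Rightarrow> 'a formula \<Rightarrow> bool" where
  "over_alphabet Lab Wei (Lab_at a x) \<longleftrightarrow> a \<in> Lab"
| "over_alphabet Lab Wei (Wei_at b x) \<longleftrightarrow> b \<in> Wei"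
| "over_alphabet Lab Wei (Less x y) \<longleftrightarrow> True"
| "over_alphabet Lab Wei (Mem x X) \<longleftrightarrow> True"
| "over_alphabet Lab Wei (Neg \<phi>) \<longleftrightarrow> over_alphabet Lab Wei \<phi>"
| "over_alphabet Lab Wei (Disj \<phi> \<psi>) \<longleftrightarrow> over_alphabet Lab Wei \<phi> \<and> over_alphabet Lab Wei \<psi>"
| "over_alphabet Lab Wei (Ex_pos x \<phi>) \<longleftrightarrow> over_alphabet Lab Wei \<phi>"
| "over_alphabet Lab Wei (Ex_set X \<phi>) \<longleftrightarrow> over_alphabet Lab Wei \<phi>"
| "over_alphabet Lab Wei (Unb X \<phi>) \<longleftrightarrow> over_alphabet Lab Wei \<phi>"
| "over_alphabet Lab Wei (Unb_wei b X \<phi>) \<longleftrightarrow> b \<in> Wei \<and> over_alphabet Lab Wei \<phi>"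

primrec free_pos :: "'a formula \<Rightarrow> nat set" where
  "free_pos (Lab_at a x) = {x}"
| "free_pos (Wei_at b x) = {x}"
| "free_pos (Less x y) = {x, y}"
| "free_pos (Mem x X) = {x}"
| "free_pos (Neg \<phi>) = free_pos \<phi>"
| "free_pos (Disj \<phi> \<psi>) = free_pos \<phi> \<union> free_pos \<psi>"
| "free_pos (Ex_pos x \<phi>) = free_pos \<phi> - {x}"
| "free_pos (Ex_set X \<phi>) = free_pos \<phi>"
| "free_pos (Unb X \<phi>) = free_pos \<phi>"
| "free_pos (Unb_wei b X \<phi>) = free_pos \<phi>"

primrec free_set :: "'a formula \<Rightarrow> nat set" where
  "free_set (Lab_at a x) = {}"
| "free_set (Wei_at b x) = {}"
| "free_set (Less x y) = {}"
| "free_set (Mem x X) = {X}"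
| "free_set (Neg \<phi>) = free_set \<phi>"
| "free_set (Disj \<phi> \<psi>) = free_set \<phi> \<union> free_set \<psi>"
| "free_set (Ex_pos x \<phi>) = free_set \<phi>"
| "free_set (Ex_set X \<phi>) = free_set \<phi> - {X}"
| "free_set (Unb X \<phi>) = free_set \<phi> - {X}"
| "free_set (Unb_wei b X \<phi>) = free_set \<phi> - {X}"

definition sentence :: "'a set \<Rightarrow> 'a set \<Rightarrow> 'a formula \<Rightarrow> bool" where
  "sentence Lab Wei \<phi> \<longleftrightarrow> over_alphabet Lab Wei \<phi> \<and> free_pos \<phi> = {} \<and> free_set \<phi> = {}"

primrec sat :: "'a wword \<Rightarrow> (nat \<Rightarrow> nat) \<Rightarrow> (nat \<Rightarrow> nat set) \<Rightarrow> 'a formula \<Rightarrow> bool" where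
  "sat w s S (Lab_at a x) \<longleftrightarrow> label w (s x) = a"
| "sat w s S (Wei_at b x) \<longleftrightarrow> weight w b (s x) \<noteq> 0"
| "sat w s S (Less x y) \<longleftrightarrow> s x < s y"
| "sat w s S (Mem x X) \<longleftrightarrow> s x \<in> S X"
| "sat w s S (Neg \<phi>) \<longleftrightarrow> \<not> sat w s S \<phi>"
| "sat w s S (Disj \<phi> \<psi>) \<longleftrightarrow> sat w s S \<phi> \<or> sat w s S \<psi>"
| "sat w s S (Ex_pos x \<phi>) \<longleftrightarrow> (\<exists>p. sat w (s(x := p)) S \<phi>)"
| "sat w s S (Ex_set X \<phi>) \<longleftrightarrow> (\<exists>P. finite P \<and> sat w s (S(X := P)) \<phi>)"
| "sat w s S (Unb X \<phi>) \<longleftrightarrow> (\<forall>n. \<exists>P. finite P \<and> n \<le> card P \<and> sat w s (S(X := P)) \<phi>)"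
| "sat w s S (Unb_wei b X \<phi>) \<longleftrightarrow>
     (\<forall>n. \<exists>P. finite P \<and> enat n \<le> set_weight w b P \<and> sat w s (S(X := P)) \<phi>)"

text \<open>Intended for sentences only, where the choice of the initial valuations is irrelevant.\<close>

definition satisfies :: "'a wword \<Rightarrow> 'a formula \<Rightarrow> bool" where
  "satisfies w \<phi> \<longleftrightarrow> sat w (\<lambda>_. 0) (\<lambda>_. {}) \<phi>"


subsection \<open>Weighted max-automata\<close>

text \<open>Label, symbols of nonzero weight, symbols of infinite weight.\<close>

type_synonym 'a profile = "'a \<times> 'a set \<times> 'a set"

definition profiles :: "'a set \<Rightarrow> 'a set \<Rightarrow> 'a profile set" where
  "profiles Lab Wei = {(a, N, I). a \<in> Lab \<and> I \<subseteq> N \<and> N \<subseteq> Wei}"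

definition profile_at :: "'a set \<Rightarrow> 'a wword \<Rightarrow> nat \<Rightarrow> 'a profile" where
  "profile_at Wei w n =
     (label w n, {b \<in> Wei. weight w b n \<noteq> 0}, {b \<in> Wei. weight w b n = \<infinity>})"

datatype ('a, 'c) counter_op =
    Incr 'c                       \<comment> \<open>\<open>c := c + 1\<close>\<close>
  | Add_weight 'c 'a              \<comment> \<open>\<open>c := c + b\<close>\<close>
  | Reset 'c                      \<comment> \<open>\<open>c := 0\<close>\<close>
  | Assign_max 'c 'c 'c           \<comment> \<open>\<open>c := max d e\<close>\<close>

primrec op_over :: "'a set \<Rightarrow> 'c set \<Rightarrow> ('a, 'c) counter_op \<Rightarrow> bool" where
  "op_over Wei C (Incr c) \<longleftrightarrow> c \<in> C"
| "op_over Wei C (Add_weight c b) \<longleftrightarrow> c \<in> C \<and> b \<in> Wei"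
| "op_over Wei C (Reset c) \<longleftrightarrow> c \<in> C"
| "op_over Wei C (Assign_max c d e) \<longleftrightarrow> c \<in> C \<and> d \<in> C \<and> e \<in> C"

primrec exec_op :: "('a \<Rightarrow> enat) \<Rightarrow> ('a, 'c) counter_op \<Rightarrow> ('c \<Rightarrow> enat) \<Rightarrow> ('c \<Rightarrow> enat)" where
  "exec_op wt (Incr c) v = v(c := v c + 1)"
| "exec_op wt (Add_weight c b) v = v(c := v c + wt b)"
| "exec_op wt (Reset c) v = v(c := 0)"
| "exec_op wt (Assign_max c d e) v = v(c := max (v d) (v e))"

record ('a, 'q, 'c) max_automaton =
  states :: "'q set"
  counters :: "'c set"
  init :: 'q
  trans :: "'q \<Rightarrow> 'a profile \<Rightarrow> 'q"
  ops :: "'q \<Rightarrow> 'a profile \<Rightarrow> ('a, 'c) counter_op list"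
  acc :: "'c set set"

definition weighted_max_automaton ::
    "'a set \<Rightarrow> 'a set \<Rightarrow> ('a, 'q, 'c) max_automaton \<Rightarrow> bool" where
  "weighted_max_automaton Lab Wei A \<longleftrightarrow>
     finite (states A) \<and> finite (counters A) \<and> init A \<in> states A \<and>
     (\<forall>q\<in>states A. \<forall>p\<in>profiles Lab Wei.
        trans A q p \<in> states A \<and> (\<forall>f\<in>set (ops A q p). op_over Wei (counters A) f)) \<and>
     acc A \<subseteq> Pow (counters A)"

text \<open>State and counter valuation after \<open>n\<close> steps; the step from \<open>n\<close> to \<open>Suc n\<close> reads
  position \<open>n\<close>, positions being numbered from \<open>0\<close>.\<close>

primrec state_after :: "'a set \<Rightarrow> ('a, 'q, 'c) max_automaton \<Rightarrow> 'a wword \<Rightarrow> nat \<Rightarrow> 'q" where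
  "state_after Wei A w 0 = init A"
| "state_after Wei A w (Suc n) = trans A (state_after Wei A w n) (profile_at Wei w n)"

primrec val_after ::
    "'a set \<Rightarrow> ('a, 'q, 'c) max_automaton \<Rightarrow> 'a wword \<Rightarrow> nat \<Rightarrow> 'c \<Rightarrow> enat" where
  "val_after Wei A w 0 = (\<lambda>_. 0)"
| "val_after Wei A w (Suc n) =
     fold (exec_op (\<lambda>b. weight w b n))
       (ops A (state_after Wei A w n) (profile_at Wei w n)) (val_after Wei A w n)"

definition accepts :: "'a set \<Rightarrow> ('a, 'q, 'c) max_automaton \<Rightarrow> 'a wword \<Rightarrow> bool" where
  "accepts Wei A w \<longleftrightarrow>
     {c \<in> counters A. limsup (\<lambda>n. val_after Wei A w n c) = \<infinity>} \<in> acc A"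

end

theory Submission
  imports Defs
begin

text \<open>Both formalisms are compared with limit conditions: for a regular language \<open>K\<close> of words with
  marked positions, \<open>Unbd u K\<close> says that for every \<open>k\<close> some prefix of length at least \<open>k\<close> has a
  marking in \<open>K\<close> whose marked positions have total weight at least \<open>k\<close> in the unit \<open>u\<close> (the number
  of positions or a weight symbol). Infinite weights are treated by the finite control.

  A max-automaton computes the largest weight of a marking for each state of an automaton for \<open>K\<close>,
  so it can evaluate finitely many limit conditions; conversely the value of a counter is, up to a
  constant factor, the largest weight collected along a path of assignments, and such a path can be
  guessed by a finite automaton. A limit condition is expressed in the logic by the unbounding
  quantifiers and a set quantification over runs.

  The main step is that properties determined by finitely many limit conditions are closed under
  quantification over finite sets \<open>X\<close>. After the last element of \<open>X\<close> only the current joint state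
  of the conditions matters, and the finitely many reachable joint states evolve deterministically,
  as threads that may merge. Listing the threads by age, every thread eventually stays at a fixed
  position of the list, so that the truth of the conditions along the threads is again described by
  finitely many limit conditions, one family for each position.\<close>

subsection \<open>Regular languages\<close>

text \<open>The obstacle is projection. A max-automaton is deterministic, and a limit condition is
  evaluated along one run followed forever, whereas a set quantifier offers infinitely many runs.
  The set of joint states reachable so far can be updated deterministically, but it does not tell
  which of its members at different times belong to the same run; a position in the list does.
  Merging is harmless because the weight before a fixed time is finite, so that two runs which meet
  and read the same letters afterwards satisfy the same conditions. This is why infinite weights
  must be kept out of the limit conditions. A property is recognizable when the truth values of
  finitely many conditions determine it, rather than when it is written as a Boolean combination of
  them: Boolean closure is then immediate, and acceptance can be given as a set of truth vectors.
  The constant factor between counters and markings arises because a marking counts a position once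
  while a transition may add the same unit several times. It is harmless since only unboundedness is
  tested.\<close>

definition lq :: "'l list set \<Rightarrow> 'l list \<Rightarrow> 'l list set" where
  "lq L u = {v. u @ v \<in> L}"

text \<open>The Myhill-Nerode form of recognizability by a finite automaton. It keeps state types
  out of \<open>recog\<close>, and the quotients themselves serve as states later.\<close>

definition regular :: "'l list set \<Rightarrow> bool" where
  "regular L \<longleftrightarrow> finite (range (lq L))"

lemma lq_Nil [simp]: "lq L [] = L"
  by (simp add: lq_def)

lemma lq_append: "lq L (u @ v) = lq (lq L u) v"
  by (simp add: lq_def)

lemma Nil_in_lq [simp]: "[] \<in> lq L u \<longleftrightarrow> u \<in> L"
  by (simp add: lq_def)

text \<open>A quotient depends only on the state reached. The invariant \<open>Q\<close> takes the
  place of a finite state type, since states will be built from lists and sets over infinite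
  types.\<close>

lemma regular_foldl:
  assumes "finite Q" "s0 \<in> Q" "\<And>s a. s \<in> Q \<Longrightarrow> step s a \<in> Q"
  shows "regular {u. foldl step s0 u \<in> F}"
proof -
  have Q: "foldl step s0 u \<in> Q" for u
    by (induction u rule: rev_induct) (auto simp: assms)
  have "lq {u. foldl step s0 u \<in> F} u = (\<lambda>s. {v. foldl step s v \<in> F}) (foldl step s0 u)" for u
    by (simp add: lq_def)
  then have "range (lq {u. foldl step s0 u \<in> F}) \<subseteq> (\<lambda>s. {v. foldl step s v \<in> F}) ` Q"
    using Q by blast
  then show ?thesis
    unfolding regular_def using assms(1) by (meson finite_imageI finite_subset)
qed

text \<open>The first letter is renamed differently because the initial valuation of a sentence
  places every position variable at position \<open>0\<close>.\<close>

lemma regular_vimage_map_first: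
  assumes "regular L"
  shows "regular {u. (case u of [] \<Rightarrow> [] | a # v \<Rightarrow> f a # map g v) \<in> L}" (is "regular ?L")
proof -
  have "lq ?L (a # u) = (\<lambda>r. {v. map g v \<in> r}) (lq L (f a # map g u))" for a u
    by (simp add: lq_def)
  then have "lq ?L u \<in> insert ?L ((\<lambda>r. {v. map g v \<in> r}) ` range (lq L))" for u
    by (cases u) auto
  then have "range (lq ?L) \<subseteq> insert ?L ((\<lambda>r. {v. map g v \<in> r}) ` range (lq L))"
    by blast
  then show ?thesis
    using assms unfolding regular_def by (meson finite_imageI finite_insert finite_subset)
qed


subsection \<open>Limit conditions\<close>

definition pre :: "(nat \<Rightarrow> 'l) \<Rightarrow> nat \<Rightarrow> 'l list" where
  "pre \<alpha> n = map \<alpha> [0..<n]"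

definition mark :: "(nat \<Rightarrow> 'l) \<Rightarrow> nat set \<Rightarrow> nat \<Rightarrow> 'l \<times> bool" where
  "mark \<alpha> M n = (\<alpha> n, n \<in> M)"

lemma pre_0 [simp]: "pre \<alpha> 0 = []"
  by (simp add: pre_def)

lemma pre_Suc: "pre \<alpha> (Suc n) = pre \<alpha> n @ [\<alpha> n]"
  by (simp add: pre_def)

lemma pre_append: "t \<le> n \<Longrightarrow> pre \<alpha> n = pre \<alpha> t @ map \<alpha> [t..<n]"
  unfolding pre_def by (metis le_add_diff_inverse map_append upt_add_eq_append zero_le)

lemma pre_cong: "(\<And>i. i < n \<Longrightarrow> \<alpha> i = \<beta> i) \<Longrightarrow> pre \<alpha> n = pre \<beta> n"
  by (simp add: pre_def)

lemma map_fst_pre_mark [simp]: "map fst (pre (mark \<alpha> M) n) = pre \<alpha> n"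
  by (simp add: pre_def mark_def o_def)

lemma ex_pre_mark:
  assumes "map fst y = pre \<alpha> t"
  obtains M where "M \<subseteq> {..<t}" "y = pre (mark \<alpha> M) t"
proof
  have len: "length y = t"
    using assms by (metis length_map length_upt minus_nat.diff_0 pre_def)
  show "{i. i < t \<and> snd (y ! i)} \<subseteq> {..<t}" by auto
  show "y = pre (mark \<alpha> {i. i < t \<and> snd (y ! i)}) t"
  proof (rule nth_equalityI)
    fix i assume i: "i < length y"
    then have "fst (y ! i) = \<alpha> i"
      using assms len by (metis add.left_neutral diff_zero length_map length_upt nth_map nth_upt pre_def)
    then show "y ! i = pre (mark \<alpha> {i. i < t \<and> snd (y ! i)}) t ! i"
      using i len by (simp add: pre_def mark_def prod_eq_iff)
  qed (simp add: len pre_def)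
qed

text \<open>The weight unit \<open>None\<close> counts positions.\<close>

definition uw :: "('b \<Rightarrow> nat \<Rightarrow> nat) \<Rightarrow> 'b option \<Rightarrow> nat \<Rightarrow> nat" where
  "uw f u n = (case u of None \<Rightarrow> 1 | Some b \<Rightarrow> f b n)"

text \<open>The weights \<open>f\<close> are separate from the letters because finite automata read
  letters only; the two are linked through \<open>profile_at\<close> and \<open>fw\<close> once a
  weighted word is given.\<close>

definition Unbd ::
    "'b option \<Rightarrow> ('l \<times> bool) list set \<Rightarrow> (nat \<Rightarrow> 'l) \<Rightarrow> ('b \<Rightarrow> nat \<Rightarrow> nat) \<Rightarrow> bool" where
  "Unbd u K \<alpha> f \<longleftrightarrow>
     (\<forall>k. \<exists>n\<ge>k. \<exists>M\<subseteq>{..<n}. k \<le> sum (uw f u) M \<and> pre (mark \<alpha> M) n \<in> K)"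

text \<open>Only finitely much weight lies before a fixed time \<open>t\<close>, so it may be ignored.\<close>

lemma Unbd_shift:
  "Unbd u K \<alpha> f \<longleftrightarrow>
     (\<forall>k. \<exists>n\<ge>k. t \<le> n \<and> (\<exists>M\<subseteq>{t..<n}. \<exists>M0\<subseteq>{..<t}.
        k \<le> sum (uw f u) M \<and> pre (mark \<alpha> (M0 \<union> M)) n \<in> K))" (is "_ \<longleftrightarrow> ?R")
proof
  assume L: "Unbd u K \<alpha> f"
  show ?R
  proof
    fix k
    let ?k = "k + t + sum (uw f u) {..<t}"
    obtain n M where n: "n \<ge> ?k" "M \<subseteq> {..<n}" "?k \<le> sum (uw f u) M" "pre (mark \<alpha> M) n \<in> K"
      using L unfolding Unbd_def by blast
    have fin: "finite M" using n(2) finite_subset by blast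
    have un: "(M \<inter> {..<t}) \<union> (M \<inter> {t..<n}) = M" using n(2) by auto
    have "sum (uw f u) M = sum (uw f u) (M \<inter> {..<t}) + sum (uw f u) (M \<inter> {t..<n})"
      using fin by (subst sum.union_disjoint [symmetric]) (auto simp: un)
    moreover have "sum (uw f u) (M \<inter> {..<t}) \<le> sum (uw f u) {..<t}"
      by (rule sum_mono2) auto
    ultimately have "k \<le> sum (uw f u) (M \<inter> {t..<n})"
      using n(3) by linarith
    then show "\<exists>n\<ge>k. t \<le> n \<and> (\<exists>M\<subseteq>{t..<n}. \<exists>M0\<subseteq>{..<t}.
        k \<le> sum (uw f u) M \<and> pre (mark \<alpha> (M0 \<union> M)) n \<in> K)"
      using n(1,4) un by (intro exI[of _ n] conjI exI[of _ "M \<inter> {t..<n}"] exI[of _ "M \<inter> {..<t}"]) auto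
  qed
next
  assume R: ?R
  show "Unbd u K \<alpha> f"
    unfolding Unbd_def
  proof
    fix k
    obtain n M M0 where n: "n \<ge> k" "t \<le> n" "M \<subseteq> {t..<n}" "M0 \<subseteq> {..<t}" "k \<le> sum (uw f u) M"
      "pre (mark \<alpha> (M0 \<union> M)) n \<in> K" using R by blast
    have "sum (uw f u) M \<le> sum (uw f u) (M0 \<union> M)"
      using n(3,4) by (intro sum_mono2) (auto intro: finite_subset)
    then show "\<exists>n\<ge>k. \<exists>M\<subseteq>{..<n}. k \<le> sum (uw f u) M \<and> pre (mark \<alpha> M) n \<in> K"
      using n by (intro exI[of _ n] conjI exI[of _ "M0 \<union> M"]) auto
  qed
qed

section \<open>Buchi conditions as limit conditions\<close>

definition Inf_often :: "'l list set \<Rightarrow> (nat \<Rightarrow> 'l) \<Rightarrow> bool" where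
  "Inf_often L \<alpha> \<longleftrightarrow> (\<forall>m. \<exists>n\<ge>m. pre \<alpha> n \<in> L)"

text \<open>Only visits to \<open>L\<close> may be marked, so that with the unit \<open>None\<close>
  the weight of a marking counts visits: arbitrarily many of them exist exactly if there are
  infinitely many.\<close>

definition marked_in :: "'l list set \<Rightarrow> ('l \<times> bool) list set" where
  "marked_in L = {y. \<forall>i<length y. snd (y ! i) \<longrightarrow> map fst (take i y) \<in> L}"

lemma regular_marked_in:
  assumes "regular L"
  shows "regular (marked_in L)"
proof -
  define step :: "'a list set \<times> bool \<Rightarrow> 'a \<times> bool \<Rightarrow> 'a list set \<times> bool" where
    "step = (\<lambda>(r, ok) (a, m). (lq r [a], ok \<and> (m \<longrightarrow> [] \<in> r)))"
  have fold: "foldl step (L, True) y = (lq L (map fst y), y \<in> marked_in L)" for y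
  proof (induction y rule: rev_induct)
    case Nil
    show ?case by (simp add: marked_in_def)
  next
    case (snoc x y)
    have "y @ [x] \<in> marked_in L \<longleftrightarrow> y \<in> marked_in L \<and> (snd x \<longrightarrow> map fst y \<in> L)"
      by (auto simp: marked_in_def nth_append less_Suc_eq)
    then show ?case using snoc by (auto simp: step_def lq_append split: prod.split)
  qed
  have "regular {y. foldl step (L, True) y \<in> UNIV \<times> {True}}"
  proof (rule regular_foldl)
    show "finite (range (lq L) \<times> (UNIV :: bool set))"
      using assms unfolding regular_def by simp
    show "(L, True) \<in> range (lq L) \<times> UNIV" by (auto intro: range_eqI[of _ _ "[]"])
    show "step s a \<in> range (lq L) \<times> UNIV" if "s \<in> range (lq L) \<times> UNIV" for s a
      using that by (auto simp: step_def lq_append [symmetric] split: prod.split)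
  qed
  then show ?thesis by (simp add: fold)
qed

lemma Unbd_marked_in: "Unbd None (marked_in L) \<alpha> f \<longleftrightarrow> Inf_often L \<alpha>"
proof
  have mem: "pre (mark \<alpha> M) n \<in> marked_in L \<longleftrightarrow> (\<forall>i<n. i \<in> M \<longrightarrow> pre \<alpha> i \<in> L)" for M n
    by (auto simp: marked_in_def pre_def mark_def take_map o_def)
  {
    assume L: "Unbd None (marked_in L) \<alpha> f"
    show "Inf_often L \<alpha>"
      unfolding Inf_often_def
    proof
      fix m
      obtain n M where n: "M \<subseteq> {..<n}" "Suc m \<le> sum (uw f None) M" "pre (mark \<alpha> M) n \<in> marked_in L"
        using L unfolding Unbd_def by blast
      then have "Suc m \<le> card M" by (simp add: uw_def)
      then have "\<not> M \<subseteq> {..<m}"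
        by (metis Suc_n_not_le_n card_lessThan card_mono finite_lessThan le_trans)
      then obtain i where "i \<in> M" "i \<ge> m" by (meson lessThan_iff not_less subsetI)
      then show "\<exists>n\<ge>m. pre \<alpha> n \<in> L" using n(1,3) mem by blast
    qed
  }
  {
    assume "Inf_often L \<alpha>"
    then have inf: "infinite {n. pre \<alpha> n \<in> L}"
      unfolding Inf_often_def infinite_nat_iff_unbounded_le by blast
    show "Unbd None (marked_in L) \<alpha> f"
      unfolding Unbd_def
    proof
      fix k
      obtain M where M: "finite M" "card M = k" "M \<subseteq> {n. pre \<alpha> n \<in> L}"
        using inf infinite_arbitrarily_large by metis
      obtain n where n: "M \<subseteq> {..<n}" using M(1) finite_nat_iff_bounded by blast
      have "M \<subseteq> {..<max n k}" using n by auto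
      moreover have "k \<le> sum (uw f None) M" using M(2) by (simp add: uw_def)
      moreover have "pre (mark \<alpha> M) (max n k) \<in> marked_in L" using M(3) mem by blast
      ultimately show "\<exists>n\<ge>k. \<exists>M\<subseteq>{..<n}. k \<le> sum (uw f None) M \<and> pre (mark \<alpha> M) n \<in> marked_in L"
        by (meson max.cobounded2)
    qed
  }
qed


subsection \<open>Recognizable properties\<close>

text \<open>The hypothesis is symmetric in the two pairs of word and weights, so the one implication
  already yields the equivalence \<open>decidesD\<close>.\<close>

definition decides ::
    "('b option \<times> ('l \<times> bool) list set) set \<Rightarrow> ((nat \<Rightarrow> 'l) \<Rightarrow> ('b \<Rightarrow> nat \<Rightarrow> nat) \<Rightarrow> bool) \<Rightarrow> bool" where
  "decides J P \<longleftrightarrow> finite J \<and> (\<forall>(u, K)\<in>J. regular K) \<and>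
     (\<forall>\<alpha> f \<beta> g. (\<forall>(u, K)\<in>J. Unbd u K \<alpha> f \<longleftrightarrow> Unbd u K \<beta> g) \<longrightarrow> P \<alpha> f \<longrightarrow> P \<beta> g)"

definition recog :: "((nat \<Rightarrow> 'l) \<Rightarrow> ('b \<Rightarrow> nat \<Rightarrow> nat) \<Rightarrow> bool) \<Rightarrow> bool" where
  "recog P \<longleftrightarrow> (\<exists>J. decides J P)"

lemma decidesD:
  assumes "decides J P" "\<And>u K. (u, K) \<in> J \<Longrightarrow> Unbd u K \<alpha> f \<longleftrightarrow> Unbd u K \<beta> g"
  shows "P \<alpha> f \<longleftrightarrow> P \<beta> g"
proof -
  have "\<forall>(u, K)\<in>J. Unbd u K \<alpha> f \<longleftrightarrow> Unbd u K \<beta> g" "\<forall>(u, K)\<in>J. Unbd u K \<beta> g \<longleftrightarrow> Unbd u K \<alpha> f"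
    using assms(2) by auto
  then show ?thesis using assms(1) unfolding decides_def by meson
qed

lemma recog_Unbd:
  assumes "regular K"
  shows "recog (Unbd u K)"
proof -
  have "decides {(u, K)} (Unbd u K)"
    unfolding decides_def using assms by auto
  then show ?thesis unfolding recog_def by blast
qed

text \<open>Determination is transitive. Most closure properties below are instances for a suitable
  finite family \<open>A\<close>.\<close>

lemma recog_determined:
  assumes "finite I" "\<And>i. i \<in> I \<Longrightarrow> recog (A i)"
    and det: "\<And>\<alpha> f \<beta> g. (\<And>i. i \<in> I \<Longrightarrow> A i \<alpha> f \<longleftrightarrow> A i \<beta> g) \<Longrightarrow> P \<alpha> f \<Longrightarrow> P \<beta> g"
  shows "recog P"
proof -
  obtain J where J: "\<And>i. i \<in> I \<Longrightarrow> decides (J i) (A i)"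
    using assms(2) unfolding recog_def by metis
  have "decides (\<Union>i\<in>I. J i) P"
    unfolding decides_def
  proof (intro conjI allI impI)
    show "finite (\<Union>i\<in>I. J i)" using assms(1) J unfolding decides_def by blast
    show "\<forall>(u, K)\<in>\<Union>i\<in>I. J i. regular K" using J unfolding decides_def by blast
    fix \<alpha> f \<beta> g
    assume eq: "\<forall>(u, K)\<in>\<Union>i\<in>I. J i. Unbd u K \<alpha> f \<longleftrightarrow> Unbd u K \<beta> g" and P: "P \<alpha> f"
    have "A i \<alpha> f \<longleftrightarrow> A i \<beta> g" if "i \<in> I" for i
      by (rule decidesD[OF J[OF that]]) (use eq that in blast)
    then show "P \<beta> g" using det P by blast
  qed
  then show ?thesis unfolding recog_def by blast
qed

lemma recog_neg: "recog P \<Longrightarrow> recog (\<lambda>\<alpha> f. \<not> P \<alpha> f)"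
  by (rule recog_determined[where I = "{()}" and A = "\<lambda>_. P"]) auto

lemma recog_disj:
  assumes "recog P" "recog Q"
  shows "recog (\<lambda>\<alpha> f. P \<alpha> f \<or> Q \<alpha> f)"
proof (rule recog_determined[where I = "{True, False}" and A = "\<lambda>i. if i then P else Q"])
  fix \<alpha> f \<beta> g
  assume eq: "\<And>i. i \<in> {True, False} \<Longrightarrow> (if i then P else Q) \<alpha> f = (if i then P else Q) \<beta> g"
    and "P \<alpha> f \<or> Q \<alpha> f"
  then show "P \<beta> g \<or> Q \<beta> g" using eq[of True] eq[of False] by auto
qed (use assms in auto)

lemma recog_conj: "recog P \<Longrightarrow> recog Q \<Longrightarrow> recog (\<lambda>\<alpha> f. P \<alpha> f \<and> Q \<alpha> f)"
  using recog_neg[OF recog_disj[OF recog_neg[of P] recog_neg[of Q]]] by simp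

lemma recog_Inf_often:
  assumes "regular L"
  shows "recog (\<lambda>\<alpha> (f :: 'b \<Rightarrow> nat \<Rightarrow> nat). Inf_often L \<alpha>)"
proof -
  have "Unbd None (marked_in L) = (\<lambda>\<alpha> (f :: 'b \<Rightarrow> nat \<Rightarrow> nat). Inf_often L \<alpha>)"
    by (intro ext) (simp add: Unbd_marked_in)
  then show ?thesis using recog_Unbd[OF regular_marked_in[OF assms], of "None :: 'b option"] by simp
qed

text \<open>A letterwise relabelling changes neither lengths nor marks nor weights, so it can be
  pushed into the language of each condition.\<close>

lemma recog_map_first:
  assumes "recog P"
  shows "recog (\<lambda>\<alpha> f. P (\<lambda>n. if n = 0 then h (\<alpha> 0) else k (\<alpha> n)) f)"
proof -
  obtain J where J: "decides J P"
    using assms unfolding recog_def by blast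
  let ?W = "\<lambda>\<alpha> n. if n = 0 then h (\<alpha> 0) else k (\<alpha> n)"
  let ?c = "\<lambda>u. case u of [] \<Rightarrow> [] | a # v \<Rightarrow> map_prod h id a # map (map_prod k id) v"
  have pre: "?c (pre (mark \<alpha> M) n) = pre (mark (?W \<alpha>) M) n" for \<alpha> M n
  proof (cases n)
    case (Suc m)
    have "[0..<Suc m] = 0 # [Suc 0..<Suc m]" using upt_rec by auto
    then show ?thesis using Suc by (simp add: pre_def mark_def del: upt_Suc)
  qed simp
  have Unbd: "Unbd u K (?W \<alpha>) f \<longleftrightarrow> Unbd u {y. ?c y \<in> K} \<alpha> f" for u K \<alpha> f
    by (simp add: Unbd_def pre)
  show ?thesis
  proof (rule recog_determined[where I = J and A = "\<lambda>(u, K) \<alpha> f. Unbd u K (?W \<alpha>) f"])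
    fix i assume "i \<in> J"
    moreover obtain u K where i: "i = (u, K)" by (cases i)
    ultimately have "regular K" using J unfolding decides_def by blast
    from recog_Unbd[OF regular_vimage_map_first[OF this]]
    show "recog (case i of (u, K) \<Rightarrow> \<lambda>\<alpha> f. Unbd u K (?W \<alpha>) f)"
      by (simp add: Unbd i)
  next
    fix \<alpha> f \<beta> g
    assume eq: "\<And>i. i \<in> J \<Longrightarrow> (case i of (u, K) \<Rightarrow> \<lambda>\<alpha> f. Unbd u K (?W \<alpha>) f) \<alpha> f =
       (case i of (u, K) \<Rightarrow> \<lambda>\<alpha> f. Unbd u K (?W \<alpha>) f) \<beta> g" and P: "P (?W \<alpha>) f"
    have "P (?W \<alpha>) f \<longleftrightarrow> P (?W \<beta>) g"
      by (rule decidesD[OF J]) (use eq in fastforce)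
    then show "P (?W \<beta>) g" using P by simp
  qed (use J in \<open>simp add: decides_def\<close>)
qed

lemma recog_map:
  fixes P :: "(nat \<Rightarrow> 'l) \<Rightarrow> ('b \<Rightarrow> nat \<Rightarrow> nat) \<Rightarrow> bool" and h :: "'m \<Rightarrow> 'l"
  assumes "recog P"
  shows "recog (\<lambda>\<alpha> f. P (\<lambda>n. h (\<alpha> n)) f)"
proof -
  have "(\<lambda>n. if n = 0 then h (\<alpha> 0) else h (\<alpha> n)) = (\<lambda>n. h (\<alpha> n))" for \<alpha> :: "nat \<Rightarrow> 'm"
    by auto
  then show ?thesis using recog_map_first[OF assms, of h h] by simp
qed

subsection \<open>Priority lists of threads\<close>

text \<open>\<open>remdups\<close> keeps the last occurrence; the two reversals make the first one,
  that is the oldest thread, survive.\<close>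

definition dedup :: "'s list \<Rightarrow> 's list" where
  "dedup xs = rev (remdups (rev xs))"

lemma set_dedup [simp]: "set (dedup xs) = set xs"
  and distinct_dedup [simp]: "distinct (dedup xs)"
  and dedup_distinct: "distinct xs \<Longrightarrow> dedup xs = xs"
  by (simp_all add: dedup_def distinct_remdups_id)

lemma length_dedup: "length (dedup xs) \<le> length xs"
  by (simp add: dedup_def length_remdups_card_conv card_length)

lemma length_dedup_less: "\<not> distinct xs \<Longrightarrow> length (dedup xs) < length xs"
  unfolding dedup_def length_rev length_remdups_card_conv set_rev
  by (metis card_distinct card_length le_neq_implies_less)

lemma dedup_append:
  fixes xs ys :: "'a list"
  shows "\<exists>zs. dedup (xs @ ys) = dedup xs @ zs"
proof -
  have "\<exists>zs. remdups (us @ vs) = zs @ remdups vs" for us vs :: "'a list"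
    by (induction us) auto
  then obtain zs where "remdups (rev ys @ rev xs) = zs @ remdups (rev xs)" by blast
  then have "dedup (xs @ ys) = dedup xs @ rev zs" by (simp add: dedup_def)
  then show ?thesis by blast
qed

text \<open>A thread is a run that from some time on reads only letters with bit \<open>False\<close>. All threads
  are kept in one list, older threads first; of two threads that meet, only the older survives, so
  the position of a thread in the list never increases.\<close>

definition lstep :: "('s \<Rightarrow> 'l \<times> bool \<Rightarrow> 's) \<Rightarrow> 's list \<Rightarrow> 'l \<Rightarrow> 's list" where
  "lstep g l a = dedup (map (\<lambda>q. g q (a, False)) l @ map (\<lambda>q. g q (a, True)) l)"

definition threads :: "('s \<Rightarrow> 'l \<times> bool \<Rightarrow> 's) \<Rightarrow> 's \<Rightarrow> (nat \<Rightarrow> 'l) \<Rightarrow> nat \<Rightarrow> 's list" where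
  "threads g s0 \<alpha> n = foldl (lstep g) [s0] (pre \<alpha> n)"

text \<open>In an undisturbed step the threads up to slot \<open>i\<close> neither merge nor move. A
  missing slot counts as disturbed, so that a slot which is never disturbed again is also
  occupied.\<close>

definition disturbed :: "('s \<Rightarrow> 'l \<times> bool \<Rightarrow> 's) \<Rightarrow> nat \<Rightarrow> 's list \<Rightarrow> 'l \<Rightarrow> bool" where
  "disturbed g i l a \<longleftrightarrow>
     \<not> (i < length l \<and> distinct (map (\<lambda>q. g q (a, False)) (take (Suc i) l)))"

lemma threads_0 [simp]: "threads g s0 \<alpha> 0 = [s0]"
  by (simp add: threads_def)

lemma threads_Suc: "threads g s0 \<alpha> (Suc n) = lstep g (threads g s0 \<alpha> n) (\<alpha> n)"
  by (simp add: threads_def pre_Suc)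

lemma pre_mark_Suc: "pre (mark \<alpha> X) (Suc n) = pre (mark \<alpha> X) n @ [(\<alpha> n, n \<in> X)]"
  by (simp add: pre_Suc mark_def)

lemma run_in_threads: "foldl g s0 (pre (mark \<alpha> X) n) \<in> set (threads g s0 \<alpha> n)"
proof (induction n)
  case (Suc n)
  then show ?case
    by (cases "n \<in> X") (auto simp: threads_Suc lstep_def pre_mark_Suc)
qed simp

lemma in_threadsE:
  assumes "q \<in> set (threads g s0 \<alpha> n)"
  obtains X where "X \<subseteq> {..<n}" "q = foldl g s0 (pre (mark \<alpha> X) n)"
proof -
  have "\<exists>X\<subseteq>{..<n}. q = foldl g s0 (pre (mark \<alpha> X) n)"
    using assms
  proof (induction n arbitrary: q)
    case (Suc n)
    from Suc.prems obtain q' b where q': "q' \<in> set (threads g s0 \<alpha> n)" "q = g q' (\<alpha> n, b)"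
      by (auto simp: threads_Suc lstep_def)
    then obtain X where X: "X \<subseteq> {..<n}" "q' = foldl g s0 (pre (mark \<alpha> X) n)"
      using Suc.IH by blast
    let ?Y = "if b then insert n X else X"
    have "pre (mark \<alpha> ?Y) n = pre (mark \<alpha> X) n"
      by (rule pre_cong) (simp add: mark_def)
    moreover have "n \<in> ?Y \<longleftrightarrow> b" using X(1) by auto
    ultimately have "q = foldl g s0 (pre (mark \<alpha> ?Y) (Suc n))"
      using q' X by (simp add: pre_mark_Suc)
    moreover have "?Y \<subseteq> {..<Suc n}" using X(1) by auto
    ultimately show ?case by blast
  qed simp
  then show ?thesis using that by blast
qed

text \<open>\<open>dedup\<close> leaves a distinct prefix in place, and the first
  \<open>Suc i\<close> successors form one.\<close>

lemma undisturbed_step: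
  assumes "\<not> disturbed g i l a"
  shows "i < length (lstep g l a) \<and> lstep g l a ! i = g (l ! i) (a, False)"
proof -
  let ?h = "\<lambda>q. g q (a, False)"
  have i: "i < length l" and d: "distinct (map ?h (take (Suc i) l))"
    using assms by (auto simp: disturbed_def)
  have "lstep g l a = dedup (map ?h (take (Suc i) l) @ map ?h (drop (Suc i) l) @ map (\<lambda>q. g q (a, True)) l)"
    unfolding lstep_def by (metis append_assoc append_take_drop_id map_append)
  then obtain zs where "lstep g l a = map ?h (take (Suc i) l) @ zs"
    using dedup_append dedup_distinct[OF d] by metis
  then show ?thesis using i by (simp add: nth_append)
qed

text \<open>The deduplicated successors of the slots up to \<open>i\<close> form the front of the
  new list. A repetition among them shortens this front, which pushes the successor of slot
  \<open>i\<close> strictly down.\<close>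

lemma thread_step:
  assumes "i < length l"
  obtains i' where "i' \<le> i" "i' < length (lstep g l a)" "lstep g l a ! i' = g (l ! i) (a, False)"
    "disturbed g i l a \<Longrightarrow> i' < i"
proof -
  let ?h = "\<lambda>q. g q (a, False)"
  let ?ys = "map ?h (take (Suc i) l)"
  have "lstep g l a = dedup (?ys @ map ?h (drop (Suc i) l) @ map (\<lambda>q. g q (a, True)) l)"
    unfolding lstep_def by (metis append_assoc append_take_drop_id map_append)
  then obtain zs where zs: "lstep g l a = dedup ?ys @ zs"
    using dedup_append by metis
  have "l ! i \<in> set (take (Suc i) l)" using assms by (auto simp: in_set_conv_nth intro!: exI[of _ i])
  then have "g (l ! i) (a, False) \<in> set (dedup ?ys)" by simp
  then obtain i' where i': "i' < length (dedup ?ys)" "dedup ?ys ! i' = g (l ! i) (a, False)"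
    by (meson in_set_conv_nth)
  have len: "length ?ys = Suc i" using assms by simp
  show ?thesis
  proof (rule that[of i'])
    show "i' \<le> i" using i'(1) length_dedup[of ?ys] len by linarith
    show "i' < length (lstep g l a)" using i'(1) zs by simp
    show "lstep g l a ! i' = g (l ! i) (a, False)" using i' zs by (simp add: nth_append)
    assume "disturbed g i l a"
    then have "\<not> distinct ?ys" using assms unfolding disturbed_def by blast
    then show "i' < i" using i'(1) length_dedup_less[of ?ys] len by linarith
  qed
qed

section \<open>Stable slots\<close>

definition stable :: "('s \<Rightarrow> 'l \<times> bool \<Rightarrow> 's) \<Rightarrow> 's \<Rightarrow> nat \<Rightarrow> (nat \<Rightarrow> 'l) \<Rightarrow> bool" where
  "stable g s0 i \<alpha> \<longleftrightarrow> (\<exists>N. \<forall>n\<ge>N. \<not> disturbed g i (threads g s0 \<alpha> n) (\<alpha> n))"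

definition at_slot :: "('s \<Rightarrow> 'l \<times> bool \<Rightarrow> 's) \<Rightarrow> 's \<Rightarrow> nat \<Rightarrow> (nat \<Rightarrow> 'l) \<Rightarrow> nat set \<Rightarrow> nat \<Rightarrow> bool" where
  "at_slot g s0 i \<alpha> X n \<longleftrightarrow>
     i < length (threads g s0 \<alpha> n) \<and> threads g s0 \<alpha> n ! i = foldl g s0 (pre (mark \<alpha> X) n)"

lemma at_slot_Suc:
  assumes "at_slot g s0 i \<alpha> X n" "n \<notin> X" "\<not> disturbed g i (threads g s0 \<alpha> n) (\<alpha> n)"
  shows "at_slot g s0 i \<alpha> X (Suc n)"
  using assms undisturbed_step[OF assms(3)] by (auto simp: at_slot_def threads_Suc pre_mark_Suc)

lemma at_slot_forever:
  assumes "at_slot g s0 i \<alpha> X t" "X \<subseteq> {..<t}" "\<And>n. t \<le> n \<Longrightarrow> \<not> disturbed g i (threads g s0 \<alpha> n) (\<alpha> n)"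
    "t \<le> n"
  shows "at_slot g s0 i \<alpha> X n"
  using assms(4)
proof (induction n rule: dec_induct)
  case (step n)
  then show ?case using assms(2,3) by (intro at_slot_Suc) auto
qed (fact assms(1))

text \<open>After the last element of \<open>X\<close> the slot of its run never increases and drops
  at every disturbance. The least slot occupied from then on is therefore kept forever and is
  undisturbed.\<close>

lemma finite_eventually_at_stable_slot:
  assumes "finite X"
  obtains i N where "\<And>n. N \<le> n \<Longrightarrow> \<not> disturbed g i (threads g s0 \<alpha> n) (\<alpha> n)"
    "\<And>n. N \<le> n \<Longrightarrow> at_slot g s0 i \<alpha> X n"
proof -
  obtain B where B: "X \<subseteq> {..<B}" using assms finite_nat_iff_bounded by blast
  let ?R = "\<lambda>i. \<exists>n\<ge>B. at_slot g s0 i \<alpha> X n"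
  have "\<exists>i. at_slot g s0 i \<alpha> X B"
    using run_in_threads[of g s0 \<alpha> X B] unfolding at_slot_def by (meson in_set_conv_nth)
  then have ex: "\<exists>i. ?R i" by blast
  define i where "i = (LEAST i. ?R i)"
  have R: "?R i" unfolding i_def using ex by (rule LeastI_ex)
  have least: "i \<le> i'" if "?R i'" for i' unfolding i_def using that by (rule Least_le)
  obtain N where N: "N \<ge> B" "at_slot g s0 i \<alpha> X N" using R by blast
  have s1: "at_slot g s0 i \<alpha> X (Suc n) \<and> \<not> disturbed g i (threads g s0 \<alpha> n) (\<alpha> n)"
    if n: "n \<ge> B" "at_slot g s0 i \<alpha> X n" for n
  proof -
    have i: "i < length (threads g s0 \<alpha> n)" "threads g s0 \<alpha> n ! i = foldl g s0 (pre (mark \<alpha> X) n)"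
      using n(2) by (auto simp: at_slot_def)
    obtain i' where i': "i' \<le> i" "i' < length (lstep g (threads g s0 \<alpha> n) (\<alpha> n))"
      "lstep g (threads g s0 \<alpha> n) (\<alpha> n) ! i' = g (threads g s0 \<alpha> n ! i) (\<alpha> n, False)"
      "disturbed g i (threads g s0 \<alpha> n) (\<alpha> n) \<Longrightarrow> i' < i"
      using thread_step[OF i(1)] by metis
    have "n \<notin> X" using B n(1) by auto
    then have at: "at_slot g s0 i' \<alpha> X (Suc n)"
      using i i' by (simp add: at_slot_def threads_Suc pre_mark_Suc)
    then have "i \<le> i'" using least[of i'] n(1) by (meson le_SucI)
    then show ?thesis using i'(1,4) at by (metis le_antisym linorder_not_le)
  qed
  have at: "at_slot g s0 i \<alpha> X n" if "N \<le> n" for n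
    using that
  proof (induction n rule: dec_induct)
    case (step n)
    then show ?case using N(1) s1 by auto
  qed (fact N(2))
  show ?thesis using that[of N i] at s1 N(1) by force
qed

lemma finite_distinct_lists: "finite Q \<Longrightarrow> finite {l. set l \<subseteq> Q \<and> distinct l}"
  by (rule finite_subset[OF _ finite_lists_length_le[of Q "card Q"]])
     (auto simp: distinct_card[symmetric] intro: card_mono)

lemma lstep_closed:
  assumes "\<And>s a. s \<in> Q \<Longrightarrow> g s a \<in> Q" "set l \<subseteq> Q"
  shows "set (lstep g l a) \<subseteq> Q" "distinct (lstep g l a)"
  using assms by (auto simp: lstep_def)

text \<open>The flag \<open>d\<close> tells whether the last letter disturbed slot \<open>i\<close>,
  which makes instability the Buchi condition of an automaton that maintains the list.\<close>

lemma recog_stable: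
  fixes g :: "'s \<Rightarrow> 'l \<times> bool \<Rightarrow> 's"
  assumes Q: "finite Q" "s0 \<in> Q" "\<And>s a. s \<in> Q \<Longrightarrow> g s a \<in> Q"
  shows "recog (\<lambda>\<alpha> (f :: 'b \<Rightarrow> nat \<Rightarrow> nat). stable g s0 i \<alpha>)"
proof -
  define step where "step = (\<lambda>(l, d :: bool) a. (lstep g l a, disturbed g i l a))"
  define L where "L = {u. foldl step ([s0], False) u \<in> UNIV \<times> {True}}"
  have fst: "fst (foldl step ([s0], False) u) = foldl (lstep g) [s0] u" for u
    by (induction u rule: rev_induct) (auto simp: step_def split: prod.split)
  have mem: "pre \<alpha> (Suc n) \<in> L \<longleftrightarrow> disturbed g i (threads g s0 \<alpha> n) (\<alpha> n)" for \<alpha> n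
  proof -
    obtain l d where ld: "foldl step ([s0], False) (pre \<alpha> n) = (l, d)" by fastforce
    then have "l = threads g s0 \<alpha> n" using fst[of "pre \<alpha> n"] by (simp add: threads_def)
    then show ?thesis by (simp add: L_def pre_Suc ld) (simp add: step_def)
  qed
  have "Inf_often L \<alpha> \<longleftrightarrow> \<not> stable g s0 i \<alpha>" for \<alpha>
  proof
    assume L: "Inf_often L \<alpha>"
    show "\<not> stable g s0 i \<alpha>"
      unfolding stable_def
    proof clarify
      fix N assume N: "\<forall>n\<ge>N. \<not> disturbed g i (threads g s0 \<alpha> n) (\<alpha> n)"
      obtain n where n: "n \<ge> Suc N" "pre \<alpha> n \<in> L" using L unfolding Inf_often_def by blast
      then obtain m where "n = Suc m" by (cases n) auto
      then show False using N n mem[of \<alpha> m] by auto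
    qed
  next
    assume S: "\<not> stable g s0 i \<alpha>"
    show "Inf_often L \<alpha>"
      unfolding Inf_often_def
    proof
      fix m
      obtain n where "n \<ge> m" "disturbed g i (threads g s0 \<alpha> n) (\<alpha> n)"
        using S unfolding stable_def by blast
      then show "\<exists>n\<ge>m. pre \<alpha> n \<in> L" using mem[of \<alpha> n] by (meson le_SucI)
    qed
  qed
  then have eq: "stable g s0 i \<alpha> \<longleftrightarrow> \<not> Inf_often L \<alpha>" for \<alpha> by simp
  have "regular L"
    unfolding L_def
  proof (rule regular_foldl)
    show "finite ({l. set l \<subseteq> Q \<and> distinct l} \<times> (UNIV :: bool set))"
      using finite_distinct_lists[OF Q(1)] by simp
    show "([s0], False) \<in> {l. set l \<subseteq> Q \<and> distinct l} \<times> UNIV" using Q(2) by simp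
    show "step s a \<in> {l. set l \<subseteq> Q \<and> distinct l} \<times> UNIV"
      if "s \<in> {l. set l \<subseteq> Q \<and> distinct l} \<times> UNIV" for s a
      using that lstep_closed[of Q g "fst s" a] Q(3) by (auto simp: step_def split: prod.split)
  qed
  from recog_neg[OF recog_Inf_often[OF this]] show ?thesis by (simp only: eq)
qed

definition slot_lang :: "('s \<Rightarrow> 'l \<times> bool \<Rightarrow> 's) \<Rightarrow> 's \<Rightarrow> nat \<Rightarrow> ('l \<times> bool) list set" where
  "slot_lang g s0 i = {y. let l = foldl (lstep g) [s0] (map fst y)
                          in i < length l \<and> l ! i = foldl g s0 y}"

lemma in_slot_lang: "pre (mark \<alpha> X) n \<in> slot_lang g s0 i \<longleftrightarrow> at_slot g s0 i \<alpha> X n"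
  by (simp add: slot_lang_def at_slot_def threads_def Let_def)

lemma regular_slot_lang:
  fixes g :: "'s \<Rightarrow> 'l \<times> bool \<Rightarrow> 's"
  assumes Q: "finite Q" "s0 \<in> Q" "\<And>s a. s \<in> Q \<Longrightarrow> g s a \<in> Q"
  shows "regular (slot_lang g s0 i)"
proof -
  define step where "step = (\<lambda>(l, q) a. (lstep g l (fst a), g q a))"
  have fold: "foldl step ([s0], s0) y = (foldl (lstep g) [s0] (map fst y), foldl g s0 y)" for y
    by (induction y rule: rev_induct) (auto simp: step_def)
  have "regular {y. foldl step ([s0], s0) y \<in> {(l, q). i < length l \<and> l ! i = q}}"
  proof (rule regular_foldl)
    show "finite ({l. set l \<subseteq> Q \<and> distinct l} \<times> Q)"
      using finite_distinct_lists[OF Q(1)] Q(1) by simp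
    show "([s0], s0) \<in> {l. set l \<subseteq> Q \<and> distinct l} \<times> Q" using Q(2) by simp
    show "step s a \<in> {l. set l \<subseteq> Q \<and> distinct l} \<times> Q"
      if "s \<in> {l. set l \<subseteq> Q \<and> distinct l} \<times> Q" for s a
    proof -
      obtain l q where s: "s = (l, q)" by fastforce
      then show ?thesis using that lstep_closed[of Q g l "fst a"] Q(3) by (simp add: step_def)
    qed
  qed
  then show ?thesis unfolding slot_lang_def by (simp add: fold Let_def)
qed


subsection \<open>Joint states of a family of limit conditions\<close>

text \<open>A joint state contains \<open>(j, r)\<close> if some choice of marks leads the condition \<open>j\<close> to the
  quotient \<open>r\<close>.\<close>

definition qstep :: "('j \<times> ('m \<times> bool) list set) set \<Rightarrow> 'm \<Rightarrow> ('j \<times> ('m \<times> bool) list set) set" where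
  "qstep q a = {(j, lq r [(a, m)]) | j r m. (j, r) \<in> q}"

definition qinit :: "('u \<times> ('m \<times> bool) list set) set \<Rightarrow>
    (('u \<times> ('m \<times> bool) list set) \<times> ('m \<times> bool) list set) set" where
  "qinit J = {(j, snd j) | j. j \<in> J}"

definition quniv :: "('u \<times> ('m \<times> bool) list set) set \<Rightarrow>
    (('u \<times> ('m \<times> bool) list set) \<times> ('m \<times> bool) list set) set" where
  "quniv J = {(j, lq (snd j) y) | j y. j \<in> J}"

lemma foldl_qstep: "foldl qstep q z = {(j, lq r y) | j r y. (j, r) \<in> q \<and> map fst y = z}"
proof (induction z rule: rev_induct)
  case (snoc a z)
  show ?case
  proof (intro set_eqI iffI)
    fix x assume "x \<in> foldl qstep q (z @ [a])"
    then obtain j r m where x: "x = (j, lq r [(a, m)])" "(j, r) \<in> foldl qstep q z"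
      by (auto simp: qstep_def)
    then obtain r' y where "r = lq r' y" "(j, r') \<in> q" "map fst y = z" using snoc by auto
    then have "x = (j, lq r' (y @ [(a, m)])) \<and> (j, r') \<in> q \<and> map fst (y @ [(a, m)]) = z @ [a]"
      using x by (simp add: lq_append)
    then show "x \<in> {(j, lq r y) | j r y. (j, r) \<in> q \<and> map fst y = z @ [a]}" by blast
  next
    fix x assume "x \<in> {(j, lq r y) | j r y. (j, r) \<in> q \<and> map fst y = z @ [a]}"
    then obtain j r y where x: "x = (j, lq r y)" "(j, r) \<in> q" "map fst y = z @ [a]" by blast
    then obtain y' m where y: "y = y' @ [(a, m)]" "map fst y' = z"
      by (auto simp: map_eq_append_conv)
    then have "(j, lq r y') \<in> foldl qstep q z" using x snoc by auto
    then show "x \<in> foldl qstep q (z @ [a])" using x y by (auto simp: qstep_def lq_append)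
  qed
qed auto

lemma finite_quniv:
  assumes "finite J" "\<forall>(u, K)\<in>J. regular K"
  shows "finite (quniv J)"
proof -
  have "quniv J \<subseteq> (\<Union>j\<in>J. {j} \<times> range (lq (snd j)))" by (auto simp: quniv_def)
  moreover have "finite (\<Union>j\<in>J. {j} \<times> range (lq (snd j)))"
    using assms by (auto simp: regular_def)
  ultimately show ?thesis by (rule finite_subset)
qed

lemma qinit_subset: "qinit J \<subseteq> quniv J"
  by (auto simp: qinit_def quniv_def intro!: exI[of _ "[]"])

lemma quniv_lq: "(j, r) \<in> quniv J \<Longrightarrow> (j, lq r y) \<in> quniv J"
  by (auto simp: quniv_def lq_append[symmetric])

lemma qstep_subset: "q \<subseteq> quniv J \<Longrightarrow> qstep q a \<subseteq> quniv J"
  using quniv_lq by (fastforce simp: qstep_def)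

lemma foldl_qinit: "foldl qstep (qinit J) z = {(j, lq (snd j) y) | j y. j \<in> J \<and> map fst y = z}"
  unfolding foldl_qstep qinit_def by auto

section \<open>The dependence of a limit condition on the past\<close>

definition tail_unbd :: "'b option \<Rightarrow> nat \<Rightarrow> ('m \<times> bool) list set set \<Rightarrow> (nat \<Rightarrow> 'm) \<Rightarrow>
    ('b \<Rightarrow> nat \<Rightarrow> nat) \<Rightarrow> bool" where
  "tail_unbd u t R \<beta> f \<longleftrightarrow> (\<forall>k. \<exists>n\<ge>k. t \<le> n \<and> (\<exists>M\<subseteq>{t..<n}. k \<le> sum (uw f u) M \<and>
     (\<exists>r\<in>R. map (mark \<beta> M) [t..<n] \<in> r)))"

lemma tail_unbd_cong:
  assumes "\<And>n. t \<le> n \<Longrightarrow> \<beta> n = \<gamma> n"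
  shows "tail_unbd u t R \<beta> f \<longleftrightarrow> tail_unbd u t R \<gamma> f"
proof -
  have "map (mark \<beta> M) [t..<n] = map (mark \<gamma> M) [t..<n]" for M n
    by (simp add: mark_def assms)
  then show ?thesis by (simp only: tail_unbd_def)
qed

lemma pre_mark_Un:
  assumes "t \<le> n" "M \<subseteq> {t..<n}" "M0 \<subseteq> {..<t}"
  shows "pre (mark \<beta> (M0 \<union> M)) n = pre (mark \<beta> M0) t @ map (mark \<beta> M) [t..<n]"
proof -
  have "pre (mark \<beta> (M0 \<union> M)) t = pre (mark \<beta> M0) t"
    using assms(2) by (intro pre_cong) (auto simp: mark_def)
  moreover have "map (mark \<beta> (M0 \<union> M)) [t..<n] = map (mark \<beta> M) [t..<n]"
    using assms(3) by (intro map_cong) (auto simp: mark_def)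
  ultimately show ?thesis using pre_append[OF assms(1)] by metis
qed

text \<open>By \<open>Unbd_shift\<close> the marks before \<open>t\<close> owe no weight; they
  merely select a quotient. Hence the past enters only through the set of quotients to which it can
  lead, which is what a joint state stores.\<close>

lemma Unbd_tail:
  "Unbd u K \<beta> f \<longleftrightarrow> tail_unbd u t {lq K y | y. map fst y = pre \<beta> t} \<beta> f" (is "_ \<longleftrightarrow> tail_unbd u t ?R \<beta> f")
proof -
  have "(\<exists>M0\<subseteq>{..<t}. k \<le> sum (uw f u) M \<and> pre (mark \<beta> (M0 \<union> M)) n \<in> K) \<longleftrightarrow>
        k \<le> sum (uw f u) M \<and> (\<exists>r\<in>?R. map (mark \<beta> M) [t..<n] \<in> r)" (is "?A \<longleftrightarrow> ?B")
    if "t \<le> n" "M \<subseteq> {t..<n}" for k M n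
  proof
    assume ?A
    then obtain M0 where M0: "M0 \<subseteq> {..<t}" "k \<le> sum (uw f u) M" "pre (mark \<beta> (M0 \<union> M)) n \<in> K" by blast
    then have "map (mark \<beta> M) [t..<n] \<in> lq K (pre (mark \<beta> M0) t)"
      using pre_mark_Un[OF that M0(1), of \<beta>] by (simp add: lq_def)
    then show ?B using M0(2) by force
  next
    assume ?B
    then obtain y where y: "k \<le> sum (uw f u) M" "map fst y = pre \<beta> t" "map (mark \<beta> M) [t..<n] \<in> lq K y"
      by blast
    obtain M0 where M0: "M0 \<subseteq> {..<t}" "y = pre (mark \<beta> M0) t" using ex_pre_mark[OF y(2)] by blast
    have "pre (mark \<beta> (M0 \<union> M)) n \<in> K"
      using y(3) unfolding pre_mark_Un[OF that M0(1)] M0(2) by (simp add: lq_def)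
    then show ?A using y(1) M0(1) by blast
  qed
  then show ?thesis
    unfolding Unbd_shift[of u K \<beta> f t] tail_unbd_def by (meson)
qed

text \<open>The empty set is a safe default for a missing slot: such a slot counts as disturbed, so
  \<open>slot_step\<close> restarts from the new list in the very step in which the slot
  appears.\<close>

definition slot_comp :: "'j \<Rightarrow> ('j \<times> 'r) set list \<Rightarrow> nat \<Rightarrow> 'r set" where
  "slot_comp j l i = (if i < length l then {r. (j, r) \<in> l ! i} else {})"

text \<open>A letter of the condition \<open>j\<close> carries two bits: the inner one is membership
  in the quantified set, always \<open>False\<close> along a thread, and the outer one is the mark
  of \<open>Unbd\<close>. \<open>S\<close> is a set of quotients because the marks before the
  restart remain open.\<close>

definition slot_step :: "'j \<Rightarrow> nat \<Rightarrow> ('j \<times> (('l \<times> bool) \<times> bool) list set) set list \<times> (('l \<times> bool) \<times> bool) list set set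
    \<Rightarrow> 'l \<times> bool \<Rightarrow> ('j \<times> (('l \<times> bool) \<times> bool) list set) set list \<times> (('l \<times> bool) \<times> bool) list set set" where
  "slot_step j i = (\<lambda>(l, S) (a, m). (lstep qstep l a,
     if disturbed qstep i l a then slot_comp j (lstep qstep l a) i
     else (\<lambda>r. lq r [((a, False), m)]) ` S))"

text \<open>Runs the condition \<open>j\<close> along the thread in slot \<open>i\<close>, restarting at each disturbance.\<close>

definition slot_cond where
  "slot_cond J j i = {y. foldl (slot_step j i) ([qinit J], slot_comp j [qinit J] i) y \<in> {(l, S). \<exists>r\<in>S. [] \<in> r}}"

lemma regular_slot_cond:
  assumes "finite J" "\<forall>(u, K)\<in>J. regular K"
  shows "regular (slot_cond J j i)"
  unfolding slot_cond_def
proof (rule regular_foldl)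
  let ?L = "{l. set l \<subseteq> Pow (quniv J) \<and> distinct l}" and ?S = "Pow {r. (j, r) \<in> quniv J}"
  have "finite {r. (j, r) \<in> quniv J}"
    by (rule finite_subset[OF _ finite_imageI[OF finite_quniv[OF assms], of snd]]) force
  then show "finite (?L \<times> ?S)"
    using finite_distinct_lists[of "Pow (quniv J)"] finite_quniv[OF assms] by simp
  have comp: "slot_comp j l i \<in> ?S" if "set l \<subseteq> Pow (quniv J)" for l
    using that by (auto simp: slot_comp_def dest!: nth_mem)
  show "([qinit J], slot_comp j [qinit J] i) \<in> ?L \<times> ?S"
    using comp[of "[qinit J]"] qinit_subset[of J] by auto
  have qclosed: "q \<in> Pow (quniv J) \<Longrightarrow> qstep q a \<in> Pow (quniv J)" for q a
    using qstep_subset[of q J a] by simp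
  show "slot_step j i s a \<in> ?L \<times> ?S" if s: "s \<in> ?L \<times> ?S" for s a
  proof -
    obtain l S b m where [simp]: "s = (l, S)" "a = (b, m)" by (cases s; cases a)
    have "set l \<subseteq> Pow (quniv J)" using s by simp
    then have "set (lstep qstep l b) \<subseteq> Pow (quniv J)" "distinct (lstep qstep l b)"
      using lstep_closed[of "Pow (quniv J)" qstep l b, OF qclosed] by simp_all
    moreover have "(\<lambda>r. lq r [((b, False), m)]) ` S \<in> ?S"
      using s quniv_lq[of j _ J] by auto
    ultimately show ?thesis using comp[of "lstep qstep l b"] by (simp add: slot_step_def)
  qed
qed

text \<open>Just after the last disturbance of slot \<open>i\<close> the automaton has restarted, so
  \<open>S\<close> holds the quotients of that slot whatever was marked before. From then on
  \<open>S\<close> only consumes letters of \<open>mark \<alpha> {}\<close>, and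
  \<open>Unbd_shift\<close> frees the earlier marks.\<close>

lemma Unbd_slot_cond:
  assumes t: "t = 0 \<or> disturbed qstep i (threads qstep (qinit J) \<alpha> (t - 1)) (\<alpha> (t - 1))"
    and und: "\<And>n. t \<le> n \<Longrightarrow> \<not> disturbed qstep i (threads qstep (qinit J) \<alpha> n) (\<alpha> n)"
  shows "Unbd u (slot_cond J j i) \<alpha> f \<longleftrightarrow>
    tail_unbd u t (slot_comp j (threads qstep (qinit J) \<alpha> t) i) (mark \<alpha> {}) f"
proof -
  let ?F = "\<lambda>M n. foldl (slot_step j i) ([qinit J], slot_comp j [qinit J] i) (pre (mark \<alpha> M) n)"
  let ?C = "slot_comp j (threads qstep (qinit J) \<alpha> t) i"
  have fst: "fst (?F M n) = threads qstep (qinit J) \<alpha> n" for M n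
    by (induction n) (auto simp: pre_mark_Suc threads_Suc slot_step_def split: prod.split)
  have Suc: "snd (?F M (Suc n)) = (if disturbed qstep i (threads qstep (qinit J) \<alpha> n) (\<alpha> n)
      then slot_comp j (threads qstep (qinit J) \<alpha> (Suc n)) i
      else (\<lambda>r. lq r [((\<alpha> n, False), n \<in> M)]) ` snd (?F M n))" for M n
    using fst[of M n] by (auto simp: pre_mark_Suc threads_Suc slot_step_def split: prod.split)
  have t0: "snd (?F M t) = ?C" for M
    using t Suc[of M "t - 1"] by (cases t) auto
  have later: "snd (?F M n) = (\<lambda>r. lq r (map (mark (mark \<alpha> {}) M) [t..<n])) ` ?C" if "t \<le> n" for M n
    using that
  proof (induction n rule: dec_induct)
    case base
    show ?case by (simp add: t0)
  next
    case (step n)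
    have "map (mark (mark \<alpha> {}) M) [t..<Suc n] =
        map (mark (mark \<alpha> {}) M) [t..<n] @ [((\<alpha> n, False), n \<in> M)]"
      using step(1) by (simp add: mark_def)
    then show ?case using Suc[of M n] und[OF step(1)] step(3)
      by (simp only: image_image lq_append if_False)
  qed
  have mem: "pre (mark \<alpha> M) n \<in> slot_cond J j i \<longleftrightarrow> (\<exists>r\<in>?C. map (mark (mark \<alpha> {}) M) [t..<n] \<in> r)"
    if "t \<le> n" for M n
  proof -
    have "pre (mark \<alpha> M) n \<in> slot_cond J j i \<longleftrightarrow> (\<exists>r\<in>snd (?F M n). [] \<in> r)"
      by (auto simp: slot_cond_def split: prod.splits)
    then show ?thesis using later[OF that] by simp
  qed
  have M0: "map (mark (mark \<alpha> {}) (M0 \<union> M)) [t..<n] = map (mark (mark \<alpha> {}) M) [t..<n]"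
    if "M0 \<subseteq> {..<t}" for M0 M n
    using that by (intro map_cong) (auto simp: mark_def)
  have "(\<exists>M0\<subseteq>{..<t}. k \<le> sum (uw f u) M \<and> pre (mark \<alpha> (M0 \<union> M)) n \<in> slot_cond J j i) \<longleftrightarrow>
    k \<le> sum (uw f u) M \<and> (\<exists>r\<in>?C. map (mark (mark \<alpha> {}) M) [t..<n] \<in> r)" if "t \<le> n" for k M n
  proof -
    have "pre (mark \<alpha> (M0 \<union> M)) n \<in> slot_cond J j i \<longleftrightarrow> (\<exists>r\<in>?C. map (mark (mark \<alpha> {}) M) [t..<n] \<in> r)"
      if "M0 \<subseteq> {..<t}" for M0
      using mem[OF \<open>t \<le> n\<close>] M0[OF that] by (simp only:)
    then show ?thesis by blast
  qed
  then have eq: "(\<exists>M\<subseteq>{t..<n}. \<exists>M0\<subseteq>{..<t}. k \<le> sum (uw f u) M \<and> pre (mark \<alpha> (M0 \<union> M)) n \<in> slot_cond J j i) \<longleftrightarrow>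
    (\<exists>M\<subseteq>{t..<n}. k \<le> sum (uw f u) M \<and> (\<exists>r\<in>?C. map (mark (mark \<alpha> {}) M) [t..<n] \<in> r))" if "t \<le> n" for k n
    using that by presburger
  then show ?thesis unfolding Unbd_shift[of u _ \<alpha> f t] tail_unbd_def by (simp only: eq cong: conj_cong)
qed

subsection \<open>Quantification over finite sets\<close>

text \<open>The thread that sits in slot \<open>i\<close> after its last disturbance is the run of
  some \<open>Y\<close> below \<open>t\<close>. \<open>X\<close> may join it only later, but from a
  common time \<open>T\<close> on the joint states and the letters agree. \<open>Unbd_tail\<close>
  is used at \<open>T\<close> to pass from \<open>X\<close> to \<open>Y\<close>, and at
  \<open>t\<close> to pass from \<open>Y\<close> to the slot.\<close>

lemma Unbd_slot:
  assumes st: "stable qstep (qinit J) i \<alpha>"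
    and at: "\<And>n. N \<le> n \<Longrightarrow> at_slot qstep (qinit J) i \<alpha> X n"
    and fin: "finite X" and j: "(u, K) \<in> J"
  shows "Unbd u K (mark \<alpha> X) f \<longleftrightarrow> Unbd u (slot_cond J (u, K) i) \<alpha> f"
proof -
  let ?th = "threads qstep (qinit J) \<alpha>"
  let ?run = "\<lambda>X n. foldl qstep (qinit J) (pre (mark \<alpha> X) n)"
  \<comment> \<open>Leastness makes \<open>t\<close> either \<open>0\<close> or the successor of a
    disturbance, as \<open>Unbd_slot_cond\<close> requires.\<close>
  define t where "t = (LEAST t. \<forall>n\<ge>t. \<not> disturbed qstep i (?th n) (\<alpha> n))"
  have und: "\<not> disturbed qstep i (?th n) (\<alpha> n)" if "t \<le> n" for n
  proof -
    have "\<forall>n\<ge>t. \<not> disturbed qstep i (?th n) (\<alpha> n)"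
      unfolding t_def by (rule LeastI_ex) (use st in \<open>simp add: stable_def\<close>)
    then show ?thesis using that by blast
  qed
  have dist: "t = 0 \<or> disturbed qstep i (?th (t - 1)) (\<alpha> (t - 1))"
  proof (rule ccontr)
    assume "\<not> (t = 0 \<or> disturbed qstep i (?th (t - 1)) (\<alpha> (t - 1)))"
    then have "\<not> disturbed qstep i (?th n) (\<alpha> n)" if "t - 1 \<le> n" for n
      using und that by (cases "n = t - 1") auto
    then have "t \<le> t - 1" unfolding t_def by (intro Least_le) blast
    with \<open>\<not> (t = 0 \<or> _)\<close> show False by linarith
  qed
  have it: "i < length (?th t)" using und[of t] by (simp add: disturbed_def)
  then obtain Y where Y: "Y \<subseteq> {..<t}" "?th t ! i = ?run Y t"
    using in_threadsE[of "?th t ! i" qstep "qinit J" \<alpha> t] by (metis nth_mem)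
  have atY: "at_slot qstep (qinit J) i \<alpha> Y n" if "t \<le> n" for n
    using at_slot_forever[of qstep "qinit J" i \<alpha> Y t n] Y it und that by (simp add: at_slot_def)
  have comp: "{r. ((u, K), r) \<in> ?run Z n} = {lq K y | y. map fst y = pre (mark \<alpha> Z) n}" for Z n
    using j by (auto simp: foldl_qinit)
  obtain B where B: "X \<subseteq> {..<B}" using fin finite_nat_iff_bounded by blast
  define T where "T = max (max t N) B"
  have T: "t \<le> T" "N \<le> T" "X \<subseteq> {..<T}" "Y \<subseteq> {..<T}"
    using B Y(1) by (auto simp: T_def)
  have run_eq: "?run X T = ?run Y T"
    using at[OF T(2)] atY[OF T(1)] by (simp add: at_slot_def)
  have "Unbd u K (mark \<alpha> X) f \<longleftrightarrow> tail_unbd u T {r. ((u, K), r) \<in> ?run X T} (mark \<alpha> X) f"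
    unfolding comp by (rule Unbd_tail)
  also have "\<dots> \<longleftrightarrow> tail_unbd u T {r. ((u, K), r) \<in> ?run X T} (mark \<alpha> Y) f"
    using T(3,4) by (intro tail_unbd_cong) (auto simp: mark_def)
  also have "\<dots> \<longleftrightarrow> Unbd u K (mark \<alpha> Y) f"
    unfolding run_eq comp by (rule Unbd_tail[symmetric])
  also have "\<dots> \<longleftrightarrow> tail_unbd u t {r. ((u, K), r) \<in> ?run Y t} (mark \<alpha> Y) f"
    unfolding comp by (rule Unbd_tail)
  also have "\<dots> \<longleftrightarrow> tail_unbd u t {r. ((u, K), r) \<in> ?run Y t} (mark \<alpha> {}) f"
    using Y(1) by (intro tail_unbd_cong) (auto simp: mark_def)
  also have "{r. ((u, K), r) \<in> ?run Y t} = slot_comp (u, K) (?th t) i"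
    using it Y(2) by (simp add: slot_comp_def)
  also have "tail_unbd u t (slot_comp (u, K) (?th t) i) (mark \<alpha> {}) f \<longleftrightarrow>
      Unbd u (slot_cond J (u, K) i) \<alpha> f"
    by (rule Unbd_slot_cond[symmetric, OF dist und])
  finally show ?thesis .
qed

text \<open>The interface for all set quantifiers. Every finite set ends in one of finitely many
  slots, and a set seen late enough in a slot with \<open>R i\<close> satisfies \<open>P\<close>. So
  the truth of \<open>P\<close> for a set is replaced by membership in the regular language
  \<open>V i\<close> at a late time.\<close>

lemma recog_slots:
  fixes P :: "(nat \<Rightarrow> 'l \<times> bool) \<Rightarrow> ('b \<Rightarrow> nat \<Rightarrow> nat) \<Rightarrow> bool"
  assumes "recog P"
  obtains B :: nat and V :: "nat \<Rightarrow> ('l \<times> bool) list set" and R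
  where "\<And>i. recog (R i)" "\<And>i. regular (V i)"
    "\<And>\<alpha> f X. finite X \<Longrightarrow> P (mark \<alpha> X) f \<Longrightarrow> \<exists>i<B. R i \<alpha> f \<and> (\<exists>N. \<forall>n\<ge>N. pre (mark \<alpha> X) n \<in> V i)"
    "\<And>i \<alpha> f. R i \<alpha> f \<Longrightarrow> \<exists>X. finite X \<and> P (mark \<alpha> X) f"
    "\<And>i \<alpha> f. R i \<alpha> f \<Longrightarrow> \<exists>N. \<forall>n\<ge>N. \<forall>X\<subseteq>{..<n}. pre (mark \<alpha> X) n \<in> V i \<longrightarrow> P (mark \<alpha> X) f"
proof -
  obtain J where J: "decides J P" using assms unfolding recog_def by blast
  then have fJ: "finite J" "\<forall>(u, K)\<in>J. regular K" unfolding decides_def by auto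
  let ?Q = "Pow (quniv J)"
  have Q: "finite ?Q" "qinit J \<in> ?Q" "\<And>q a. q \<in> ?Q \<Longrightarrow> qstep q a \<in> ?Q"
    using finite_quniv[OF fJ] qinit_subset[of J] qstep_subset[of _ J] by blast+
  let ?st = "stable qstep (qinit J)" and ?at = "at_slot qstep (qinit J)"
  define In where "In i \<alpha> X \<longleftrightarrow> finite X \<and> (\<exists>N. \<forall>n\<ge>N. ?at i \<alpha> X n)" for i \<alpha> X
  \<comment> \<open>By \<open>slot\<close> below, all sets that end in a stable slot
    \<open>i\<close> agree on \<open>P\<close>, so the existential quantifier amounts to a universal
    one.\<close>
  define R where "R i \<alpha> f \<longleftrightarrow> ?st i \<alpha> \<and> (\<exists>X. In i \<alpha> X \<and> P (mark \<alpha> X) f)" for i \<alpha> f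
  have slot: "P (mark \<alpha> X) f \<longleftrightarrow> P (mark \<beta> Y) g"
    if "?st i \<alpha>" "?st i \<beta>" "In i \<alpha> X" "In i \<beta> Y"
      "\<And>u K. (u, K) \<in> J \<Longrightarrow> Unbd u (slot_cond J (u, K) i) \<alpha> f \<longleftrightarrow> Unbd u (slot_cond J (u, K) i) \<beta> g"
    for i \<alpha> \<beta> X Y f g
  proof (rule decidesD[OF J])
    note prems = that
    fix u K assume uK: "(u, K) \<in> J"
    obtain N M where "\<forall>n\<ge>N. ?at i \<alpha> X n" "\<forall>n\<ge>M. ?at i \<beta> Y n" "finite X" "finite Y"
      using prems(3,4) unfolding In_def by blast
    then show "Unbd u K (mark \<alpha> X) f \<longleftrightarrow> Unbd u K (mark \<beta> Y) g"
      using Unbd_slot[OF prems(1) _ _ uK, of N X f] Unbd_slot[OF prems(2) _ _ uK, of M Y g] prems(5)[OF uK]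
      by simp
  qed
  have stay: "\<exists>N. \<forall>n\<ge>N. i < length (threads qstep (qinit J) \<alpha> n) \<and> (\<forall>X\<subseteq>{..<n}. ?at i \<alpha> X n \<longrightarrow> In i \<alpha> X)"
    if st: "?st i \<alpha>" for i \<alpha>
  proof -
    obtain N where N: "\<And>n. n \<ge> N \<Longrightarrow> \<not> disturbed qstep i (threads qstep (qinit J) \<alpha> n) (\<alpha> n)"
      using st unfolding stable_def by blast
    have "i < length (threads qstep (qinit J) \<alpha> n) \<and> (\<forall>X\<subseteq>{..<n}. ?at i \<alpha> X n \<longrightarrow> In i \<alpha> X)" if n: "n \<ge> N" for n
    proof (intro conjI allI impI)
      show "i < length (threads qstep (qinit J) \<alpha> n)" using N[OF n] by (simp add: disturbed_def)
      fix X assume X: "X \<subseteq> {..<n}" "?at i \<alpha> X n"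
      then have "?at i \<alpha> X m" if "m \<ge> n" for m
        using at_slot_forever[OF X(2,1) N that] n by simp
      moreover have "finite X" using X(1) finite_subset by blast
      ultimately show "In i \<alpha> X" unfolding In_def by blast
    qed
    then show ?thesis by blast
  qed
  \<comment> \<open>Needed to transfer \<open>R i\<close> between words: the second word must offer
    some set that ends in slot \<open>i\<close>.\<close>
  have inhabited: "\<exists>X. In i \<alpha> X" if st: "?st i \<alpha>" for i \<alpha>
  proof -
    obtain n where n: "i < length (threads qstep (qinit J) \<alpha> n)" "\<forall>X\<subseteq>{..<n}. ?at i \<alpha> X n \<longrightarrow> In i \<alpha> X"
      using stay[OF st] by blast
    obtain X where "X \<subseteq> {..<n}" "threads qstep (qinit J) \<alpha> n ! i = foldl qstep (qinit J) (pre (mark \<alpha> X) n)"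
      using in_threadsE[OF nth_mem[OF n(1)]] by metis
    then show ?thesis using n unfolding at_slot_def by blast
  qed
  show ?thesis
  proof (rule that[of R "slot_lang qstep (qinit J)" "Suc (card ?Q)"])
    show "regular (slot_lang qstep (qinit J) i)" for i
      by (rule regular_slot_lang[OF Q])
    show "recog (R i)" for i
    proof (rule recog_determined[where I = "insert None (Some ` J)" and
          A = "\<lambda>x. case x of None \<Rightarrow> (\<lambda>\<alpha> f. ?st i \<alpha>) | Some (u, K) \<Rightarrow> Unbd u (slot_cond J (u, K) i)"])
      show "finite (insert None (Some ` J))" using fJ by simp
      fix x assume "x \<in> insert None (Some ` J)"
      then show "recog (case x of None \<Rightarrow> (\<lambda>\<alpha> (f :: 'b \<Rightarrow> nat \<Rightarrow> nat). ?st i \<alpha>) | Some (u, K) \<Rightarrow> Unbd u (slot_cond J (u, K) i))"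
        using recog_stable[OF Q] recog_Unbd[OF regular_slot_cond[OF fJ]]
        by (auto split: option.splits)
    next
      fix \<alpha> \<beta> :: "nat \<Rightarrow> 'l" and f g :: "'b \<Rightarrow> nat \<Rightarrow> nat"
      let ?A = "\<lambda>x. case x of None \<Rightarrow> (\<lambda>\<alpha> f. ?st i \<alpha>) | Some (u, K) \<Rightarrow> Unbd u (slot_cond J (u, K) i)"
      assume eq: "\<And>x. x \<in> insert None (Some ` J) \<Longrightarrow> ?A x \<alpha> f \<longleftrightarrow> ?A x \<beta> g" and "R i \<alpha> f"
      then obtain X where X: "?st i \<alpha>" "In i \<alpha> X" "P (mark \<alpha> X) f" unfolding R_def by blast
      have st: "?st i \<beta>" using eq[of None] X(1) by simp
      then obtain Y where Y: "In i \<beta> Y" using inhabited by blast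
      have "Unbd u (slot_cond J (u, K) i) \<alpha> f \<longleftrightarrow> Unbd u (slot_cond J (u, K) i) \<beta> g" if "(u, K) \<in> J" for u K
        using eq[of "Some (u, K)"] that by simp
      then have "P (mark \<beta> Y) g" using slot[OF X(1) st X(2) Y] X(3) by simp
      then show "R i \<beta> g" unfolding R_def using st Y by blast
    qed
  next
    fix \<alpha> f X assume X: "finite X" "P (mark \<alpha> X) f"
    obtain i N where i: "\<And>n. N \<le> n \<Longrightarrow> \<not> disturbed qstep i (threads qstep (qinit J) \<alpha> n) (\<alpha> n)"
      "\<And>n. N \<le> n \<Longrightarrow> ?at i \<alpha> X n"
      using finite_eventually_at_stable_slot[OF X(1)] by metis
    have th: "set (threads qstep (qinit J) \<alpha> n) \<subseteq> ?Q \<and> distinct (threads qstep (qinit J) \<alpha> n)" for n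
      using Q(2) lstep_closed[of ?Q qstep] Q(3) by (induction n) (simp_all add: threads_Suc)
    have "length (threads qstep (qinit J) \<alpha> N) \<le> card ?Q"
      using th[of N] card_mono[OF Q(1)] by (metis distinct_card)
    then have "i < Suc (card ?Q)" using i(2)[of N] by (simp add: at_slot_def)
    moreover have "R i \<alpha> f" unfolding R_def In_def stable_def using i X by blast
    ultimately show "\<exists>i<Suc (card ?Q). R i \<alpha> f \<and> (\<exists>N. \<forall>n\<ge>N. pre (mark \<alpha> X) n \<in> slot_lang qstep (qinit J) i)"
      using i(2) unfolding in_slot_lang by blast
  next
    fix i \<alpha> f assume "R i \<alpha> f"
    then obtain X where X: "?st i \<alpha>" "In i \<alpha> X" "P (mark \<alpha> X) f" unfolding R_def by blast
    then show "\<exists>X. finite X \<and> P (mark \<alpha> X) f" unfolding In_def by blast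
    have "P (mark \<alpha> Y) f" if "In i \<alpha> Y" for Y using slot[OF X(1,1,2) that] X(3) by blast
    then show "\<exists>N. \<forall>n\<ge>N. \<forall>Y\<subseteq>{..<n}. pre (mark \<alpha> Y) n \<in> slot_lang qstep (qinit J) i \<longrightarrow> P (mark \<alpha> Y) f"
      using stay[OF X(1)] unfolding in_slot_lang by blast
  qed
qed

section \<open>Elimination of set quantifiers\<close>

lemma not_Unbd:
  "\<not> Unbd u K \<alpha> f \<longleftrightarrow>
     (\<exists>k. \<forall>n\<ge>k. \<forall>X\<subseteq>{..<n}. k \<le> sum (uw f u) X \<longrightarrow> pre (mark \<alpha> X) n \<notin> K)"
  unfolding Unbd_def by (meson)

lemma recog_finite_ex:
  assumes "\<And>i :: nat. recog (R i)"
  shows "recog (\<lambda>\<alpha> f. \<exists>i<B. R i \<alpha> f)"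
  by (rule recog_determined[where I = "{..<B}" and A = R]) (use assms in auto)

lemma recog_ex_finite_set:
  fixes P :: "(nat \<Rightarrow> 'l \<times> bool) \<Rightarrow> ('b \<Rightarrow> nat \<Rightarrow> nat) \<Rightarrow> bool"
  assumes "recog P"
  shows "recog (\<lambda>\<alpha> f. \<exists>X. finite X \<and> P (mark \<alpha> X) f)"
proof -
  obtain R V and B :: nat where R: "\<And>i. recog (R i)" "\<And>i. regular (V i)"
    "\<And>\<alpha> f X. finite X \<Longrightarrow> P (mark \<alpha> X) f \<Longrightarrow> \<exists>i<B. R i \<alpha> f \<and> (\<exists>N. \<forall>n\<ge>N. pre (mark \<alpha> X) n \<in> V i)"
    "\<And>i \<alpha> f. R i \<alpha> f \<Longrightarrow> \<exists>X. finite X \<and> P (mark \<alpha> X) f"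
    "\<And>i \<alpha> f. R i \<alpha> f \<Longrightarrow> \<exists>N. \<forall>n\<ge>N. \<forall>X\<subseteq>{..<n}. pre (mark \<alpha> X) n \<in> V i \<longrightarrow> P (mark \<alpha> X) f"
    by (rule recog_slots[OF assms]) (rule that; assumption)
  have "(\<lambda>\<alpha> f. \<exists>X. finite X \<and> P (mark \<alpha> X) f) = (\<lambda>\<alpha> f. \<exists>i<B. R i \<alpha> f)"
    by (intro ext iffI) (elim exE conjE, drule (1) R(3), blast, elim exE conjE, erule R(4))
  then show ?thesis using recog_finite_ex[OF R(1)] by simp
qed

text \<open>There are finitely many slots, so one of them receives satisfying sets of unbounded
  weight. Within a slot with \<open>R i\<close> these are, from some time on, the markings in
  \<open>V i\<close>, and the quantified set becomes the marking of a limit condition.\<close>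

lemma recog_unbounded_set:
  fixes P :: "(nat \<Rightarrow> 'l \<times> bool) \<Rightarrow> ('b \<Rightarrow> nat \<Rightarrow> nat) \<Rightarrow> bool"
  assumes "recog P"
  shows "recog (\<lambda>\<alpha> f. \<forall>k. \<exists>X. finite X \<and> k \<le> sum (uw f u) X \<and> P (mark \<alpha> X) f)"
proof -
  obtain R V and B :: nat where R: "\<And>i. recog (R i)" "\<And>i. regular (V i)"
    "\<And>\<alpha> f X. finite X \<Longrightarrow> P (mark \<alpha> X) f \<Longrightarrow> \<exists>i<B. R i \<alpha> f \<and> (\<exists>N. \<forall>n\<ge>N. pre (mark \<alpha> X) n \<in> V i)"
    "\<And>i \<alpha> f. R i \<alpha> f \<Longrightarrow> \<exists>X. finite X \<and> P (mark \<alpha> X) f"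
    "\<And>i \<alpha> f. R i \<alpha> f \<Longrightarrow> \<exists>N. \<forall>n\<ge>N. \<forall>X\<subseteq>{..<n}. pre (mark \<alpha> X) n \<in> V i \<longrightarrow> P (mark \<alpha> X) f"
    by (rule recog_slots[OF assms]) (rule that; assumption)
  have "(\<forall>k. \<exists>X. finite X \<and> k \<le> sum (uw f u) X \<and> P (mark \<alpha> X) f) \<longleftrightarrow>
     (\<exists>i<B. R i \<alpha> f \<and> Unbd u (V i) \<alpha> f)" (is "?L \<longleftrightarrow> ?R") for \<alpha> f
  proof
    assume L: ?L
    show ?R
    proof (rule ccontr)
      assume "\<not> ?R"
      then have "\<forall>i. \<exists>k. i < B \<longrightarrow> R i \<alpha> f \<longrightarrow>
          (\<forall>n\<ge>k. \<forall>X\<subseteq>{..<n}. k \<le> sum (uw f u) X \<longrightarrow> pre (mark \<alpha> X) n \<notin> V i)"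
        using not_Unbd by metis
      then obtain k where k: "\<And>i n X. i < B \<Longrightarrow> R i \<alpha> f \<Longrightarrow> n \<ge> k i \<Longrightarrow> X \<subseteq> {..<n} \<Longrightarrow>
          k i \<le> sum (uw f u) X \<Longrightarrow> pre (mark \<alpha> X) n \<notin> V i"
        unfolding choice_iff by blast
      \<comment> \<open>The sum exceeds the bound of every single slot, so the slot in which
        \<open>X\<close> ends need not be known in advance.\<close>
      obtain X where X: "finite X" "(\<Sum>i<B. k i) \<le> sum (uw f u) X" "P (mark \<alpha> X) f" using L by blast
      obtain i N where i: "i < B" "R i \<alpha> f" "\<And>n. n \<ge> N \<Longrightarrow> pre (mark \<alpha> X) n \<in> V i"
        using R(3)[OF X(1,3)] by blast
      obtain M where M: "X \<subseteq> {..<M}" using X(1) finite_nat_iff_bounded by blast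
      have "k i \<le> (\<Sum>i<B. k i)" using i(1) by (intro member_le_sum) auto
      then show False
        using k[OF i(1,2), of "N + M + k i" X] i(3)[of "N + M + k i"] M X(2) by fastforce
    qed
  next
    assume ?R
    then obtain i where i: "R i \<alpha> f" "Unbd u (V i) \<alpha> f" by blast
    obtain N where N: "\<And>n X. n \<ge> N \<Longrightarrow> X \<subseteq> {..<n} \<Longrightarrow> pre (mark \<alpha> X) n \<in> V i \<Longrightarrow> P (mark \<alpha> X) f"
      using R(5)[OF i(1)] by blast
    show ?L
    proof
      fix k
      obtain n X where n: "n \<ge> k + N" "X \<subseteq> {..<n}" "k + N \<le> sum (uw f u) X" "pre (mark \<alpha> X) n \<in> V i"
        using i(2) unfolding Unbd_def by blast
      then have "P (mark \<alpha> X) f" using N[of n X] by simp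
      then show "\<exists>X. finite X \<and> k \<le> sum (uw f u) X \<and> P (mark \<alpha> X) f"
        using n by (intro exI[of _ X]) (auto intro: finite_subset)
    qed
  qed
  then show ?thesis
    using recog_finite_ex[OF recog_conj[OF R(1) recog_Unbd[OF R(2)]]] by simp
qed

subsection \<open>From formulas to recognizable properties\<close>

text \<open>Infinite weights count as \<open>0\<close>; they are accounted for separately, through the profile.\<close>

definition fw :: "'a set \<Rightarrow> 'a wword \<Rightarrow> 'a \<Rightarrow> nat \<Rightarrow> nat" where
  "fw Wei w b n = (if b \<in> Wei \<and> weight w b n \<noteq> \<infinity> then the_enat (weight w b n) else 0)"

text \<open>All variables are encoded at once. The letter type is infinite, but
  \<open>regular\<close> asks only for finitely many quotients, so the set of free variables never
  has to be tracked.\<close>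

type_synonym 'a tletter = "'a profile \<times> nat set \<times> nat set"

definition tracks :: "'a set \<Rightarrow> 'a wword \<Rightarrow> (nat \<Rightarrow> nat) \<Rightarrow> (nat \<Rightarrow> nat set) \<Rightarrow> nat \<Rightarrow> 'a tletter" where
  "tracks Wei w s S n = (profile_at Wei w n, {x. s x = n}, {X. n \<in> S X})"

lemma profile_at_in_profiles:
  "w \<in> weighted_words Lab Wei \<Longrightarrow> profile_at Wei w n \<in> profiles Lab Wei"
  by (auto simp: weighted_words_def profile_at_def profiles_def label_def mem_Times_iff)

lemma finite_profiles:
  assumes "weighted_alphabet Lab Wei"
  shows "finite (profiles Lab Wei)"
proof -
  have "profiles Lab Wei \<subseteq> Lab \<times> Pow Wei \<times> Pow Wei" by (auto simp: profiles_def)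
  then show ?thesis
    using assms unfolding weighted_alphabet_def by (meson finite_Pow_iff finite_SigmaI finite_Un finite_subset)
qed

lemma fw_finite: "b \<in> Wei \<Longrightarrow> weight w b n \<noteq> \<infinity> \<Longrightarrow> enat (fw Wei w b n) = weight w b n"
  by (auto simp: fw_def)

lemma fw_le: "b \<in> Wei \<Longrightarrow> enat (fw Wei w b n) \<le> weight w b n"
  by (cases "weight w b n = \<infinity>") (simp_all add: fw_finite)

lemma enat_sum: "enat (sum f A) = (\<Sum>x\<in>A. enat (f x))"
  by (induction A rule: infinite_finite_induct) (simp_all add: zero_enat_def flip: plus_enat_simps(1))

lemma set_weight_ge: "b \<in> Wei \<Longrightarrow> enat (sum (fw Wei w b) P) \<le> set_weight w b P"
  unfolding enat_sum set_weight_def by (intro sum_mono fw_le)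

lemma set_weight_finite:
  assumes "b \<in> Wei" "\<And>n. n \<in> P \<Longrightarrow> weight w b n \<noteq> \<infinity>"
  shows "set_weight w b P = enat (sum (fw Wei w b) P)"
  unfolding enat_sum set_weight_def using assms by (intro sum.cong) (simp_all add: fw_finite)

lemma set_weight_infinite:
  assumes "finite P" "n \<in> P" "weight w b n = \<infinity>"
  shows "set_weight w b P = \<infinity>"
  unfolding set_weight_def using assms by (subst sum.remove[of _ n]) auto

text \<open>An automaton that remembers an event forever turns its occurrence into a Buchi
  condition; \<open>recog_before\<close> does the same for an ordered pair of events.\<close>

lemma recog_occurs:
  fixes G :: "'l \<Rightarrow> bool"
  shows "recog (\<lambda>\<alpha> (f :: 'b \<Rightarrow> nat \<Rightarrow> nat). \<exists>n. G (\<alpha> n))"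
proof -
  define L where "L = {u. foldl (\<lambda>s a. s \<or> G a) False u \<in> {True}}"
  have "regular L"
    unfolding L_def by (rule regular_foldl[of UNIV]) auto
  have "foldl (\<lambda>s a. s \<or> G a) False u \<longleftrightarrow> (\<exists>a\<in>set u. G a)" for u
    by (induction u rule: rev_induct) auto
  then have mem: "pre \<alpha> n \<in> L \<longleftrightarrow> (\<exists>i<n. G (\<alpha> i))" for \<alpha> n
    by (auto simp: L_def pre_def)
  have "Inf_often L \<alpha> \<longleftrightarrow> (\<exists>n. G (\<alpha> n))" for \<alpha>
    unfolding Inf_often_def mem by (meson le_SucI less_Suc_eq_le max.cobounded1 max.cobounded2)
  then show ?thesis
    using recog_Inf_often[OF \<open>regular L\<close>] by simp
qed

lemma recog_before:
  fixes G H :: "'l \<Rightarrow> bool"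
  shows "recog (\<lambda>\<alpha> (f :: 'b \<Rightarrow> nat \<Rightarrow> nat). \<exists>m n. m < n \<and> G (\<alpha> m) \<and> H (\<alpha> n))"
proof -
  define step where "step = (\<lambda>(s, t) a. (s \<or> G a, t \<or> s \<and> H a))"
  define L where "L = {u. foldl step (False, False) u \<in> UNIV \<times> {True}}"
  have "regular L"
    unfolding L_def by (rule regular_foldl[of UNIV]) auto
  have "foldl step (False, False) (pre \<alpha> n) =
     ((\<exists>i<n. G (\<alpha> i)), (\<exists>j<n. \<exists>i<j. G (\<alpha> i) \<and> H (\<alpha> j)))" for \<alpha> n
    by (induction n) (auto simp: step_def pre_Suc less_Suc_eq)
  then have mem: "pre \<alpha> n \<in> L \<longleftrightarrow> (\<exists>j<n. \<exists>i<j. G (\<alpha> i) \<and> H (\<alpha> j))" for \<alpha> n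
    by (simp add: L_def)
  have "Inf_often L \<alpha> \<longleftrightarrow> (\<exists>m n. m < n \<and> G (\<alpha> m) \<and> H (\<alpha> n))" for \<alpha>
    unfolding Inf_often_def mem by (meson le_SucI less_Suc_eq_le max.cobounded1 max.cobounded2)
  then show ?thesis
    using recog_Inf_often[OF \<open>regular L\<close>] by simp
qed

definition set_track :: "nat \<Rightarrow> 'a tletter \<times> bool \<Rightarrow> 'a tletter" where
  "set_track X = (\<lambda>((p, xs, Xs), m). (p, xs, if m then insert X Xs else Xs - {X}))"

definition pos_track :: "nat \<Rightarrow> 'a tletter \<times> bool \<Rightarrow> 'a tletter" where
  "pos_track x = (\<lambda>((p, xs, Xs), m). (p, if m then insert x xs else xs - {x}, Xs))"

lemma set_track: "(\<lambda>n. set_track X (mark (tracks Wei w s S) P n)) = tracks Wei w s (S(X := P))"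
  by (auto simp: fun_eq_iff set_track_def mark_def tracks_def)

lemma pos_track: "(\<lambda>n. pos_track x (mark (tracks Wei w s S) {p} n)) = tracks Wei w (s(x := p)) S"
  by (auto simp: fun_eq_iff pos_track_def mark_def tracks_def)

definition recog_formula :: "'a set \<Rightarrow> 'a set \<Rightarrow> 'a formula \<Rightarrow> bool" where
  "recog_formula Lab Wei \<phi> \<longleftrightarrow> (\<exists>P. recog P \<and>
     (\<forall>w\<in>weighted_words Lab Wei. \<forall>s S. sat w s S \<phi> \<longleftrightarrow> P (tracks Wei w s S) (fw Wei w)))"

lemma recog_formulaI:
  assumes "recog P" "\<And>w s S. w \<in> weighted_words Lab Wei \<Longrightarrow> sat w s S \<phi> \<longleftrightarrow> P (tracks Wei w s S) (fw Wei w)"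
  shows "recog_formula Lab Wei \<phi>"
  using assms unfolding recog_formula_def by blast

lemma recog_formulaE:
  assumes "recog_formula Lab Wei \<phi>"
  obtains P where "recog P"
    "\<And>w s S. w \<in> weighted_words Lab Wei \<Longrightarrow> sat w s S \<phi> \<longleftrightarrow> P (tracks Wei w s S) (fw Wei w)"
  using assms unfolding recog_formula_def by blast

lemma recog_formula_over_alphabet:
  "over_alphabet Lab Wei \<phi> \<Longrightarrow> recog_formula Lab Wei \<phi>"
proof (induction \<phi>)
  case (Lab_at a x)
  show ?case
    by (rule recog_formulaI[OF recog_occurs[of "\<lambda>(p, xs, Xs). fst p = a \<and> x \<in> xs"]])
       (simp add: tracks_def profile_at_def)
next
  case (Wei_at b x)
  then show ?case
    by (intro recog_formulaI[OF recog_occurs[of "\<lambda>(p, xs, Xs). b \<in> fst (snd p) \<and> x \<in> xs"]])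
       (simp add: tracks_def profile_at_def)
next
  case (Less x y)
  show ?case
    by (rule recog_formulaI[OF recog_before[of "\<lambda>(p, xs, Xs). x \<in> xs" "\<lambda>(p, xs, Xs). y \<in> xs"]])
       (simp add: tracks_def)
next
  case (Mem x X)
  show ?case
    by (rule recog_formulaI[OF recog_occurs[of "\<lambda>(p, xs, Xs). x \<in> xs \<and> X \<in> Xs"]])
       (simp add: tracks_def)
next
  case (Neg \<phi>)
  then obtain P where P: "recog P"
    "\<And>w s S. w \<in> weighted_words Lab Wei \<Longrightarrow> sat w s S \<phi> \<longleftrightarrow> P (tracks Wei w s S) (fw Wei w)"
    by (auto elim: recog_formulaE)
  show ?case by (rule recog_formulaI[OF recog_neg[OF P(1)]]) (simp add: P(2))
next
  case (Disj \<phi> \<psi>)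
  then obtain P Q where P: "recog P"
    "\<And>w s S. w \<in> weighted_words Lab Wei \<Longrightarrow> sat w s S \<phi> \<longleftrightarrow> P (tracks Wei w s S) (fw Wei w)"
    and Q: "recog Q"
    "\<And>w s S. w \<in> weighted_words Lab Wei \<Longrightarrow> sat w s S \<psi> \<longleftrightarrow> Q (tracks Wei w s S) (fw Wei w)"
    by (auto elim!: recog_formulaE)
  show ?case by (rule recog_formulaI[OF recog_disj[OF P(1) Q(1)]]) (simp add: P(2) Q(2))
next
  case (Ex_pos x \<phi>)
  then obtain P where P: "recog P"
    "\<And>w s S. w \<in> weighted_words Lab Wei \<Longrightarrow> sat w s S \<phi> \<longleftrightarrow> P (tracks Wei w s S) (fw Wei w)"
    by (auto elim: recog_formulaE)
  \<comment> \<open>A position is quantified as a singleton: a set with an element but without two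
    ordered ones.\<close>
  let ?P = "\<lambda>\<alpha> f. ((\<exists>n. snd (\<alpha> n)) \<and> \<not> (\<exists>m n. m < n \<and> snd (\<alpha> m) \<and> snd (\<alpha> n))) \<and>
      P (\<lambda>n. pos_track x (\<alpha> n)) f"
  have "recog ?P"
    by (rule recog_conj[OF recog_conj[OF recog_occurs[of snd] recog_neg[OF recog_before[of snd snd]]]
          recog_map[OF P(1), of "pos_track x"]])
  then show ?case
  proof (rule recog_formulaI[OF recog_ex_finite_set])
    fix w s S assume w: "w \<in> weighted_words Lab Wei"
    have sing: "(\<exists>n. n \<in> X) \<and> \<not> (\<exists>m n. m < n \<and> m \<in> X \<and> n \<in> X) \<longleftrightarrow> (\<exists>p. X = {p})" for X :: "nat set"
    proof
      assume X: "(\<exists>n. n \<in> X) \<and> \<not> (\<exists>m n. m < n \<and> m \<in> X \<and> n \<in> X)"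
      then obtain p where "p \<in> X" by blast
      then have "X = {p}" using X by (metis linorder_neqE_nat singleton_iff subsetI subset_antisym empty_subsetI insert_subset)
      then show "\<exists>p. X = {p}" ..
    qed auto
    have snd: "snd (mark (tracks Wei w s S) X n) \<longleftrightarrow> n \<in> X" for X n by (simp add: mark_def)
    have "?P (mark (tracks Wei w s S) X) (fw Wei w) \<longleftrightarrow> (\<exists>p. X = {p} \<and> P (tracks Wei w (s(x := p)) S) (fw Wei w))" for X
      unfolding snd sing by (auto simp: pos_track)
    then show "sat w s S (Ex_pos x \<phi>) \<longleftrightarrow> (\<exists>X. finite X \<and> ?P (mark (tracks Wei w s S) X) (fw Wei w))"
      by (auto simp: P(2)[OF w])
  qed
next
  case (Ex_set X \<phi>)
  then obtain P where P: "recog P"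
    "\<And>w s S. w \<in> weighted_words Lab Wei \<Longrightarrow> sat w s S \<phi> \<longleftrightarrow> P (tracks Wei w s S) (fw Wei w)"
    by (auto elim: recog_formulaE)
  show ?case
    by (rule recog_formulaI[OF recog_ex_finite_set[OF recog_map[OF P(1), of "set_track X"]]])
       (simp add: P(2) set_track)
next
  case (Unb X \<phi>)
  then obtain P where P: "recog P"
    "\<And>w s S. w \<in> weighted_words Lab Wei \<Longrightarrow> sat w s S \<phi> \<longleftrightarrow> P (tracks Wei w s S) (fw Wei w)"
    by (auto elim: recog_formulaE)
  have "sum (uw f None) X = card X" for f :: "'a \<Rightarrow> nat \<Rightarrow> nat" and X by (simp add: uw_def)
  then show ?case
    by (intro recog_formulaI[OF recog_unbounded_set[OF recog_map[OF P(1), of "set_track X"], of None]])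
       (simp add: P(2) set_track)
next
  case (Unb_wei b X \<phi>)
  then have b: "b \<in> Wei" by simp
  from Unb_wei obtain P where P: "recog P"
    "\<And>w s S. w \<in> weighted_words Lab Wei \<Longrightarrow> sat w s S \<phi> \<longleftrightarrow> P (tracks Wei w s S) (fw Wei w)"
    by (auto elim: recog_formulaE)
  let ?P = "\<lambda>\<alpha> f. P (\<lambda>n. set_track X (\<alpha> n)) f"
  let ?I = "\<lambda>\<alpha>. \<exists>n. b \<in> snd (snd (fst (fst (\<alpha> n)))) \<and> snd (\<alpha> n)"
  \<comment> \<open>Either some satisfying set contains a position of infinite weight, or all of
    them have finite weight, which \<open>fw\<close> then measures exactly.\<close>
  have "recog (\<lambda>\<alpha> f. (\<exists>X. finite X \<and> ?I (mark \<alpha> X) \<and> ?P (mark \<alpha> X) f) \<or>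
      (\<forall>k. \<exists>X. finite X \<and> k \<le> sum (uw f (Some b)) X \<and> ?P (mark \<alpha> X) f))"
    by (rule recog_disj[OF recog_ex_finite_set[OF recog_conj[OF
            recog_occurs[of "\<lambda>a. b \<in> snd (snd (fst (fst a))) \<and> snd a"] recog_map[OF P(1), of "set_track X"]]]
          recog_unbounded_set[OF recog_map[OF P(1), of "set_track X"], of "Some b"]])
  then show ?case
  proof (rule recog_formulaI)
    fix w s S assume w: "w \<in> weighted_words Lab Wei"
    have uw: "uw (fw Wei w) (Some b) = fw Wei w b" by (auto simp: uw_def)
    have I: "?I (mark (tracks Wei w s S) Y) \<longleftrightarrow> (\<exists>n\<in>Y. weight w b n = \<infinity>)" for Y
      using b by (auto simp: mark_def tracks_def profile_at_def)
    show "sat w s S (Unb_wei b X \<phi>) \<longleftrightarrow>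
      (\<exists>Y. finite Y \<and> ?I (mark (tracks Wei w s S) Y) \<and> ?P (mark (tracks Wei w s S) Y) (fw Wei w)) \<or>
      (\<forall>k. \<exists>Y. finite Y \<and> k \<le> sum (uw (fw Wei w) (Some b)) Y \<and> ?P (mark (tracks Wei w s S) Y) (fw Wei w))"
      (is "_ \<longleftrightarrow> ?A \<or> ?B")
    proof
      assume L: "sat w s S (Unb_wei b X \<phi>)"
      show "?A \<or> ?B"
      proof (cases ?A)
        case False
        then have notA: "\<not> (\<exists>Y. finite Y \<and> (\<exists>n\<in>Y. weight w b n = \<infinity>) \<and> sat w s (S(X := Y)) \<phi>)"
          unfolding I set_track P(2)[OF w, symmetric] .
        have sw: "set_weight w b Y = enat (sum (fw Wei w b) Y)" if "finite Y" "sat w s (S(X := Y)) \<phi>" for Y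
        proof (rule set_weight_finite[OF b])
          fix n assume "n \<in> Y"
          then show "weight w b n \<noteq> \<infinity>"
            using notA that by metis
        qed
        have ?B
        proof
          fix k
          obtain Y where "finite Y" "enat k \<le> set_weight w b Y" "sat w s (S(X := Y)) \<phi>"
            using L by auto
          then show "\<exists>Y. finite Y \<and> k \<le> sum (uw (fw Wei w) (Some b)) Y \<and> ?P (mark (tracks Wei w s S) Y) (fw Wei w)"
            unfolding uw set_track P(2)[OF w, symmetric] using sw by (intro exI[of _ Y]) simp
        qed
        then show ?thesis ..
      qed simp
    next
      assume "?A \<or> ?B"
      then show "sat w s S (Unb_wei b X \<phi>)"
      proof
        assume ?A
        then obtain Y where Y: "finite Y" "\<exists>n\<in>Y. weight w b n = \<infinity>" "sat w s (S(X := Y)) \<phi>"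
          unfolding I set_track P(2)[OF w, symmetric] by blast
        then obtain n where "n \<in> Y" "weight w b n = \<infinity>" by (elim bexE)
        then have "set_weight w b Y = \<infinity>" by (rule set_weight_infinite[OF Y(1)])
        then show ?thesis unfolding sat.simps using Y(1,3) by (intro allI exI[of _ Y]) simp
      next
        assume B: ?B
        show ?thesis
          unfolding sat.simps
        proof
          fix k
          obtain Y where Y: "finite Y" "k \<le> sum (fw Wei w b) Y" "sat w s (S(X := Y)) \<phi>"
            using B unfolding uw set_track P(2)[OF w, symmetric] by blast
          then have "enat k \<le> set_weight w b Y"
            using set_weight_ge[OF b, of w Y] by (metis enat_ord_simps(1) order_trans)
          then show "\<exists>Y. finite Y \<and> enat k \<le> set_weight w b Y \<and> sat w s (S(X := Y)) \<phi>"
            using Y by blast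
        qed
      qed
    qed
  qed
qed

lemma recog_sentence:
  assumes "over_alphabet Lab Wei \<phi>"
  obtains P where "recog P"
    "\<And>w. w \<in> weighted_words Lab Wei \<Longrightarrow> satisfies w \<phi> \<longleftrightarrow> P (profile_at Wei w) (fw Wei w)"
proof -
  obtain P where P: "recog P"
    "\<And>w s S. w \<in> weighted_words Lab Wei \<Longrightarrow> sat w s S \<phi> \<longleftrightarrow> P (tracks Wei w s S) (fw Wei w)"
    using recog_formula_over_alphabet[OF assms] by (auto elim: recog_formulaE)
  have "tracks Wei w (\<lambda>_. 0) (\<lambda>_. {}) =
     (\<lambda>n. if n = 0 then (profile_at Wei w 0, UNIV, {}) else (profile_at Wei w n, {}, {}))" for w
    by (auto simp: tracks_def fun_eq_iff)
  then show ?thesis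
    using that[OF recog_map_first[OF P(1), of "\<lambda>p. (p, UNIV, {})" "\<lambda>p. (p, {}, {})"]] P(2)
    by (simp add: satisfies_def)
qed

subsection \<open>Suprema of extended natural numbers\<close>

text \<open>The shape of \<open>Unbd\<close>: a single \<open>k\<close> bounds both the time and the
  value.\<close>

lemma limsup_enat_infinity:
  "limsup x = (\<infinity> :: enat) \<longleftrightarrow> (\<forall>k. \<exists>n\<ge>k. enat k \<le> x n)"
proof
  assume L: "limsup x = \<infinity>"
  show "\<forall>k. \<exists>n\<ge>k. enat k \<le> x n"
  proof
    fix k
    have "limsup x \<le> (SUP m\<in>{k..}. x m)" unfolding limsup_INF_SUP by (rule INF_lower) simp
    then have "(SUP m\<in>{k..}. x m) = \<infinity>" using L by simp
    then have "enat k < (SUP m\<in>{k..}. x m)" by simp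
    then obtain n where "n \<ge> k" "enat k < x n" unfolding less_SUP_iff by auto
    then show "\<exists>n\<ge>k. enat k \<le> x n" by (auto intro: order.strict_implies_order)
  qed
next
  assume R: "\<forall>k. \<exists>n\<ge>k. enat k \<le> x n"
  have "(SUP m\<in>{N..}. x m) = \<infinity>" for N
  proof (rule ccontr)
    assume "(SUP m\<in>{N..}. x m) \<noteq> \<infinity>"
    then obtain B where B: "(SUP m\<in>{N..}. x m) = enat B" by auto
    obtain n where n: "n \<ge> max N (Suc B)" "enat (max N (Suc B)) \<le> x n" using R by blast
    have "x n \<le> enat B" unfolding B[symmetric] using n(1) by (intro SUP_upper) simp
    then have "enat (max N (Suc B)) \<le> enat B" using n(2) by (rule order_trans[rotated])
    then show False by simp
  qed
  then show "limsup x = \<infinity>" unfolding limsup_INF_SUP by simp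
qed

text \<open>Exceeding \<open>k - 1\<close> means reaching \<open>k\<close>, so a finite bound is met
  by a member of the set. \<open>0 < k\<close> excludes the empty set, whose supremum is
  \<open>0\<close>.\<close>

lemma enat_le_Sup_iff:
  assumes "0 < k"
  shows "enat k \<le> Sup S \<longleftrightarrow> (\<exists>s\<in>S. enat k \<le> s)"
proof
  assume "enat k \<le> Sup S"
  moreover have "enat (k - 1) < enat k" using assms by simp
  ultimately have "enat (k - 1) < Sup S" by (rule order.strict_trans2[rotated])
  then obtain s where "s \<in> S" "enat (k - 1) < s" unfolding less_Sup_iff by blast
  moreover from this have "enat k \<le> s"
    using ileI1[of "enat (k - 1)" s] assms by (simp add: eSuc_enat)
  ultimately show "\<exists>s\<in>S. enat k \<le> s" by blast
next
  assume "\<exists>s\<in>S. enat k \<le> s"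
  then show "enat k \<le> Sup S" by (meson Sup_upper order_trans)
qed

lemma finite_enat_Sup_in:
  fixes S :: "enat set"
  assumes "finite S" "S \<noteq> {}"
  shows "Sup S \<in> S"
  using Max_in[OF assms] Max_Sup[OF assms] by simp


subsection \<open>Automata over natural numbers\<close>

text \<open>The automaton built below has sets of quotients as states and registers as counters;
  injective renaming brings it to the types in the theorem.\<close>

lemma max_automaton_nat:
  fixes A :: "('a, 's, 'c) max_automaton"
  assumes A: "weighted_max_automaton Lab Wei A"
  obtains A' :: "('a, nat, nat) max_automaton" where "weighted_max_automaton Lab Wei A'"
    "\<And>w. w \<in> weighted_words Lab Wei \<Longrightarrow> accepts Wei A' w \<longleftrightarrow> accepts Wei A w"
proof -
  have fin: "finite (states A)" "finite (counters A)" and init: "init A \<in> states A"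
    and tr: "\<And>q p. q \<in> states A \<Longrightarrow> p \<in> profiles Lab Wei \<Longrightarrow> trans A q p \<in> states A"
    and op: "\<And>q p f. q \<in> states A \<Longrightarrow> p \<in> profiles Lab Wei \<Longrightarrow> f \<in> set (ops A q p) \<Longrightarrow> op_over Wei (counters A) f"
    and acc: "acc A \<subseteq> Pow (counters A)"
    using A unfolding weighted_max_automaton_def by auto
  obtain g :: "'s \<Rightarrow> nat" where g: "inj_on g (states A)"
    using finite_imp_inj_to_nat_seg[OF fin(1)] by blast
  obtain h :: "'c \<Rightarrow> nat" where h: "inj_on h (counters A)"
    using finite_imp_inj_to_nat_seg[OF fin(2)] by blast
  define d where "d = inv_into (states A) g"
  have d: "d (g q) = q" if "q \<in> states A" for q using g that by (simp add: d_def)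
  define A' where "A' = \<lparr>states = g ` states A, counters = h ` counters A, init = g (init A),
    trans = (\<lambda>q p. g (trans A (d q) p)), ops = (\<lambda>q p. map (map_counter_op id h) (ops A (d q) p)),
    acc = (\<lambda>S. h ` S) ` acc A\<rparr>"
  have sel [simp]: "states A' = g ` states A" "counters A' = h ` counters A" "init A' = g (init A)"
    "trans A' q p = g (trans A (d q) p)" "ops A' q p = map (map_counter_op id h) (ops A (d q) p)"
    "acc A' = (\<lambda>S. h ` S) ` acc A" for q p
    by (simp_all add: A'_def)
  have over: "op_over Wei (h ` C) (map_counter_op id h f)" if "op_over Wei C f" for f C
    using that by (cases f) auto
  have "weighted_max_automaton Lab Wei A'"
    unfolding weighted_max_automaton_def
  proof (intro conjI ballI)
    show "acc A' \<subseteq> Pow (counters A')" using acc by (auto intro!: imageI)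
  qed (use fin init tr op over in \<open>auto simp: d\<close>)
  moreover have "accepts Wei A' w \<longleftrightarrow> accepts Wei A w" if w: "w \<in> weighted_words Lab Wei" for w
  proof -
    note prof = profile_at_in_profiles[OF w]
    have st: "state_after Wei A w n \<in> states A" for n
      by (induction n) (auto simp: init tr prof)
    have st': "state_after Wei A' w n = g (state_after Wei A w n)" for n
      by (induction n) (auto simp: d st)
    have fold: "fold (exec_op wt) (map (map_counter_op id h) fs) v' (h c) = fold (exec_op wt) fs v c"
      if "\<forall>f\<in>set fs. op_over Wei (counters A) f" "\<forall>c\<in>counters A. v' (h c) = v c" "c \<in> counters A"
      for wt fs c and v' v :: "_ \<Rightarrow> enat"
      using that
    proof (induction fs arbitrary: v v')
      case (Cons f fs)
      have "\<forall>c\<in>counters A. exec_op wt (map_counter_op id h f) v' (h c) = exec_op wt f v c"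
        using Cons.prems(1,2) h by (cases f) (auto simp: inj_on_eq_iff)
      from Cons.IH[OF _ this Cons.prems(3)] show ?case using Cons.prems(1) by simp
    qed simp
    have val: "\<forall>c\<in>counters A. val_after Wei A' w n (h c) = val_after Wei A w n c" for n
    proof (induction n)
      case (Suc n)
      then show ?case
        using fold[OF _ Suc] op[OF st prof] by (auto simp: st' d[OF st])
    qed simp
    have "{c \<in> counters A'. limsup (\<lambda>n. val_after Wei A' w n c) = \<infinity>} =
        h ` {c \<in> counters A. limsup (\<lambda>n. val_after Wei A w n c) = \<infinity>}"
      using val by (auto simp: image_iff)
    moreover have "h ` S = h ` T \<longleftrightarrow> S = T" if "S \<subseteq> counters A" "T \<subseteq> counters A" for S T
      using inj_on_image_eq_iff[OF h that] .
    ultimately show ?thesis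
      using acc unfolding accepts_def sel by (auto simp: image_iff) 
  qed
  ultimately show ?thesis by (rule that)
qed


subsection \<open>From recognizable properties to automata\<close>

text \<open>\<open>Val (j, r)\<close> holds the largest weight of a set of marks that leads the condition \<open>j\<close> to the
  quotient \<open>r\<close>. All \<open>Val\<close> counters change simultaneously, whence the copies \<open>Tmp\<close>.\<close>

datatype ('x, 'j) reg = Val 'x | Tmp 'x | Out 'j | Aux

text \<open>Units outside \<open>Wei\<close> or of infinite weight add nothing, in agreement with
  \<open>fw\<close>. The counters thus stay finite and the operations stay over the
  alphabet.\<close>

definition inc_ops :: "'a set \<Rightarrow> 'a profile \<Rightarrow> 'a option \<Rightarrow> ('a, ('x, 'j) reg) counter_op list" where
  "inc_ops Wei p u = (case u of None \<Rightarrow> [Incr Aux]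
     | Some b \<Rightarrow> if b \<in> Wei - snd (snd p) then [Add_weight Aux b] else [])"

lemma fold_inc_ops:
  "fold (exec_op (\<lambda>b. weight w b n)) (inc_ops Wei (profile_at Wei w n) u) v =
     v(Aux := v Aux + enat (uw (fw Wei w) u n))"
proof (cases u)
  case None
  then show ?thesis by (simp add: inc_ops_def uw_def one_enat_def)
next
  case (Some b)
  show ?thesis
  proof (cases "b \<in> Wei \<and> weight w b n \<noteq> \<infinity>")
    case True
    then show ?thesis
      by (auto simp: Some inc_ops_def uw_def profile_at_def fw_finite fun_eq_iff)
  next
    case False
    then show ?thesis
      by (auto simp: Some inc_ops_def uw_def profile_at_def fw_def zero_enat_def[symmetric])
  qed
qed

lemma fold_reset:
  "fold (exec_op wt) (map (\<lambda>x. Reset (r x)) xs) v = (\<lambda>c. if c \<in> r ` set xs then 0 else v c)"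
  by (induction xs arbitrary: v) (auto simp: fun_eq_iff)

lemma fold_copy:
  "fold (exec_op wt) (map (\<lambda>x. Assign_max (Val x) (Tmp x) (Tmp x)) xs) v =
     (\<lambda>c. case c of Val x \<Rightarrow> if x \<in> set xs then v (Tmp x) else v c | _ \<Rightarrow> v c)"
  by (induction xs arbitrary: v) (auto simp: fun_eq_iff split: reg.split)

text \<open>One transition of \<open>qstep\<close> with mark \<open>m\<close>. The candidate weight
  is built in \<open>Aux\<close> and maximized into the copy \<open>Tmp\<close> of the target; as
  only \<open>Val\<close> is read as a source, the order of the transitions is immaterial.\<close>

definition move_ops where
  "move_ops Wei p = (\<lambda>((j, r), m). [Assign_max Aux (Val (j, r)) (Val (j, r))] @
     (if m then inc_ops Wei p (fst j) else []) @
     [let y = (j, lq r [(p, m)]) in Assign_max (Tmp y) (Tmp y) Aux])"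

definition moved :: "'a set \<Rightarrow> 'a wword \<Rightarrow> nat \<Rightarrow> (_ \<Rightarrow> enat) \<Rightarrow> _ \<Rightarrow> enat" where
  "moved Wei w n v = (\<lambda>((j, r), m). v (Val (j, r)) + (if m then enat (uw (fw Wei w) (fst j) n) else 0))"

lemma fold_move_ops1:
  "fold (exec_op (\<lambda>b. weight w b n)) (move_ops Wei (profile_at Wei w n) ((j, r), m)) v =
     (let e = moved Wei w n v ((j, r), m); y = (j, lq r [(profile_at Wei w n, m)])
      in v(Aux := e, Tmp y := max (v (Tmp y)) e))"
  by (auto simp: move_ops_def moved_def Let_def fold_inc_ops fun_eq_iff)

lemma fold_move_ops:
  fixes Wei :: "'a set" and w :: "'a wword" and n :: nat and v :: "_ \<Rightarrow> enat"
  defines "v' \<equiv> \<lambda>L. fold (exec_op (\<lambda>b. weight w b n)) (concat (map (move_ops Wei (profile_at Wei w n)) L)) v"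
  shows "v' L (Tmp y) = max (v (Tmp y))
      (Sup {moved Wei w n v ((j, r), m) | j r m. ((j, r), m) \<in> set L \<and> (j, lq r [(profile_at Wei w n, m)]) = y})"
proof -
  let ?S = "\<lambda>L y. {moved Wei w n v ((j, r), m) | j r m. ((j, r), m) \<in> set L \<and> (j, lq r [(profile_at Wei w n, m)]) = y}"
  \<comment> \<open>The induction also has to say that \<open>Val\<close> is unchanged, since every
    later candidate reads it.\<close>
  have "(\<forall>x. v' L (Val x) = v (Val x)) \<and>
    (\<forall>y. v' L (Tmp y) = max (v (Tmp y)) (Sup (?S L y)))"
  proof (induction L rule: rev_induct)
    case Nil
    show ?case by (simp add: v'_def bot_enat_def[symmetric])
  next
    case (snoc a L)
    obtain j r m where a: "a = ((j, r), m)" by (metis prod.exhaust)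
    obtain u K where j: "j = (u, K)" by (cases j)
    have step: "v' (L @ [a]) = (let e = moved Wei w n (v' L) ((j, r), m); y = (j, lq r [(profile_at Wei w n, m)])
      in (v' L)(Aux := e, Tmp y := max (v' L (Tmp y)) e))"
      by (simp add: v'_def a fold_move_ops1)
    have e: "moved Wei w n (v' L) ((j, r), m) = moved Wei w n v ((j, r), m)"
      unfolding moved_def by (simp add: snoc[THEN conjunct1, rule_format])
    have S: "?S (L @ [a]) y = (if y = (j, lq r [(profile_at Wei w n, m)])
        then insert (moved Wei w n v ((j, r), m)) (?S L y) else ?S L y)" for y
      by (auto simp: a j)
    show ?case
      unfolding step e S
      by (simp add: Let_def sup_enat_def max.commute max.left_commute snoc[THEN conjunct1, rule_format]
          snoc[THEN conjunct2, rule_format])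
  qed
  then show "v' L (Tmp y) = max (v (Tmp y)) (Sup (?S L y))" by blast
qed

lemma fold_out:
  fixes v :: "_ \<Rightarrow> enat"
  shows "fold (exec_op wt) (map (\<lambda>(j, r). Assign_max (Out j) (Out j) (Val (j, r))) L) v =
     (\<lambda>c. case c of Out j \<Rightarrow> max (v (Out j)) (Sup {v (Val (j, r)) | r. (j, r) \<in> set L}) | _ \<Rightarrow> v c)"
proof (induction L rule: rev_induct)
  case Nil
  show ?case by (auto simp: fun_eq_iff bot_enat_def[symmetric] split: reg.split)
next
  case (snoc a L)
  obtain i s where a: "a = (i, s)" by fastforce
  have S: "{v (Val (j, r)) | r. (j, r) \<in> set (L @ [a])} = (if j = i
        then insert (v (Val (i, s))) {v (Val (j, r)) | r. (j, r) \<in> set L} else {v (Val (j, r)) | r. (j, r) \<in> set L})" for j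
    by (auto simp: a)
  show ?case
    unfolding S by (auto simp: snoc a fun_eq_iff sup_enat_def max.commute max.left_commute split: reg.split)
qed

lemma recog_automaton:
  fixes P :: "(nat \<Rightarrow> 'a profile) \<Rightarrow> ('a \<Rightarrow> nat \<Rightarrow> nat) \<Rightarrow> bool"
  assumes "recog P"
  obtains A :: "('a, nat, nat) max_automaton" where "weighted_max_automaton Lab Wei A"
    "\<And>w. w \<in> weighted_words Lab Wei \<Longrightarrow> accepts Wei A w \<longleftrightarrow> P (profile_at Wei w) (fw Wei w)"
proof -
  obtain J where J: "decides J P" using assms unfolding recog_def by blast
  then have fJ: "finite J" "\<forall>(u, K)\<in>J. regular K" unfolding decides_def by auto
  obtain Js where Js: "set Js = J" using finite_list[OF fJ(1)] by blast
  obtain Us where Us: "set Us = quniv J" using finite_list[OF finite_quniv[OF fJ]] by blast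
  let ?C = "Val ` quniv J \<union> Tmp ` quniv J \<union> Out ` J \<union> {Aux}"
  \<comment> \<open>A counter cannot express that a quotient is unreachable: its value
    \<open>0\<close> looks like weight \<open>0\<close>. The state records which pairs are
    reachable, and only those are moved. \<open>Out j\<close> is recomputed in each step from the
    accepting quotients, and \<open>acc\<close> admits the truth vectors that some word and weights
    satisfying \<open>P\<close> realize.\<close>
  define A where "A = \<lparr>states = Pow (quniv J), counters = ?C, init = qinit J, trans = qstep,
    ops = (\<lambda>q p. map (\<lambda>x. Reset (Tmp x)) Us @
      concat (map (move_ops Wei p) (List.product (filter (\<lambda>x. x \<in> q) Us) [False, True])) @
      map (\<lambda>x. Assign_max (Val x) (Tmp x) (Tmp x)) Us @
      map (\<lambda>j. Reset (Out j)) Js @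
      map (\<lambda>(j, r). Assign_max (Out j) (Out j) (Val (j, r))) (filter (\<lambda>(j, r). [] \<in> r) Us)),
    acc = {S. S \<subseteq> ?C \<and> (\<exists>\<alpha> f. P \<alpha> f \<and> (\<forall>(u, K)\<in>J. Out (u, K) \<in> S \<longleftrightarrow> Unbd u K \<alpha> f))}\<rparr>"
  have sel [simp]: "states A = Pow (quniv J)" "counters A = ?C" "init A = qinit J" "trans A = qstep"
    by (simp_all add: A_def)
  have ops: "ops A q p = map (\<lambda>x. Reset (Tmp x)) Us @
      concat (map (move_ops Wei p) (List.product (filter (\<lambda>x. x \<in> q) Us) [False, True])) @
      map (\<lambda>x. Assign_max (Val x) (Tmp x) (Tmp x)) Us @
      map (\<lambda>j. Reset (Out j)) Js @
      map (\<lambda>(j, r). Assign_max (Out j) (Out j) (Val (j, r))) (filter (\<lambda>(j, r). [] \<in> r) Us)" for q p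
    by (simp add: A_def)
  have "op_over Wei ?C f" if q: "q \<subseteq> quniv J" and f: "f \<in> set (ops A q p)" for q p f
  proof -
    have move: "op_over Wei ?C f" if "(j, r) \<in> quniv J" "f \<in> set (move_ops Wei p ((j, r), m))" for j r m
      using that quniv_lq[OF that(1), of "[(p, m)]"]
      by (auto simp: move_ops_def inc_ops_def Let_def split: if_splits option.splits)
    have "j \<in> J" if "(j, r) \<in> quniv J" for j r using that by (auto simp: quniv_def)
    then show ?thesis
      using f move by (auto simp: A_def Us Js)
  qed
  then have wma: "weighted_max_automaton Lab Wei A"
    using finite_quniv[OF fJ] fJ(1) qinit_subset[of J] qstep_subset[of _ J]
    unfolding weighted_max_automaton_def by (auto simp: A_def)
  have "accepts Wei A w \<longleftrightarrow> P (profile_at Wei w) (fw Wei w)" for w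
  proof -
    let ?\<alpha> = "profile_at Wei w" and ?f = "fw Wei w"
    let ?Ms = "\<lambda>n j r. {M. M \<subseteq> {..<n} \<and> lq (snd j) (pre (mark ?\<alpha> M) n) = r}"
    let ?w = "\<lambda>j M. enat (sum (uw ?f (fst j)) M)"
    let ?q = "state_after Wei A w" and ?v = "val_after Wei A w"
    have q: "?q n = foldl qstep (qinit J) (pre ?\<alpha> n)" for n
      by (induction n) (simp_all add: pre_Suc)
    have q_iff: "(j, r) \<in> ?q n \<longleftrightarrow> j \<in> J \<and> ?Ms n j r \<noteq> {}" for j r n
    proof
      assume "(j, r) \<in> ?q n"
      then obtain y where y: "j \<in> J" "r = lq (snd j) y" "map fst y = pre ?\<alpha> n"
        unfolding q foldl_qinit by blast
      then obtain M where "M \<subseteq> {..<n}" "y = pre (mark ?\<alpha> M) n" using ex_pre_mark by metis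
      then show "j \<in> J \<and> ?Ms n j r \<noteq> {}" using y by blast
    next
      assume "j \<in> J \<and> ?Ms n j r \<noteq> {}"
      then obtain M where "j \<in> J" "r = lq (snd j) (pre (mark ?\<alpha> M) n)" by blast
      then show "(j, r) \<in> ?q n"
        unfolding q foldl_qinit using map_fst_pre_mark[of ?\<alpha> M n] by blast
    qed
    have qU: "?q n \<subseteq> quniv J" for n
      by (induction n) (auto simp: qinit_subset qstep_subset[THEN subsetD])
    have finMs: "finite (?Ms n j r)" for n j r
      by (rule finite_subset[of _ "Pow {..<n}"]) auto
    define v1 where "v1 n = (\<lambda>c. if c \<in> Tmp ` quniv J then 0 else ?v n c)" for n
    define v2 where "v2 n = fold (exec_op (\<lambda>b. weight w b n)) (concat (map (move_ops Wei (?\<alpha> n))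
        (List.product (filter (\<lambda>x. x \<in> ?q n) Us) [False, True]))) (v1 n)" for n
    define v3 where "v3 n = (\<lambda>c. case c of Val x \<Rightarrow> if x \<in> quniv J then v2 n (Tmp x) else v2 n c | _ \<Rightarrow> v2 n c)" for n
    define v4 where "v4 n = (\<lambda>c. if c \<in> Out ` J then 0 else v3 n c)" for n
    have v5: "?v (Suc n) = (\<lambda>c. case c of Out j \<Rightarrow> max (v4 n (Out j))
        (Sup {v4 n (Val (j, r)) | r. (j, r) \<in> set (filter (\<lambda>(j, r). [] \<in> r) Us)}) | _ \<Rightarrow> v4 n c)" for n
      unfolding v4_def v3_def v2_def v1_def
      by (simp only: val_after.simps ops fold_append o_apply fold_reset fold_copy fold_out Us Js)
    have Val_Suc: "?v (Suc n) (Val y) = Sup {moved Wei w n (v1 n) ((j, r), m) | j r m.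
        (j, r) \<in> ?q n \<and> (j, lq r [(?\<alpha> n, m)]) = y}" if "y \<in> quniv J" for n y
    proof -
      have mem: "((j, r), m) \<in> set (List.product (filter (\<lambda>x. x \<in> ?q n) Us) [False, True]) \<longleftrightarrow> (j, r) \<in> ?q n"
        for j r m
        using qU[of n] Us by auto
      have "?v (Suc n) (Val y) = v2 n (Tmp y)"
        using that unfolding v5 by (simp add: v4_def v3_def image_iff)
      also have "\<dots> = Sup {moved Wei w n (v1 n) ((j, r), m) | j r m.
        ((j, r), m) \<in> set (List.product (filter (\<lambda>x. x \<in> ?q n) Us) [False, True]) \<and> (j, lq r [(?\<alpha> n, m)]) = y}"
        using that unfolding v2_def fold_move_ops by (simp add: v1_def)
      finally show ?thesis unfolding mem .
    qed
    \<comment> \<open>For an unreachable quotient both sides are \<open>0\<close>, the supremum of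
      the empty set.\<close>
    have Val: "?v n (Val (j, r)) = Sup (?w j ` ?Ms n j r)" if "(j, r) \<in> quniv J" for n j r
      using that
    proof (induction n arbitrary: j r)
      case 0
      have "Sup (?w j ` ?Ms 0 j r) \<le> 0" by (rule Sup_least) (auto simp: zero_enat_def)
      then show ?case by simp
    next
      case (Suc n)
      have mov: "moved Wei w n (v1 n) ((j', r'), m) =
        Sup (?w j' ` ?Ms n j' r') + (if m then enat (uw ?f (fst j') n) else 0)" if "(j', r') \<in> ?q n" for j' r' m
        using Suc.IH[of j' r'] that qU[of n] by (auto simp: moved_def v1_def)
      have ins: "sum (uw ?f u) (if m then insert n M else M) = sum (uw ?f u) M + (if m then uw ?f u n else 0)"
        if "M \<subseteq> {..<n}" for M u m
      proof -
        have "finite M" "n \<notin> M" using that finite_subset[OF that] by auto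
        then show ?thesis by simp
      qed
      show ?case
        unfolding Val_Suc[OF Suc.prems]
      proof (rule antisym)
        show "Sup {moved Wei w n (v1 n) ((j', r'), m) | j' r' m.
            (j', r') \<in> ?q n \<and> (j', lq r' [(?\<alpha> n, m)]) = (j, r)} \<le> Sup (?w j ` ?Ms (Suc n) j r)"
        proof (rule Sup_least)
          fix e assume "e \<in> {moved Wei w n (v1 n) ((j', r'), m) | j' r' m.
            (j', r') \<in> ?q n \<and> (j', lq r' [(?\<alpha> n, m)]) = (j, r)}"
          then obtain r' m where r': "e = moved Wei w n (v1 n) ((j, r'), m)" "(j, r') \<in> ?q n"
            "lq r' [(?\<alpha> n, m)] = r" by auto
          have "Sup (?w j ` ?Ms n j r') \<in> ?w j ` ?Ms n j r'"
            using r'(2) finMs unfolding q_iff by (intro finite_enat_Sup_in) auto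
          then obtain M where M: "M \<subseteq> {..<n}" "lq (snd j) (pre (mark ?\<alpha> M) n) = r'"
            "Sup (?w j ` ?Ms n j r') = ?w j M" by auto
          let ?M = "if m then insert n M else M"
          have "pre (mark ?\<alpha> ?M) n = pre (mark ?\<alpha> M) n" by (rule pre_cong) (simp add: mark_def)
          moreover have "n \<in> ?M \<longleftrightarrow> m" using M(1) by auto
          ultimately have "?M \<in> ?Ms (Suc n) j r"
            using M(1,2) r'(3) by (auto simp: pre_mark_Suc lq_append)
          moreover have "e = ?w j ?M"
            unfolding r'(1) mov[OF r'(2)] M(3) ins[OF M(1)] by (simp add: zero_enat_def)
          ultimately show "e \<le> Sup (?w j ` ?Ms (Suc n) j r)" by (intro Sup_upper) blast
        qed
        show "Sup (?w j ` ?Ms (Suc n) j r) \<le> Sup {moved Wei w n (v1 n) ((j', r'), m) | j' r' m.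
            (j', r') \<in> ?q n \<and> (j', lq r' [(?\<alpha> n, m)]) = (j, r)}"
        proof (rule SUP_least)
          fix M assume M: "M \<in> ?Ms (Suc n) j r"
          let ?M = "M \<inter> {..<n}" and ?r = "lq (snd j) (pre (mark ?\<alpha> M) n)"
          have "pre (mark ?\<alpha> ?M) n = pre (mark ?\<alpha> M) n" by (rule pre_cong) (simp add: mark_def)
          then have Mn: "?M \<in> ?Ms n j ?r" by simp
          have "j \<in> J" using Suc.prems by (auto simp: quniv_def)
          then have q: "(j, ?r) \<in> ?q n" using Mn q_iff by blast
          have r: "lq ?r [(?\<alpha> n, n \<in> M)] = r" using M by (simp add: pre_mark_Suc lq_append)
          have "M = (if n \<in> M then insert n ?M else ?M)" using M by (auto simp: less_Suc_eq)
          then have "?w j M = ?w j ?M + (if n \<in> M then enat (uw ?f (fst j) n) else 0)"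
            using ins[of ?M "fst j" "n \<in> M"] by (auto simp: zero_enat_def)
          also have "\<dots> \<le> moved Wei w n (v1 n) ((j, ?r), n \<in> M)"
            unfolding mov[OF q] using Mn by (intro add_right_mono SUP_upper)
          also have "\<dots> \<le> Sup {moved Wei w n (v1 n) ((j', r'), m) | j' r' m.
            (j', r') \<in> ?q n \<and> (j', lq r' [(?\<alpha> n, m)]) = (j, r)}"
            using q r by (intro Sup_upper) blast
          finally show "?w j M \<le> \<dots>" .
        qed
      qed
    qed
    have Out_Suc: "?v (Suc n) (Out j) = Sup {?v (Suc n) (Val (j, r)) | r. (j, r) \<in> quniv J \<and> [] \<in> r}" if "j \<in> J" for n j
      using that unfolding v5 by (simp add: v4_def Us image_iff)
    have Out: "limsup (\<lambda>n. ?v n (Out (u, K))) = \<infinity> \<longleftrightarrow> Unbd u K ?\<alpha> ?f" if j: "(u, K) \<in> J" for u K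
    proof -
      have "enat k \<le> ?v n (Out (u, K)) \<longleftrightarrow> (\<exists>M\<subseteq>{..<n}. k \<le> sum (uw ?f u) M \<and> pre (mark ?\<alpha> M) n \<in> K)"
        if "0 < k" "k \<le> n" for k n
      proof -
        have "n \<noteq> 0" using that by simp
        then obtain n' where n: "n = Suc n'" by (metis not0_implies_Suc)
        have "enat k \<le> ?v n (Out (u, K)) \<longleftrightarrow>
            (\<exists>r. ((u, K), r) \<in> quniv J \<and> [] \<in> r \<and> enat k \<le> ?v n (Val ((u, K), r)))"
          unfolding n Out_Suc[OF j] enat_le_Sup_iff[OF that(1)]
          by blast
        also have "\<dots> \<longleftrightarrow>
            (\<exists>r. ((u, K), r) \<in> quniv J \<and> [] \<in> r \<and> enat k \<le> Sup (?w (u, K) ` ?Ms n (u, K) r))"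
          using Val by (intro ex_cong1 conj_cong refl) simp
        also have "\<dots> \<longleftrightarrow> (\<exists>r. ((u, K), r) \<in> quniv J \<and> [] \<in> r \<and> (\<exists>M\<in>?Ms n (u, K) r. k \<le> sum (uw ?f u) M))"
          unfolding enat_le_Sup_iff[OF that(1)] by simp
        also have "\<dots> \<longleftrightarrow> (\<exists>M\<subseteq>{..<n}. k \<le> sum (uw ?f u) M \<and> pre (mark ?\<alpha> M) n \<in> K)"
        proof
          assume "\<exists>r. ((u, K), r) \<in> quniv J \<and> [] \<in> r \<and> (\<exists>M\<in>?Ms n (u, K) r. k \<le> sum (uw ?f u) M)"
          then obtain r M where "[] \<in> r" "M \<subseteq> {..<n}" "lq K (pre (mark ?\<alpha> M) n) = r" "k \<le> sum (uw ?f u) M"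
            by auto
          then show "\<exists>M\<subseteq>{..<n}. k \<le> sum (uw ?f u) M \<and> pre (mark ?\<alpha> M) n \<in> K"
            using Nil_in_lq by blast
        next
          assume "\<exists>M\<subseteq>{..<n}. k \<le> sum (uw ?f u) M \<and> pre (mark ?\<alpha> M) n \<in> K"
          then obtain M where M: "M \<subseteq> {..<n}" "k \<le> sum (uw ?f u) M" "pre (mark ?\<alpha> M) n \<in> K" by blast
          have "((u, K), lq K (pre (mark ?\<alpha> M) n)) \<in> quniv J" using j by (auto simp: quniv_def)
          then show "\<exists>r. ((u, K), r) \<in> quniv J \<and> [] \<in> r \<and> (\<exists>M\<in>?Ms n (u, K) r. k \<le> sum (uw ?f u) M)"
            using M by (intro exI[of _ "lq K (pre (mark ?\<alpha> M) n)"]) auto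
        qed
        finally show ?thesis .
      qed
      \<comment> \<open>Thresholds are shifted by one: \<open>Out\<close> is computed from the first
        step on, and \<open>enat_le_Sup_iff\<close> needs a positive bound.\<close>
      then have iff: "(\<exists>n\<ge>Suc k. enat (Suc k) \<le> ?v n (Out (u, K))) \<longleftrightarrow>
          (\<exists>n\<ge>Suc k. \<exists>M\<subseteq>{..<n}. Suc k \<le> sum (uw ?f u) M \<and> pre (mark ?\<alpha> M) n \<in> K)" for k
        by (intro ex_cong1 conj_cong refl) blast
      have all_Suc: "(\<forall>k. R k) \<longleftrightarrow> (\<forall>k. R (Suc k))" if "R (Suc 0) \<Longrightarrow> R 0" for R :: "nat \<Rightarrow> bool"
        using that by (metis not0_implies_Suc)
      have "limsup (\<lambda>n. ?v n (Out (u, K))) = \<infinity> \<longleftrightarrow> (\<forall>k. \<exists>n\<ge>Suc k. enat (Suc k) \<le> ?v n (Out (u, K)))"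
        unfolding limsup_enat_infinity by (rule all_Suc) (auto simp flip: zero_enat_def)
      also have "\<dots> \<longleftrightarrow> Unbd u K ?\<alpha> ?f"
        unfolding iff Unbd_def by (rule all_Suc[symmetric]) (meson Suc_leD)
      finally show ?thesis .
    qed
    let ?S = "{c \<in> ?C. limsup (\<lambda>n. ?v n c) = \<infinity>}"
    have S: "Out (u, K) \<in> ?S \<longleftrightarrow> Unbd u K ?\<alpha> ?f" if "(u, K) \<in> J" for u K
      using that Out by auto
    have "accepts Wei A w \<longleftrightarrow> (\<exists>\<beta> g. P \<beta> g \<and> (\<forall>(u, K)\<in>J. Out (u, K) \<in> ?S \<longleftrightarrow> Unbd u K \<beta> g))"
      by (auto simp: accepts_def A_def)
    also have "\<dots> \<longleftrightarrow> P ?\<alpha> ?f"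
    proof
      assume "\<exists>\<beta> g. P \<beta> g \<and> (\<forall>(u, K)\<in>J. Out (u, K) \<in> ?S \<longleftrightarrow> Unbd u K \<beta> g)"
      then obtain \<beta> g where b: "P \<beta> g" "\<forall>(u, K)\<in>J. Out (u, K) \<in> ?S \<longleftrightarrow> Unbd u K \<beta> g" by blast
      have "P ?\<alpha> ?f \<longleftrightarrow> P \<beta> g" by (rule decidesD[OF J]) (use b(2) S in auto)
      then show "P ?\<alpha> ?f" using b(1) by simp
    next
      assume "P ?\<alpha> ?f"
      then show "\<exists>\<beta> g. P \<beta> g \<and> (\<forall>(u, K)\<in>J. Out (u, K) \<in> ?S \<longleftrightarrow> Unbd u K \<beta> g)"
        using S by (intro exI[of _ ?\<alpha>] exI[of _ ?f]) auto
    qed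
    finally show ?thesis .
  qed
  then show ?thesis using max_automaton_nat[OF wma] that by metis
qed

subsection \<open>Derived formulas\<close>

definition Conj :: "'a formula \<Rightarrow> 'a formula \<Rightarrow> 'a formula" where
  "Conj \<phi> \<psi> = Neg (Disj (Neg \<phi>) (Neg \<psi>))"

definition Imp :: "'a formula \<Rightarrow> 'a formula \<Rightarrow> 'a formula" where
  "Imp \<phi> \<psi> = Disj (Neg \<phi>) \<psi>"

definition All_pos :: "nat \<Rightarrow> 'a formula \<Rightarrow> 'a formula" where
  "All_pos x \<phi> = Neg (Ex_pos x (Neg \<phi>))"

primrec Conjs :: "'a formula list \<Rightarrow> 'a formula" where
  "Conjs [] = Neg (Ex_pos 0 (Less 0 0))"
| "Conjs (\<phi> # \<phi>s) = Conj \<phi> (Conjs \<phi>s)"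

primrec Disjs :: "'a formula list \<Rightarrow> 'a formula" where
  "Disjs [] = Ex_pos 0 (Less 0 0)"
| "Disjs (\<phi> # \<phi>s) = Disj \<phi> (Disjs \<phi>s)"

primrec Ex_sets :: "nat list \<Rightarrow> 'a formula \<Rightarrow> 'a formula" where
  "Ex_sets [] \<phi> = \<phi>"
| "Ex_sets (X # Xs) \<phi> = Ex_set X (Ex_sets Xs \<phi>)"

lemma sat_derived [simp]:
  "sat w s S (Conj \<phi> \<psi>) \<longleftrightarrow> sat w s S \<phi> \<and> sat w s S \<psi>"
  "sat w s S (Imp \<phi> \<psi>) \<longleftrightarrow> (sat w s S \<phi> \<longrightarrow> sat w s S \<psi>)"
  "sat w s S (All_pos x \<phi>) \<longleftrightarrow> (\<forall>p. sat w (s(x := p)) S \<phi>)"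
  by (auto simp: Conj_def Imp_def All_pos_def)

lemma over_alphabet_derived [simp]:
  "over_alphabet Lab Wei (Conj \<phi> \<psi>) \<longleftrightarrow> over_alphabet Lab Wei \<phi> \<and> over_alphabet Lab Wei \<psi>"
  "over_alphabet Lab Wei (Imp \<phi> \<psi>) \<longleftrightarrow> over_alphabet Lab Wei \<phi> \<and> over_alphabet Lab Wei \<psi>"
  "over_alphabet Lab Wei (All_pos x \<phi>) \<longleftrightarrow> over_alphabet Lab Wei \<phi>"
  by (auto simp: Conj_def Imp_def All_pos_def)

lemma free_derived [simp]:
  "free_pos (Conj \<phi> \<psi>) = free_pos \<phi> \<union> free_pos \<psi>"
  "free_pos (Imp \<phi> \<psi>) = free_pos \<phi> \<union> free_pos \<psi>"
  "free_pos (All_pos x \<phi>) = free_pos \<phi> - {x}"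
  "free_set (Conj \<phi> \<psi>) = free_set \<phi> \<union> free_set \<psi>"
  "free_set (Imp \<phi> \<psi>) = free_set \<phi> \<union> free_set \<psi>"
  "free_set (All_pos x \<phi>) = free_set \<phi>"
  by (auto simp: Conj_def Imp_def All_pos_def)

lemma Conjs_simps [simp]:
  "sat w s S (Conjs \<phi>s) \<longleftrightarrow> (\<forall>\<phi>\<in>set \<phi>s. sat w s S \<phi>)"
  "over_alphabet Lab Wei (Conjs \<phi>s) \<longleftrightarrow> (\<forall>\<phi>\<in>set \<phi>s. over_alphabet Lab Wei \<phi>)"
  "free_pos (Conjs \<phi>s) = (\<Union>\<phi>\<in>set \<phi>s. free_pos \<phi>)"
  "free_set (Conjs \<phi>s) = (\<Union>\<phi>\<in>set \<phi>s. free_set \<phi>)"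
  by (induction \<phi>s) auto

lemma Disjs_simps [simp]:
  "sat w s S (Disjs \<phi>s) \<longleftrightarrow> (\<exists>\<phi>\<in>set \<phi>s. sat w s S \<phi>)"
  "over_alphabet Lab Wei (Disjs \<phi>s) \<longleftrightarrow> (\<forall>\<phi>\<in>set \<phi>s. over_alphabet Lab Wei \<phi>)"
  "free_pos (Disjs \<phi>s) = (\<Union>\<phi>\<in>set \<phi>s. free_pos \<phi>)"
  "free_set (Disjs \<phi>s) = (\<Union>\<phi>\<in>set \<phi>s. free_set \<phi>)"
  by (induction \<phi>s) auto

lemma Ex_sets_simps [simp]:
  "over_alphabet Lab Wei (Ex_sets Xs \<phi>) \<longleftrightarrow> over_alphabet Lab Wei \<phi>"
  "free_pos (Ex_sets Xs \<phi>) = free_pos \<phi>"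
  "free_set (Ex_sets Xs \<phi>) = free_set \<phi> - set Xs"
  by (induction Xs) auto

lemma sat_Ex_sets:
  "sat w s S (Ex_sets Xs \<phi>) \<longleftrightarrow>
     (\<exists>T. (\<forall>X\<in>set Xs. finite (T X)) \<and> sat w s (\<lambda>X. if X \<in> set Xs then T X else S X) \<phi>)"
proof (induction Xs arbitrary: S)
  case (Cons X Xs)
  have "(\<exists>P. finite P \<and> (\<exists>T. (\<forall>Y\<in>set Xs. finite (T Y)) \<and>
        sat w s (\<lambda>Y. if Y \<in> set Xs then T Y else (S(X := P)) Y) \<phi>)) \<longleftrightarrow>
    (\<exists>T. (\<forall>Y\<in>set (X # Xs). finite (T Y)) \<and>
        sat w s (\<lambda>Y. if Y \<in> set (X # Xs) then T Y else S Y) \<phi>)" (is "?L \<longleftrightarrow> ?R")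
  proof
    assume ?L
    then obtain P T where PT: "finite P" "\<forall>Y\<in>set Xs. finite (T Y)"
      "sat w s (\<lambda>Y. if Y \<in> set Xs then T Y else (S(X := P)) Y) \<phi>" by blast
    let ?T = "\<lambda>Y. if Y \<in> set Xs then T Y else P"
    have "(\<lambda>Y. if Y \<in> set Xs then T Y else (S(X := P)) Y) =
        (\<lambda>Y. if Y \<in> set (X # Xs) then ?T Y else S Y)" by (auto simp: fun_eq_iff)
    then show ?R using PT by (intro exI[of _ ?T]) auto
  next
    assume ?R
    then obtain T where T: "\<forall>Y\<in>set (X # Xs). finite (T Y)"
      "sat w s (\<lambda>Y. if Y \<in> set (X # Xs) then T Y else S Y) \<phi>" by blast
    have "(\<lambda>Y. if Y \<in> set (X # Xs) then T Y else S Y) =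
        (\<lambda>Y. if Y \<in> set Xs then T Y else (S(X := T X)) Y)" by (auto simp: fun_eq_iff)
    then show ?L using T by (intro exI[of _ "T X"] conjI exI[of _ T]) auto
  qed
  then show ?case using Cons by simp
qed simp


subsection \<open>Profiles and runs in the logic\<close>

text \<open>The logic has no predicate for infinite weights; but the weights of the subsets of \<open>{x}\<close> are
  unbounded exactly if the weight of \<open>x\<close> is infinite.\<close>

definition Inf_at :: "'a \<Rightarrow> nat \<Rightarrow> 'a formula" where
  "Inf_at b x = Unb_wei b 0 (All_pos (Suc x) (Imp (Mem (Suc x) 0)
     (Conj (Neg (Less (Suc x) x)) (Neg (Less x (Suc x))))))"

lemma Inf_at_simps [simp]:
  "over_alphabet Lab Wei (Inf_at b x) \<longleftrightarrow> b \<in> Wei"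
  "free_pos (Inf_at b x) = {x}"
  "free_set (Inf_at b x) = {}"
  by (auto simp: Inf_at_def)

lemma sat_Inf_at [simp]: "sat w s S (Inf_at b x) \<longleftrightarrow> weight w b (s x) = \<infinity>"
proof -
  have "sat w s S (Inf_at b x) \<longleftrightarrow> (\<forall>n. \<exists>P. finite P \<and> enat n \<le> set_weight w b P \<and> P \<subseteq> {s x})"
  proof -
    have "P \<subseteq> {s x} \<longleftrightarrow> (\<forall>p. p \<in> P \<longrightarrow> \<not> p < s x \<and> \<not> s x < p)" for P
      by (auto simp: subset_iff)
    then show ?thesis by (simp add: Inf_at_def)
  qed
  also have "\<dots> \<longleftrightarrow> weight w b (s x) = \<infinity>"
  proof
    assume L: "\<forall>n. \<exists>P. finite P \<and> enat n \<le> set_weight w b P \<and> P \<subseteq> {s x}"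
    have "enat n \<le> weight w b (s x)" for n
    proof -
      obtain P where P: "enat n \<le> set_weight w b P" "P \<subseteq> {s x}" using L by blast
      have "set_weight w b P \<le> weight w b (s x)"
        using P(2) by (auto simp: subset_singleton_iff set_weight_def)
      then show ?thesis using P(1) by (rule order_trans[rotated])
    qed
    then show "weight w b (s x) = \<infinity>"
      by (metis enat.exhaust enat_ord_simps(1) not_less_eq_eq order_refl)
  next
    assume "weight w b (s x) = \<infinity>"
    then show "\<forall>n. \<exists>P. finite P \<and> enat n \<le> set_weight w b P \<and> P \<subseteq> {s x}"
      by (intro allI exI[of _ "{s x}"]) (simp add: set_weight_def)
  qed
  finally show ?thesis .
qed

definition Profile_at :: "'a list \<Rightarrow> 'a profile \<Rightarrow> nat \<Rightarrow> 'a formula" where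
  "Profile_at bs = (\<lambda>(a, N, I) x. Conjs (Lab_at a x #
     map (\<lambda>b. if b \<in> N then Wei_at b x else Neg (Wei_at b x)) bs @
     map (\<lambda>b. if b \<in> I then Inf_at b x else Neg (Inf_at b x)) bs))"

lemma Profile_at_simps:
  assumes "p \<in> profiles Lab Wei" "set bs = Wei"
  shows "over_alphabet Lab Wei (Profile_at bs p x)"
    and "free_pos (Profile_at bs p x) = {x}"
    and "free_set (Profile_at bs p x) = {}"
    and "sat w s S (Profile_at bs p x) \<longleftrightarrow> profile_at Wei w (s x) = p"
proof -
  obtain a N I where p: "p = (a, N, I)" by (cases p)
  show "over_alphabet Lab Wei (Profile_at bs p x)" "free_pos (Profile_at bs p x) = {x}"
    "free_set (Profile_at bs p x) = {}"
    using assms by (auto simp: p Profile_at_def profiles_def split: if_splits)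
  have "sat w s S (Profile_at bs p x) \<longleftrightarrow> label w (s x) = a \<and>
      (\<forall>b\<in>Wei. weight w b (s x) \<noteq> 0 \<longleftrightarrow> b \<in> N) \<and> (\<forall>b\<in>Wei. weight w b (s x) = \<infinity> \<longleftrightarrow> b \<in> I)"
  proof -
    have "sat w s S (if c then \<phi> else Neg \<phi>) \<longleftrightarrow> (sat w s S \<phi> \<longleftrightarrow> c)" for c \<phi> by simp
    then show ?thesis by (simp add: p Profile_at_def assms(2)[symmetric] ball_Un del: not_infinity_eq) blast
  qed
  also have "\<dots> \<longleftrightarrow> profile_at Wei w (s x) = p"
    using assms(1) by (auto simp: p profile_at_def profiles_def)
  finally show "sat w s S (Profile_at bs p x) \<longleftrightarrow> profile_at Wei w (s x) = p" .
qed

text \<open>The run of the quotient automaton up to the position \<open>1\<close>, on the word marked by the set variable \<open>0\<close>: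
  the set variable \<open>v r\<close> contains the positions at which the state is \<open>r\<close>.\<close>

lemma regular_definable:
  fixes K :: "('a profile \<times> bool) list set"
  assumes alph: "weighted_alphabet Lab Wei" and K: "regular K"
  obtains \<phi> where "over_alphabet Lab Wei \<phi>" "free_pos \<phi> \<subseteq> {1}" "free_set \<phi> \<subseteq> {0}"
    "\<And>w s S. w \<in> weighted_words Lab Wei \<Longrightarrow>
       sat w s S \<phi> \<longleftrightarrow> pre (mark (profile_at Wei w) (S 0)) (s 1) \<in> K"
proof -
  have "finite Wei" using alph by (simp add: weighted_alphabet_def)
  then obtain bs where bs: "set bs = Wei" using finite_list by blast
  obtain ps where ps: "set ps = profiles Lab Wei" using finite_list[OF finite_profiles[OF alph]] by blast
  have Q: "finite (range (lq K))" using K by (simp add: regular_def)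
  obtain qs where qs: "set qs = range (lq K)" using finite_list[OF Q] by blast
  obtain g :: "_ \<Rightarrow> nat" where g: "inj_on g (range (lq K))"
    using finite_imp_inj_to_nat_seg[OF Q] by blast
  \<comment> \<open>The successor keeps variable \<open>0\<close> free for the marked set.\<close>
  define v where "v r = Suc (g r)" for r
  have v: "v r = v r' \<longleftrightarrow> r = r'" if "r \<in> range (lq K)" "r' \<in> range (lq K)" for r r'
    using g that by (simp add: v_def inj_on_eq_iff)
  have step: "lq r [a] \<in> range (lq K)" if "r \<in> range (lq K)" for r a
    using that by (auto simp: lq_append[symmetric])
  \<comment> \<open>A position stands for the prefix of that length: the first position carries the
    initial quotient \<open>K\<close>, and the position variable \<open>1\<close> the final
    one.\<close>
  define C1 :: "'a formula" where "C1 = All_pos 2 (Imp (Neg (Ex_pos 3 (Less 3 2))) (Mem 2 (v K)))"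
  define D where "D r p m = Imp
     (Conjs [Mem 2 (v r), Profile_at bs p 2, if m then Mem 2 0 else Neg (Mem 2 0)])
     (Mem 3 (v (lq r [(p, m)])))" for r p m
  \<comment> \<open>The transitions are imposed only up to the position variable \<open>1\<close>,
    so that finite sets can hold the run.\<close>
  define C2 where "C2 = All_pos 2 (All_pos 3 (Imp
     (Conjs [Less 2 3, Neg (Ex_pos 4 (Conj (Less 2 4) (Less 4 3))), Neg (Less 1 3)])
     (Conjs (map (\<lambda>(r, p, m). D r p m) (List.product qs (List.product ps [False, True]))))))"
  \<comment> \<open>The sets are only known to contain the run, possibly with further positions.
    Forbidding all rejecting quotients at the end therefore forces acceptance, where asking for an
    accepting one would not.\<close>
  define C3 :: "'a formula" where "C3 = Conjs (map (\<lambda>r. Neg (Mem 1 (v r))) (filter (\<lambda>r. [] \<notin> r) qs))"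
  define \<phi> where "\<phi> = Ex_sets (map v qs) (Conjs [C1, C2, C3])"
  have KQ: "K \<in> range (lq K)" by (rule range_eqI[of _ _ "[]"]) simp
  have D: "over_alphabet Lab Wei (D r p m)" "free_pos (D r p m) \<subseteq> {1, 2, 3}"
    "free_set (D r p m) \<subseteq> insert 0 (v ` set qs)"
    if "p \<in> set ps" "r \<in> set qs" for r p m
    using that Profile_at_simps(1,2,3)[OF _ bs, of p Lab] step[of r "(p, m)"]
    by (auto simp: D_def ps qs split: if_splits)
  have "over_alphabet Lab Wei \<phi>"
    using D(1) by (auto simp: \<phi>_def C1_def C2_def C3_def)
  moreover have "free_pos \<phi> \<subseteq> {1}"
  proof -
    have "free_pos (case a of (r, p, m) \<Rightarrow> D r p m) \<subseteq> {1, 2, 3}"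
      if "a \<in> set qs \<times> set ps \<times> {False, True}" for a
      using that D(2) by (cases a) simp
    then have "free_pos C2 \<subseteq> {1}"
      by (simp add: C2_def) blast
    then show ?thesis by (auto simp: \<phi>_def C1_def C3_def)
  qed
  moreover have "free_set \<phi> \<subseteq> {0}"
  proof -
    have "free_set (case a of (r, p, m) \<Rightarrow> D r p m) \<subseteq> insert 0 (v ` set qs)"
      if "a \<in> set qs \<times> set ps \<times> {False, True}" for a
      using that D(3) by (cases a) simp
    then have "free_set C2 \<subseteq> insert 0 (v ` set qs)"
      by (simp add: C2_def) blast
    then show ?thesis using KQ by (auto simp: \<phi>_def C1_def C3_def qs)
  qed
  moreover have "sat w s S \<phi> \<longleftrightarrow> pre (mark (profile_at Wei w) (S 0)) (s 1) \<in> K"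
    if w: "w \<in> weighted_words Lab Wei" for w s S
  proof -
    let ?\<alpha> = "mark (profile_at Wei w) (S 0)" and ?n = "s 1"
    let ?run = "\<lambda>z. lq K (pre ?\<alpha> z)"
    note prof = profile_at_in_profiles[OF w]
    have succ: "z < z' \<and> \<not> (\<exists>y. z < y \<and> y < z') \<longleftrightarrow> z' = Suc z" for z z' :: nat
      by (metis lessI less_antisym not_less_eq)
    have C1: "sat w s T C1 \<longleftrightarrow> 0 \<in> T (v K)" for T
      by (auto simp: C1_def)
    have D_sat: "sat w s' T (D r p m) \<longleftrightarrow> (s' 2 \<in> T (v r) \<and> profile_at Wei w (s' 2) = p \<and> (s' 2 \<in> T 0 \<longleftrightarrow> m)
        \<longrightarrow> s' 3 \<in> T (v (lq r [(p, m)])))" if "p \<in> profiles Lab Wei" for s' T r p m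
      using Profile_at_simps(4)[OF that bs] by (auto simp: D_def)
    have C2: "sat w s T C2 \<longleftrightarrow> (\<forall>z<?n. \<forall>r\<in>range (lq K). z \<in> T (v r) \<longrightarrow>
        Suc z \<in> T (v (lq r [(profile_at Wei w z, z \<in> T 0)])))" for T
    proof -
      have "sat w s T C2 \<longleftrightarrow> (\<forall>z z'. (z < z' \<and> \<not> (\<exists>y. z < y \<and> y < z')) \<and> \<not> ?n < z' \<longrightarrow>
        (\<forall>r\<in>range (lq K). \<forall>p\<in>profiles Lab Wei. \<forall>m\<in>{False, True}. z \<in> T (v r) \<and> profile_at Wei w z = p \<and> (z \<in> T 0 \<longleftrightarrow> m)
        \<longrightarrow> z' \<in> T (v (lq r [(p, m)]))))"
        by (simp add: C2_def D_sat ps qs)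
      moreover have "(\<forall>p\<in>profiles Lab Wei. \<forall>m\<in>{False, True}. z \<in> T (v r) \<and> profile_at Wei w z = p \<and> (z \<in> T 0 \<longleftrightarrow> m)
        \<longrightarrow> z' \<in> T (v (lq r [(p, m)]))) \<longleftrightarrow>
        (z \<in> T (v r) \<longrightarrow> z' \<in> T (v (lq r [(profile_at Wei w z, z \<in> T 0)])))" for z z' r
        using prof[of z] by (cases "z \<in> T 0") auto
      ultimately show ?thesis unfolding succ by (simp add: not_less Suc_le_eq)
    qed
    have C3: "sat w s T C3 \<longleftrightarrow> (\<forall>r\<in>range (lq K). [] \<notin> r \<longrightarrow> ?n \<notin> T (v r))" for T
      by (auto simp: C3_def qs)
    have sat: "sat w s T (Conjs [C1, C2, C3]) \<longleftrightarrow> 0 \<in> T (v K) \<and>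
      (\<forall>z<?n. \<forall>r\<in>range (lq K). z \<in> T (v r) \<longrightarrow> Suc z \<in> T (v (lq r [?\<alpha> z]))) \<and>
      (\<forall>r\<in>range (lq K). [] \<notin> r \<longrightarrow> ?n \<notin> T (v r))" if "T 0 = S 0" for T
      using that by (simp add: C1 C2 C3 mark_def)
    let ?U = "\<lambda>T X. if X \<in> v ` range (lq K) then T X else S X"
    have U0: "?U T 0 = S 0" for T by (auto simp: v_def)
    have "sat w s S \<phi> \<longleftrightarrow> (\<exists>T. (\<forall>X\<in>v ` range (lq K). finite (T X)) \<and> sat w s (?U T) (Conjs [C1, C2, C3]))"
      unfolding \<phi>_def sat_Ex_sets set_map qs ..
    also have "\<dots> \<longleftrightarrow> pre ?\<alpha> ?n \<in> K"
    proof
      assume "\<exists>T. (\<forall>X\<in>v ` range (lq K). finite (T X)) \<and> sat w s (?U T) (Conjs [C1, C2, C3])"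
      then obtain T0 where T0: "sat w s (?U T0) (Conjs [C1, C2, C3])" by blast
      define T where "T = ?U T0"
      have "0 \<in> T (v K) \<and>
          (\<forall>z<?n. \<forall>r\<in>range (lq K). z \<in> T (v r) \<longrightarrow> Suc z \<in> T (v (lq r [?\<alpha> z]))) \<and>
          (\<forall>r\<in>range (lq K). [] \<notin> r \<longrightarrow> ?n \<notin> T (v r))"
        using T0 unfolding T_def[symmetric] by (rule iffD1[OF sat, rotated]) (simp only: T_def U0)
      then have T: "0 \<in> T (v K)"
        "\<And>z r. z < ?n \<Longrightarrow> r \<in> range (lq K) \<Longrightarrow> z \<in> T (v r) \<Longrightarrow> Suc z \<in> T (v (lq r [?\<alpha> z]))"
        "\<And>r. r \<in> range (lq K) \<Longrightarrow> [] \<notin> r \<Longrightarrow> ?n \<notin> T (v r)" by blast+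
      have "z \<le> ?n \<Longrightarrow> z \<in> T (v (?run z))" for z
      proof (induction z)
        case (Suc z)
        then show ?case using T(2)[of z "?run z"] by (simp add: pre_Suc lq_append)
      qed (simp add: T(1))
      then show "pre ?\<alpha> ?n \<in> K" using T(3)[of "?run ?n"] by fastforce
    next
      assume acc: "pre ?\<alpha> ?n \<in> K"
      define T where "T X = {z. z \<le> ?n \<and> v (?run z) = X}" for X
      have T: "?U T (v r) = {z. z \<le> ?n \<and> ?run z = r}" if "r \<in> range (lq K)" for r
        using that v by (auto simp: T_def)
      have run: "?run (Suc z) = lq (?run z) [?\<alpha> z]" for z by (simp add: pre_Suc lq_append)
      have "0 \<in> ?U T (v K) \<and>
          (\<forall>z<?n. \<forall>r\<in>range (lq K). z \<in> ?U T (v r) \<longrightarrow> Suc z \<in> ?U T (v (lq r [?\<alpha> z]))) \<and>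
          (\<forall>r\<in>range (lq K). [] \<notin> r \<longrightarrow> ?n \<notin> ?U T (v r))"
      proof (intro conjI allI impI ballI)
        show "0 \<in> ?U T (v K)" unfolding T[OF KQ] by simp
        show "Suc z \<in> ?U T (v (lq r [?\<alpha> z]))"
          if "z < ?n" "r \<in> range (lq K)" "z \<in> ?U T (v r)" for z r
          using that(1,3) unfolding T[OF that(2)] T[OF step[OF that(2)]] using run by auto
        show "?n \<notin> ?U T (v r)" if "r \<in> range (lq K)" "[] \<notin> r" for r
          unfolding T[OF that(1)] using acc that(2) by auto
      qed
      then have "sat w s (?U T) (Conjs [C1, C2, C3])" by (rule iffD2[OF sat, rotated]) (rule U0)
      moreover have "finite (T X)" for X by (simp add: T_def)
      ultimately show "\<exists>T. (\<forall>X\<in>v ` range (lq K). finite (T X)) \<and> sat w s (?U T) (Conjs [C1, C2, C3])"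
        by blast
    qed
    finally show ?thesis .
  qed
  ultimately show ?thesis by (rule that)
qed

text \<open>\<open>Unb_wei\<close> sees infinite weights and \<open>Unbd\<close> does not; they
  agree because \<open>K\<close> admits no marks at positions of infinite weight. Long prefixes are
  enforced by a universally quantified lower bound on the end of the prefix.\<close>

lemma Unbd_definable:
  fixes K :: "('a profile \<times> bool) list set"
  assumes alph: "weighted_alphabet Lab Wei" and K: "regular K"
    and u: "case u of None \<Rightarrow> True | Some b \<Rightarrow> b \<in> Wei \<and> (\<forall>y\<in>K. \<forall>(p, m)\<in>set y. m \<longrightarrow> b \<notin> snd (snd p))"
  obtains \<phi> where "sentence Lab Wei \<phi>"
    "\<And>w s S. w \<in> weighted_words Lab Wei \<Longrightarrow> sat w s S \<phi> \<longleftrightarrow> Unbd u K (profile_at Wei w) (fw Wei w)"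
proof -
  obtain \<psi> where \<psi>: "over_alphabet Lab Wei \<psi>" "free_pos \<psi> \<subseteq> {1}" "free_set \<psi> \<subseteq> {0}"
    "\<And>w s S. w \<in> weighted_words Lab Wei \<Longrightarrow>
       sat w s S \<psi> \<longleftrightarrow> pre (mark (profile_at Wei w) (S 0)) (s 1) \<in> K"
    using regular_definable[OF alph K] by metis
  \<comment> \<open>As the sorts are separate, \<open>0\<close> names both the lower bound, a
    position, and the marked set; the position \<open>1\<close> is the length of the prefix.\<close>
  define \<chi> where "\<chi> = Ex_pos 1 (Conjs [Neg (Less 1 0), All_pos 2 (Imp (Mem 2 0) (Less 2 1)), \<psi>])"
  define \<phi> where "\<phi> = All_pos 0 (case u of None \<Rightarrow> Unb 0 \<chi> | Some b \<Rightarrow> Unb_wei b 0 \<chi>)"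
  have "sentence Lab Wei \<phi>"
    using \<psi>(1,2,3) u by (auto simp: sentence_def \<phi>_def \<chi>_def split: option.splits)
  moreover have "sat w s S \<phi> \<longleftrightarrow> Unbd u K (profile_at Wei w) (fw Wei w)"
    if w: "w \<in> weighted_words Lab Wei" for w s S
  proof -
    let ?\<alpha> = "profile_at Wei w"
    let ?ok = "\<lambda>p P. \<exists>n. p \<le> n \<and> P \<subseteq> {..<n} \<and> pre (mark ?\<alpha> P) n \<in> K"
    have \<chi>: "sat w (s(0 := p)) (S(0 := P)) \<chi> \<longleftrightarrow> ?ok p P" for p P
      using \<psi>(4)[OF w] by (auto simp: \<chi>_def not_less subset_iff)
    have weight: "enat k \<le> set_weight w b P \<longleftrightarrow> k \<le> sum (uw (fw Wei w) u) P"
      if b: "u = Some b" and P: "P \<subseteq> {..<n}" "pre (mark ?\<alpha> P) n \<in> K" for k b P n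
    proof -
      have "weight w b i \<noteq> \<infinity>" if "i \<in> P" for i
      proof -
        have "(?\<alpha> i, True) \<in> set (pre (mark ?\<alpha> P) n)"
          using that P(1) by (force simp: pre_def mark_def)
        then have "b \<notin> snd (snd (?\<alpha> i))" "b \<in> Wei" using u b P(2) by auto
        then show ?thesis by (simp add: profile_at_def)
      qed
      moreover have "uw (fw Wei w) u = fw Wei w b" by (auto simp: b uw_def)
      ultimately show ?thesis using set_weight_finite[of b Wei P w] u b by auto
    qed
    have "sat w s S \<phi> \<longleftrightarrow> (\<forall>p k. \<exists>P. finite P \<and> k \<le> sum (uw (fw Wei w) u) P \<and> ?ok p P)"
    proof (cases u)
      case None
      then show ?thesis by (simp add: \<phi>_def \<chi> uw_def)
    next
      case (Some b)
      then have "sat w s S \<phi> \<longleftrightarrow> (\<forall>p k. \<exists>P. finite P \<and> enat k \<le> set_weight w b P \<and> ?ok p P)"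
        by (simp add: \<phi>_def \<chi>)
      then show ?thesis using weight[OF Some] by (metis (no_types, lifting))
    qed
    also have "\<dots> \<longleftrightarrow> Unbd u K ?\<alpha> (fw Wei w)"
    proof
      assume L: "\<forall>p k. \<exists>P. finite P \<and> k \<le> sum (uw (fw Wei w) u) P \<and> ?ok p P"
      show "Unbd u K ?\<alpha> (fw Wei w)"
        unfolding Unbd_def
      proof
        fix k
        obtain P n where "k \<le> sum (uw (fw Wei w) u) P" "k \<le> n" "P \<subseteq> {..<n}" "pre (mark ?\<alpha> P) n \<in> K"
          using L by blast
        then show "\<exists>n\<ge>k. \<exists>M\<subseteq>{..<n}. k \<le> sum (uw (fw Wei w) u) M \<and> pre (mark ?\<alpha> M) n \<in> K" by blast
      qed
    next
      assume R: "Unbd u K ?\<alpha> (fw Wei w)"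
      show "\<forall>p k. \<exists>P. finite P \<and> k \<le> sum (uw (fw Wei w) u) P \<and> ?ok p P"
      proof (intro allI)
        fix p k
        obtain n M where "n \<ge> p + k" "M \<subseteq> {..<n}" "p + k \<le> sum (uw (fw Wei w) u) M" "pre (mark ?\<alpha> M) n \<in> K"
          using R unfolding Unbd_def by blast
        then show "\<exists>P. finite P \<and> k \<le> sum (uw (fw Wei w) u) P \<and> ?ok p P"
          by (intro exI[of _ M] conjI exI[of _ n]) (auto intro: finite_subset)
      qed
    qed
    finally show ?thesis .
  qed
  ultimately show ?thesis by (rule that)
qed

subsection \<open>From automata to limit conditions\<close>

lemma regular_Int:
  assumes "regular K" "regular L"
  shows "regular (K \<inter> L)"
proof -
  have "range (lq (K \<inter> L)) \<subseteq> (\<lambda>(r, s). r \<inter> s) ` (range (lq K) \<times> range (lq L))"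
    by (auto simp: lq_def image_iff)
  then show ?thesis
    using assms unfolding regular_def by (meson finite_SigmaI finite_imageI finite_subset)
qed

lemma regular_all: "regular {y. \<forall>a\<in>set y. G a}"
proof -
  have "foldl (\<lambda>s a. s \<and> G a) True y \<longleftrightarrow> (\<forall>a\<in>set y. G a)" for y
    by (induction y rule: rev_induct) auto
  then show ?thesis
    using regular_foldl[of UNIV True "\<lambda>s a. s \<and> G a" "{True}"] by simp
qed

text \<open>Infinity survives everything but a reset or an assignment, so the set of infinite
  counters is a matter of profiles and finite control.\<close>

primrec inf_op :: "'a set \<Rightarrow> ('a, 'c) counter_op \<Rightarrow> 'c set \<Rightarrow> 'c set" where
  "inf_op B (Incr c) I = I"
| "inf_op B (Add_weight c b) I = (if b \<in> B then insert c I else I)"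
| "inf_op B (Reset c) I = I - {c}"
| "inf_op B (Assign_max c d e) I = (if d \<in> I \<or> e \<in> I then insert c I else I - {c})"

text \<open>The companion of \<open>inf_op\<close>: its values are the true ones as long as a
  counter is finite, and are disregarded otherwise.\<close>

primrec fin_op :: "('a \<Rightarrow> nat) \<Rightarrow> ('a, 'c) counter_op \<Rightarrow> ('c \<Rightarrow> nat) \<Rightarrow> 'c \<Rightarrow> nat" where
  "fin_op wt (Incr c) v = v(c := v c + 1)"
| "fin_op wt (Add_weight c b) v = v(c := v c + wt b)"
| "fin_op wt (Reset c) v = v(c := 0)"
| "fin_op wt (Assign_max c d e) v = v(c := max (v d) (v e))"

text \<open>\<open>set_op\<close> collects, for each path of assignments along which the value of a counter has been
  built up, the set of positions at which the path adds the unit \<open>u\<close>.\<close>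

primrec set_op :: "'a option \<Rightarrow> 'a set \<Rightarrow> nat \<Rightarrow> ('a, 'c) counter_op \<Rightarrow> ('c \<Rightarrow> nat set set) \<Rightarrow> 'c \<Rightarrow> nat set set" where
  "set_op u B n (Incr c) F = (if u = None then F(c := insert n ` F c) else F)"
| "set_op u B n (Add_weight c b) F = (if u = Some b \<and> b \<notin> B then F(c := insert n ` F c) else F)"
| "set_op u B n (Reset c) F = F(c := {{}})"
| "set_op u B n (Assign_max c d e) F = F(c := F d \<union> F e)"

text \<open>Inserting the current position \<open>n\<close> sends both \<open>M\<close> and
  \<open>insert n M\<close> to \<open>insert n M\<close>, so the two bits of \<open>c\<close> merge
  into \<open>True\<close>.\<close>

definition bump :: "'c \<Rightarrow> ('c \<times> bool) set \<Rightarrow> ('c \<times> bool) set" where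
  "bump c T = {x \<in> T. fst x \<noteq> c} \<union> {(c, True) | b. (c, b) \<in> T}"

text \<open>The effect of \<open>set_op\<close> on the membership of \<open>M\<close> and of \<open>insert n M\<close>, where \<open>M\<close> consists of
  positions before \<open>n\<close> and is empty iff \<open>e\<close>.\<close>

primrec bit_op :: "'a option \<Rightarrow> 'a set \<Rightarrow> bool \<Rightarrow> ('a, 'c) counter_op \<Rightarrow> ('c \<times> bool) set \<Rightarrow> ('c \<times> bool) set" where
  "bit_op u B e (Incr c) T = (if u = None then bump c T else T)"
| "bit_op u B e (Add_weight c b) T = (if u = Some b \<and> b \<notin> B then bump c T else T)"
| "bit_op u B e (Reset c) T = {x \<in> T. fst x \<noteq> c} \<union> (if e then {(c, False)} else {})"
| "bit_op u B e (Assign_max c d d') T =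
     {x \<in> T. fst x \<noteq> c} \<union> {(c, b) | b. (d, b) \<in> T \<or> (d', b) \<in> T}"

definition bits_of :: "'c set \<Rightarrow> nat \<Rightarrow> nat set \<Rightarrow> ('c \<Rightarrow> nat set set) \<Rightarrow> ('c \<times> bool) set" where
  "bits_of C n M F = {(c, b). c \<in> C \<and> (if b then insert n M else M) \<in> F c}"

lemma insert_in_image_insert:
  assumes "n \<notin> M"
  shows "insert n M \<in> insert n ` G \<longleftrightarrow> M \<in> G \<or> insert n M \<in> G"
proof
  assume "insert n M \<in> insert n ` G"
  then obtain M' where M': "insert n M = insert n M'" "M' \<in> G" by blast
  then have "M' = M \<or> M' = insert n M" using assms by (cases "n \<in> M'") (auto simp: insert_ident insert_absorb)
  then show "M \<in> G \<or> insert n M \<in> G" using M'(2) by blast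
next
  assume "M \<in> G \<or> insert n M \<in> G"
  then show "insert n M \<in> insert n ` G"
    by (metis image_eqI insert_absorb2)
qed

lemma bits_of_bump:
  assumes "n \<notin> M" "c \<in> C"
  shows "bits_of C n M (F(c := insert n ` F c)) = bump c (bits_of C n M F)"
proof -
  have "M \<notin> insert n ` F c" using assms(1) by blast
  moreover have "((d, b) \<in> bits_of C n M (F(c := insert n ` F c))) \<longleftrightarrow> (d, b) \<in> bump c (bits_of C n M F)"
    if "d \<noteq> c" for d b
    using that by (simp add: bits_of_def bump_def)
  ultimately have "x \<in> bits_of C n M (F(c := insert n ` F c)) \<longleftrightarrow> x \<in> bump c (bits_of C n M F)" for x
    using assms(2) insert_in_image_insert[OF assms(1), of "F c"]
    by (cases x; cases "fst x = c"; cases "snd x") (simp_all add: bits_of_def bump_def ex_bool_eq disj_commute)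
  then show ?thesis by blast
qed

lemma bits_of_set_op:
  assumes "n \<notin> M" "op_over Wei C x"
  shows "bits_of C n M (set_op u B n x F) = bit_op u B (M = {}) x (bits_of C n M F)"
proof (cases x)
  case (Incr c)
  then show ?thesis using assms by (simp add: bits_of_bump)
next
  case (Add_weight c b)
  then show ?thesis using assms by (simp add: bits_of_bump)
next
  case (Reset c)
  have "y \<in> bits_of C n M (F(c := {{}})) \<longleftrightarrow>
      y \<in> {x \<in> bits_of C n M F. fst x \<noteq> c} \<union> (if M = {} then {(c, False)} else {})" for y
    using assms(2) Reset by (cases y; cases "fst y = c"; cases "snd y") (simp_all add: bits_of_def)
  then show ?thesis unfolding Reset set_op.simps bit_op.simps by (rule set_eqI)
next
  case (Assign_max c d e)
  have "y \<in> bits_of C n M (F(c := F d \<union> F e)) \<longleftrightarrow> y \<in> {x \<in> bits_of C n M F. fst x \<noteq> c} \<union>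
      {(c, b) | b. (d, b) \<in> bits_of C n M F \<or> (e, b) \<in> bits_of C n M F}" for y
    using assms(2) Assign_max
    by (cases y; cases "fst y = c"; cases "snd y") (simp_all add: bits_of_def ex_bool_eq)
  then show ?thesis unfolding Assign_max set_op.simps bit_op.simps by (rule set_eqI)
qed

lemma bits_of_fold:
  assumes "n \<notin> M" "\<forall>x\<in>set xs. op_over Wei C x"
  shows "bits_of C n M (fold (set_op u B n) xs F) = fold (bit_op u B (M = {})) xs (bits_of C n M F)"
  using assms(2) by (induction xs arbitrary: F) (simp_all add: bits_of_set_op[OF assms(1), where Wei = Wei])

section \<open>Infinite values and assignment paths of a fixed automaton\<close>

context
  fixes Lab Wei :: "'a set" and A :: "('a, 'q, 'c) max_automaton"
  assumes alph: "weighted_alphabet Lab Wei" and wma: "weighted_max_automaton Lab Wei A"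
begin

lemma wma_simps:
  shows fin_states: "finite (states A)" and fin_counters: "finite (counters A)" and init_state: "init A \<in> states A"
    and trans_state: "q \<in> states A \<Longrightarrow> p \<in> profiles Lab Wei \<Longrightarrow> trans A q p \<in> states A"
    and ops_over: "q \<in> states A \<Longrightarrow> p \<in> profiles Lab Wei \<Longrightarrow> \<forall>f\<in>set (ops A q p). op_over Wei (counters A) f"
    and acc_counters: "acc A \<subseteq> Pow (counters A)"
  using wma unfolding weighted_max_automaton_def by auto

lemma fin_Wei: "finite Wei"
  using alph by (simp add: weighted_alphabet_def)

lemmas fin_profiles = finite_profiles[OF alph]

definition units :: "'a option set" where
  "units = insert None (Some ` Wei)"

text \<open>Letters that are not profiles leave the state alone: regularity speaks of all words over
  the letter type, while the automaton is constrained on profiles only.\<close>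

definition inf_step :: "'q \<times> 'c set \<Rightarrow> 'a profile \<Rightarrow> 'q \<times> 'c set" where
  "inf_step = (\<lambda>(q, I) p. if p \<in> profiles Lab Wei
     then (trans A q p, fold (inf_op (snd (snd p))) (ops A q p) I) else (q, I))"

definition inf_lang :: "'c \<Rightarrow> 'a profile list set" where
  "inf_lang c = {u. foldl inf_step (init A, {}) u \<in> {(q, I). c \<in> I}}"

lemma fold_inf_op_subset:
  "\<forall>x\<in>set xs. op_over Wei (counters A) x \<Longrightarrow> I \<subseteq> counters A \<Longrightarrow> fold (inf_op B) xs I \<subseteq> counters A"
proof (induction xs arbitrary: I)
  case (Cons x xs)
  then have "inf_op B x I \<subseteq> counters A" by (cases x) auto
  then show ?case using Cons by simp
qed simp

lemma regular_inf_lang: "regular (inf_lang c)"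
  unfolding inf_lang_def
proof (rule regular_foldl)
  show "finite (states A \<times> Pow (counters A))" using fin_states fin_counters by simp
  show "(init A, {}) \<in> states A \<times> Pow (counters A)" using init_state by simp
  show "inf_step s p \<in> states A \<times> Pow (counters A)" if "s \<in> states A \<times> Pow (counters A)" for s p
  proof -
    obtain q I where sq: "s = (q, I)" by (cases s)
    have "fold (inf_op (snd (snd p))) (ops A q p) I \<subseteq> counters A" if "p \<in> profiles Lab Wei"
      using \<open>s \<in> _\<close> sq that by (intro fold_inf_op_subset ops_over) auto
    then show ?thesis using that trans_state unfolding sq inf_step_def by auto
  qed
qed

text \<open>\<open>T\<close> holds the counters with a path that collects exactly the positions
  marked so far, and \<open>e\<close> says that there are none. The sets start without the current
  position, hence \<open>T \<times> {False}\<close>; after the operations those counters remain that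
  have the bit \<open>m\<close>.\<close>

definition path_step :: "'a option \<Rightarrow> 'q \<times> bool \<times> 'c set \<Rightarrow> 'a profile \<times> bool \<Rightarrow> 'q \<times> bool \<times> 'c set" where
  "path_step u = (\<lambda>(q, e, T) (p, m). if p \<in> profiles Lab Wei
     then (trans A q p, e \<and> \<not> m,
       {c. (c, m) \<in> fold (bit_op u (snd (snd p)) e) (ops A q p) (T \<times> {False})})
     else (q, e, T))"

text \<open>The second set supplies the assumption of \<open>Unbd_definable\<close> on infinite
  weights. It loses no path, because \<open>set_op\<close> does not collect such positions.\<close>

definition path_lang :: "'a option \<Rightarrow> 'c \<Rightarrow> ('a profile \<times> bool) list set" where
  "path_lang u c = {y. foldl (path_step u) (init A, True, counters A) y \<in> {(q, e, T). c \<in> T}} \<inter>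
     {y. \<forall>a\<in>set y. snd a \<longrightarrow> (\<forall>b. u = Some b \<longrightarrow> b \<notin> snd (snd (fst a)))}"

lemma fold_bit_op_subset:
  "\<forall>x\<in>set xs. op_over Wei (counters A) x \<Longrightarrow> T \<subseteq> counters A \<times> UNIV \<Longrightarrow>
     fold (bit_op u B e) xs T \<subseteq> counters A \<times> UNIV"
proof (induction xs arbitrary: T)
  case (Cons x xs)
  then have "bit_op u B e x T \<subseteq> counters A \<times> UNIV" by (cases x) (auto simp: bump_def)
  then show ?case using Cons by simp
qed simp

lemma regular_path_lang: "regular (path_lang u c)"
  unfolding path_lang_def
proof (rule regular_Int[OF regular_foldl regular_all])
  let ?Q = "states A \<times> (UNIV :: bool set) \<times> Pow (counters A)"
  show "finite ?Q" using fin_states fin_counters by simp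
  show "(init A, True, counters A) \<in> ?Q" using init_state by simp
  show "path_step u s a \<in> ?Q" if s: "s \<in> ?Q" for s a
  proof -
    obtain q e T p m where sa: "s = (q, e, T)" "a = (p, m)" by (metis prod.exhaust)
    have "fold (bit_op u (snd (snd p)) e) (ops A q p) (T \<times> {False}) \<subseteq> counters A \<times> UNIV"
      if "p \<in> profiles Lab Wei"
      using s sa(1) that by (intro fold_bit_op_subset ops_over) auto
    then show ?thesis using s trans_state unfolding sa path_step_def by auto
  qed
qed

context
  fixes w :: "'a wword"
  assumes w: "w \<in> weighted_words Lab Wei"
begin

abbreviation "prof \<equiv> profile_at Wei w"
abbreviation "Q \<equiv> state_after Wei A w"
abbreviation "opsn n \<equiv> ops A (Q n) (prof n)"
abbreviation "infs n \<equiv> snd (snd (prof n))"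

lemmas prof = profile_at_in_profiles[OF w]

lemma Q: "Q n \<in> states A"
  by (induction n) (simp_all add: init_state trans_state prof)

lemma opsn: "\<forall>x\<in>set (opsn n). op_over Wei (counters A) x"
  by (rule ops_over[OF Q prof])

primrec inf_after :: "nat \<Rightarrow> 'c set" where
  "inf_after 0 = {}"
| "inf_after (Suc n) = fold (inf_op (infs n)) (opsn n) (inf_after n)"

primrec fin_after :: "nat \<Rightarrow> 'c \<Rightarrow> nat" where
  "fin_after 0 = (\<lambda>_. 0)"
| "fin_after (Suc n) = fold (fin_op (\<lambda>b. fw Wei w b n)) (opsn n) (fin_after n)"

primrec sets_after :: "'a option \<Rightarrow> nat \<Rightarrow> 'c \<Rightarrow> nat set set" where
  "sets_after u 0 = (\<lambda>_. {{}})"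
| "sets_after u (Suc n) = fold (set_op u (infs n) n) (opsn n) (sets_after u n)"

lemma pre_inf_lang: "pre prof n \<in> inf_lang c \<longleftrightarrow> c \<in> inf_after n"
proof -
  have "foldl inf_step (init A, {}) (pre prof n) = (Q n, inf_after n)"
    by (induction n) (simp_all add: pre_Suc inf_step_def prof)
  then show ?thesis by (simp add: inf_lang_def)
qed

lemma val_after_split: "val_after Wei A w n c = (if c \<in> inf_after n then \<infinity> else enat (fin_after n c))"
proof -
  have op: "exec_op (\<lambda>b. weight w b n) x (\<lambda>c. if c \<in> I then \<infinity> else enat (v c)) =
      (\<lambda>c. if c \<in> inf_op (infs n) x I then \<infinity> else enat (fin_op (\<lambda>b. fw Wei w b n) x v c))"
    if "op_over Wei (counters A) x" for n x I and v :: "'c \<Rightarrow> nat"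
  proof (cases x)
    case (Add_weight c b)
    then have "b \<in> Wei" using that by simp
    then show ?thesis
      using fw_finite[of b Wei w n] Add_weight by (auto simp: fun_eq_iff profile_at_def simp flip: plus_enat_simps(1))
  qed (auto simp: fun_eq_iff one_enat_def zero_enat_def)
  have fold: "fold (exec_op (\<lambda>b. weight w b n)) xs (\<lambda>c. if c \<in> I then \<infinity> else enat (v c)) =
      (\<lambda>c. if c \<in> fold (inf_op (infs n)) xs I then \<infinity>
        else enat (fold (fin_op (\<lambda>b. fw Wei w b n)) xs v c))"
    if "\<forall>x\<in>set xs. op_over Wei (counters A) x" for n xs I and v :: "'c \<Rightarrow> nat"
    using that by (induction xs arbitrary: I v) (simp_all add: op cong: if_cong)
  have "val_after Wei A w n = (\<lambda>c. if c \<in> inf_after n then \<infinity> else enat (fin_after n c))"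
    by (induction n) (simp_all add: zero_enat_def fold[OF opsn] cong: if_cong)
  then show ?thesis by simp
qed

lemma sets_after_positions:
  assumes "M \<in> sets_after u n c"
  shows "M \<subseteq> {..<n}" "i \<in> M \<Longrightarrow> u = Some b \<Longrightarrow> b \<notin> infs i"
proof -
  let ?G = "\<lambda>n. {M. M \<subseteq> {..<n} \<and> (\<forall>i\<in>M. \<forall>b. u = Some b \<longrightarrow> b \<notin> infs i)}"
  have op: "set_op u (infs n) n x F c \<subseteq> ?G (Suc n)" if "\<And>c. F c \<subseteq> ?G (Suc n)" for n x F and c :: 'c
    using that[of c] that by (cases x) (force split: if_splits)+
  have fold: "fold (set_op u (infs n) n) xs F c \<subseteq> ?G (Suc n)" if "\<And>c. F c \<subseteq> ?G (Suc n)" for n xs F and c :: 'c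
    using that
  proof (induction xs arbitrary: F)
    case (Cons x xs)
    from Cons.IH[OF op[OF Cons.prems]] show ?case by simp
  qed simp
  have "sets_after u n c \<subseteq> ?G n" for n c
  proof (induction n arbitrary: c)
    case (Suc n)
    have "?G n \<subseteq> ?G (Suc n)" by (auto simp: less_Suc_eq)
    then have "sets_after u n c \<subseteq> ?G (Suc n)" for c using Suc[of c] by (rule subset_trans[rotated])
    from fold[OF this] show ?case by simp
  qed simp
  then show "M \<subseteq> {..<n}" "i \<in> M \<Longrightarrow> u = Some b \<Longrightarrow> b \<notin> infs i" using assms by blast+
qed

lemma pre_path_lang:
  assumes c: "c \<in> counters A" and M: "M \<subseteq> {..<n}"
  shows "pre (mark prof M) n \<in> path_lang u c \<longleftrightarrow> M \<in> sets_after u n c"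
proof -
  have fold: "foldl (path_step u) (init A, True, counters A) (pre (mark prof M) n) =
      (Q n, M \<inter> {..<n} = {}, {c \<in> counters A. M \<inter> {..<n} \<in> sets_after u n c})" for n
  proof (induction n)
    case (Suc n)
    let ?M = "M \<inter> {..<n}"
    have n: "n \<notin> ?M" by simp
    \<comment> \<open>Sets collected earlier lie below \<open>n\<close>, so before the operations
      only bits \<open>False\<close> occur.\<close>
    have "insert n ?M \<notin> sets_after u n c" for c using sets_after_positions(1)[of "insert n ?M" u n c] by auto
    then have bits: "{c \<in> counters A. ?M \<in> sets_after u n c} \<times> {False} = bits_of (counters A) n ?M (sets_after u n)"
      by (auto simp: bits_of_def)
    have M': "M \<inter> {..<Suc n} = (if n \<in> M then insert n ?M else ?M)" by (auto simp: less_Suc_eq)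
    show ?case
      unfolding pre_mark_Suc foldl_append Suc foldl.simps
      unfolding path_step_def split_conv if_P[OF prof] bits bits_of_fold[OF n opsn, symmetric]
      unfolding M' by (auto simp: bits_of_def)
  qed simp
  have "\<forall>a\<in>set (pre (mark prof M) n). snd a \<longrightarrow> (\<forall>b. u = Some b \<longrightarrow> b \<notin> snd (snd (fst a)))"
    if "M \<in> sets_after u n c"
    using sets_after_positions(2)[OF that] by (auto simp: pre_def mark_def)
  moreover have "M \<inter> {..<n} = M" using M by blast
  ultimately show ?thesis using c by (auto simp: path_lang_def fold)
qed

text \<open>The lower bound on counters holds with factor one: a position counts once in
  \<open>M\<close> however often the path adds the unit there, and a maximum dominates both of its
  branches.\<close>

lemma sum_sets_after_le:
  assumes "M \<in> sets_after u n c"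
  shows "sum (uw (fw Wei w) u) M \<le> fin_after n c"
proof -
  let ?G = "\<lambda>k. {M. finite M \<and> sum (uw (fw Wei w) u) M \<le> k}"
  have ins: "insert n M \<in> ?G (k + uw (fw Wei w) u n)" if "M \<in> ?G k" for n M k
    using that by (auto simp: sum.insert_if)
  have op: "set_op u (infs n) n x F c \<subseteq> ?G (fin_op (\<lambda>b. fw Wei w b n) x v c)"
    if F: "\<And>c. F c \<subseteq> ?G (v c)" for n x F v and c :: 'c
  proof (cases x)
    case (Incr d)
    then show ?thesis using F[of c] ins[of _ "v d" n] F[of d] by (auto simp: uw_def)
  next
    case (Add_weight d b)
    then show ?thesis using F[of c] ins[of _ "v d" n] F[of d] by (auto simp: uw_def)
  next
    case (Assign_max d d1 d2)
    then show ?thesis using F[of c] F[of d1] F[of d2] by (auto simp: le_max_iff_disj)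
  qed (use F in auto)
  have fold: "fold (set_op u (infs n) n) xs F c \<subseteq> ?G (fold (fin_op (\<lambda>b. fw Wei w b n)) xs v c)"
    if "\<And>c. F c \<subseteq> ?G (v c)" for n xs F v and c :: 'c
    using that
  proof (induction xs arbitrary: F v)
    case (Cons x xs)
    from Cons.IH[OF op[OF Cons.prems]] show ?case by simp
  qed simp
  have "sets_after u n c \<subseteq> ?G (fin_after n c)" for n c
  proof (induction n arbitrary: c)
    case (Suc n)
    from fold[OF Suc] show ?case by simp
  qed simp
  then show ?thesis using assms by blast
qed

text \<open>Following the path that realizes the value of a counter, each unit is added at most
  \<open>L\<close> times per position.\<close>

lemma fin_after_le:
  assumes L: "\<And>q p. q \<in> states A \<Longrightarrow> p \<in> profiles Lab Wei \<Longrightarrow> length (ops A q p) \<le> L"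
  shows "\<exists>M. (\<forall>u. M u \<in> sets_after u n c) \<and>
    fin_after n c \<le> L * (\<Sum>u\<in>units. sum (uw (fw Wei w) u) (M u))"
proof -
  let ?w = "uw (fw Wei w)"
  let ?old = "\<lambda>n M. \<Sum>u\<in>units. sum (?w u) (M u \<inter> {..<n})"
  let ?new = "\<lambda>n M. \<Sum>u\<in>units. if n \<in> M u then ?w u n else 0"
  \<comment> \<open>Here \<open>i\<close> counts the operations already executed at position
    \<open>n\<close>. Each of them adds at most one unit, so the weight at \<open>n\<close> has the
    factor \<open>i\<close> while completed positions have the factor \<open>L\<close>.\<close>
  let ?inv = "\<lambda>n i F v. \<forall>c. \<exists>M. (\<forall>u. M u \<in> F u c) \<and> v c \<le> L * ?old n M + i * ?new n M"
  have fin: "finite units" using fin_Wei by (simp add: units_def)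
  have op: "?inv n (Suc i) (\<lambda>u. set_op u (infs n) n x (F u)) (fin_op (\<lambda>b. fw Wei w b n) x v)"
    if inv: "?inv n i F v" and x: "op_over Wei (counters A) x" for n i F x and v :: "'c \<Rightarrow> nat"
  proof
    fix c :: 'c
    have add: "\<exists>M'. M' u0 \<in> insert n ` F u0 c \<and> (\<forall>u. u \<noteq> u0 \<longrightarrow> M' u \<in> F u c) \<and>
        v c + ?w u0 n \<le> L * ?old n M' + Suc i * ?new n M'" if "u0 \<in> units" for u0
    proof -
      obtain M where M: "\<forall>u. M u \<in> F u c" "v c \<le> L * ?old n M + i * ?new n M" using inv by blast
      let ?M = "M(u0 := insert n (M u0))"
      have old: "?old n ?M = ?old n M" by (intro sum.cong arg_cong2[where f = sum]) auto
      have "i * ?new n M \<le> i * ?new n ?M" by (intro mult_le_mono2 sum_mono) auto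
      moreover have "?w u0 n \<le> ?new n ?M"
        using member_le_sum[OF that _ fin, of "\<lambda>u. if n \<in> ?M u then ?w u n else 0"] by simp
      ultimately have "v c + ?w u0 n \<le> L * ?old n ?M + Suc i * ?new n ?M"
        using M(2) unfolding mult_Suc old by linarith
      then show ?thesis using M(1) by (intro exI[of _ ?M]) auto
    qed
    have same: "\<exists>M. (\<forall>u. M u \<in> F u d) \<and> v d \<le> L * ?old n M + Suc i * ?new n M" for d
    proof -
      obtain M where "\<forall>u. M u \<in> F u d" "v d \<le> L * ?old n M + i * ?new n M" using inv by blast
      then show ?thesis by (intro exI[of _ M]) simp
    qed
    show "\<exists>M. (\<forall>u. M u \<in> set_op u (infs n) n x (F u) c) \<and>
        fin_op (\<lambda>b. fw Wei w b n) x v c \<le> L * ?old n M + Suc i * ?new n M"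
    proof (cases x)
      case (Incr d)
      show ?thesis
      proof (cases "c = d")
        case True
        obtain M where "M None \<in> insert n ` F None c" "\<forall>u. u \<noteq> None \<longrightarrow> M u \<in> F u c"
          "v c + ?w None n \<le> L * ?old n M + Suc i * ?new n M"
          using add[of None] by (auto simp: units_def)
        then show ?thesis using True Incr by (intro exI[of _ M]) (auto simp: uw_def)
      next
        case False
        then have "set_op u (infs n) n x (F u) c = F u c" for u using Incr by simp
        then show ?thesis using same[of c] False Incr by simp
      qed
    next
      case (Add_weight d b)
      show ?thesis
      proof (cases "c = d \<and> b \<notin> infs n")
        case True
        have b: "Some b \<in> units" using x Add_weight by (simp add: units_def)
        obtain M where "M (Some b) \<in> insert n ` F (Some b) c" "\<forall>u. u \<noteq> Some b \<longrightarrow> M u \<in> F u c"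
          "v c + ?w (Some b) n \<le> L * ?old n M + Suc i * ?new n M"
          using add[OF b] by (elim exE conjE)
        then show ?thesis using True Add_weight by (intro exI[of _ M]) (auto simp: uw_def)
      next
        case False
        have "fw Wei w b n = 0" if "b \<in> infs n" using that by (simp add: profile_at_def fw_def)
        then show ?thesis using False same[of c] Add_weight by auto
      qed
    next
      case (Reset d)
      show ?thesis
      proof (cases "c = d")
        case True
        then show ?thesis using Reset by (intro exI[of _ "\<lambda>_. {}"]) simp
      qed (use same[of c] Reset in simp)
    next
      case (Assign_max d d1 d2)
      show ?thesis
      proof (cases "c = d")
        case True
        show ?thesis
        proof (cases "v d1 \<le> v d2")
          case True
          then show ?thesis using same[of d2] \<open>c = d\<close> Assign_max by (auto simp: max_def)
        next
          case False
          then show ?thesis using same[of d1] \<open>c = d\<close> Assign_max by (auto simp: max_def)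
        qed
      qed (use same[of c] Assign_max in simp)
    qed
  qed
  have fold: "?inv n (i + length xs) (\<lambda>u. fold (set_op u (infs n) n) xs (F u)) (fold (fin_op (\<lambda>b. fw Wei w b n)) xs v)"
    if "?inv n i F v" "\<forall>x\<in>set xs. op_over Wei (counters A) x" for n i F xs and v :: "'c \<Rightarrow> nat"
    using that
  proof (induction xs arbitrary: i F v)
    case (Cons x xs)
    have "op_over Wei (counters A) x" using Cons.prems(2) by simp
    from Cons.IH[OF op[OF Cons.prems(1) this]] Cons.prems(2) show ?case by simp
  qed simp
  have "?inv n 0 (\<lambda>u. sets_after u n) (fin_after n)" for n
  proof (induction n)
    case 0
    show ?case by (intro allI exI[of _ "\<lambda>_. {}"]) simp
  next
    case (Suc n)
    show ?case
    proof
      fix c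
      from fold[OF Suc opsn[of n]] obtain M where M: "\<forall>u. M u \<in> sets_after u (Suc n) c"
        "fin_after (Suc n) c \<le> L * ?old n M + length (opsn n) * ?new n M"
        by auto
      have "length (opsn n) * ?new n M \<le> L * ?new n M" using L[OF Q prof] by (rule mult_le_mono1)
      moreover have "?old (Suc n) M = ?old n M + ?new n M"
        unfolding sum.distrib[symmetric]
      proof (rule sum.cong[OF refl])
        fix u
        have "M u \<inter> {..<Suc n} = (if n \<in> M u then insert n (M u \<inter> {..<n}) else M u \<inter> {..<n})"
          by (auto simp: less_Suc_eq)
        then show "sum (?w u) (M u \<inter> {..<Suc n}) = sum (?w u) (M u \<inter> {..<n}) + (if n \<in> M u then ?w u n else 0)"
          by simp
      qed
      ultimately have "fin_after (Suc n) c \<le> L * ?old (Suc n) M"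
        using M(2) by (simp only: distrib_left)
      then show "\<exists>M. (\<forall>u. M u \<in> sets_after u (Suc n) c) \<and>
          fin_after (Suc n) c \<le> L * ?old (Suc n) M + 0 * ?new (Suc n) M"
        using M(1) by (intro exI[of _ M]) simp
    qed
  qed
  then obtain M where M: "\<forall>u. M u \<in> sets_after u n c" "fin_after n c \<le> L * ?old n M"
    by fastforce
  have "M u \<inter> {..<n} = M u" for u using sets_after_positions(1)[of "M u" u n c] M(1) by blast
  then show ?thesis using M by auto
qed

text \<open>If infinite values do not recur, the counter is eventually finite and is bounded by
  \<open>L\<close> times a sum over the finitely many units. Bounds \<open>k u\<close> for the
  single units then give the bound \<open>?B\<close>, so an unbounded counter has an unbounded
  unit.\<close>

lemma limsup_counter:
  assumes c: "c \<in> counters A"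
  shows "limsup (\<lambda>n. val_after Wei A w n c) = \<infinity> \<longleftrightarrow>
    Inf_often (inf_lang c) prof \<or> (\<exists>u\<in>units. Unbd u (path_lang u c) prof (fw Wei w))"
proof
  assume lim: "limsup (\<lambda>n. val_after Wei A w n c) = \<infinity>"
  show "Inf_often (inf_lang c) prof \<or> (\<exists>u\<in>units. Unbd u (path_lang u c) prof (fw Wei w))"
  proof (rule ccontr)
    assume neg: "\<not> ?thesis"
    then obtain N where N: "\<And>n. n \<ge> N \<Longrightarrow> c \<notin> inf_after n"
      unfolding Inf_often_def pre_inf_lang by blast
    have "\<forall>u\<in>units. \<exists>k. \<forall>n\<ge>k. \<forall>M\<subseteq>{..<n}. k \<le> sum (uw (fw Wei w) u) M \<longrightarrow> pre (mark prof M) n \<notin> path_lang u c"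
      using neg not_Unbd by blast
    then obtain k where k: "\<And>u n M. u \<in> units \<Longrightarrow> n \<ge> k u \<Longrightarrow> M \<subseteq> {..<n} \<Longrightarrow>
        k u \<le> sum (uw (fw Wei w) u) M \<Longrightarrow> pre (mark prof M) n \<notin> path_lang u c" by metis
    have fin: "finite units" using fin_Wei by (simp add: units_def)
    have "finite ((\<lambda>(q, p). length (ops A q p)) ` (states A \<times> profiles Lab Wei))"
      using fin_states fin_profiles by simp
    then obtain L where "\<forall>l\<in>(\<lambda>(q, p). length (ops A q p)) ` (states A \<times> profiles Lab Wei). l \<le> L"
      using finite_nat_set_iff_bounded_le by blast
    then have L: "length (ops A q p) \<le> L" if "q \<in> states A" "p \<in> profiles Lab Wei" for q p
      using that by auto
    let ?B = "L * (\<Sum>u\<in>units. k u)"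
    \<comment> \<open>The time lies past \<open>N\<close>, where the counter is finite, and past
      every \<open>k u\<close>; the value exceeds \<open>?B\<close>.\<close>
    obtain n where n: "n \<ge> N + (\<Sum>u\<in>units. k u) + Suc ?B" "enat (N + (\<Sum>u\<in>units. k u) + Suc ?B) \<le> val_after Wei A w n c"
      using lim unfolding limsup_enat_infinity by blast
    have "Suc ?B \<le> fin_after n c" using n N[of n] by (simp add: val_after_split)
    moreover obtain M where M: "\<And>u. M u \<in> sets_after u n c"
      "fin_after n c \<le> L * (\<Sum>u\<in>units. sum (uw (fw Wei w) u) (M u))"
      using fin_after_le[OF L] by blast
    have "sum (uw (fw Wei w) u) (M u) \<le> k u" if u: "u \<in> units" for u
    proof -
      have sub: "M u \<subseteq> {..<n}" by (rule sets_after_positions(1)[OF M(1)])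
      have "k u \<le> (\<Sum>u\<in>units. k u)" using u fin by (intro member_le_sum) auto
      then have "k u \<le> n" using n(1) by simp
      then show ?thesis using k[OF u _ sub] M(1)[of u] pre_path_lang[OF c sub] by (meson nat_le_linear)
    qed
    then have "(\<Sum>u\<in>units. sum (uw (fw Wei w) u) (M u)) \<le> (\<Sum>u\<in>units. k u)" by (rule sum_mono)
    then have "fin_after n c \<le> ?B" using M(2) by (meson le_trans mult_le_mono2)
    ultimately show False by simp
  qed
next
  assume "Inf_often (inf_lang c) prof \<or> (\<exists>u\<in>units. Unbd u (path_lang u c) prof (fw Wei w))"
  then show "limsup (\<lambda>n. val_after Wei A w n c) = \<infinity>"
  proof
    assume "Inf_often (inf_lang c) prof"
    then have "\<exists>n\<ge>k. val_after Wei A w n c = \<infinity>" for k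
      unfolding Inf_often_def pre_inf_lang val_after_split by auto
    then show ?thesis unfolding limsup_enat_infinity by (metis enat_ord_code(3))
  next
    assume "\<exists>u\<in>units. Unbd u (path_lang u c) prof (fw Wei w)"
    then obtain u where u: "Unbd u (path_lang u c) prof (fw Wei w)" by blast
    show ?thesis
      unfolding limsup_enat_infinity
    proof
      fix k
      obtain n M where n: "n \<ge> k" "M \<subseteq> {..<n}" "k \<le> sum (uw (fw Wei w) u) M" "pre (mark prof M) n \<in> path_lang u c"
        using u unfolding Unbd_def by blast
      then have "k \<le> fin_after n c"
        using pre_path_lang[OF c n(2)] sum_sets_after_le by (meson le_trans)
      then show "\<exists>n\<ge>k. enat k \<le> val_after Wei A w n c"
        using n(1) by (intro exI[of _ n]) (simp add: val_after_split)
    qed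
  qed
qed

end

section \<open>Sentences for unbounded counters and for acceptance\<close>

lemma counter_definable:
  assumes c: "c \<in> counters A"
  obtains \<phi> where "sentence Lab Wei \<phi>" "\<And>w s S. w \<in> weighted_words Lab Wei \<Longrightarrow>
     sat w s S \<phi> \<longleftrightarrow> limsup (\<lambda>n. val_after Wei A w n c) = \<infinity>"
proof -
  have "\<exists>\<phi>. sentence Lab Wei \<phi> \<and> (\<forall>w\<in>weighted_words Lab Wei. \<forall>s S.
      sat w s S \<phi> \<longleftrightarrow> Unbd u (path_lang u c) (profile_at Wei w) (fw Wei w))" if "u \<in> units" for u
  proof -
    have "case u of None \<Rightarrow> True
        | Some b \<Rightarrow> b \<in> Wei \<and> (\<forall>y\<in>path_lang u c. \<forall>(p, m)\<in>set y. m \<longrightarrow> b \<notin> snd (snd p))"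
      using that by (auto simp: units_def path_lang_def split: option.split)
    from Unbd_definable[OF alph regular_path_lang this] show ?thesis by metis
  qed
  then obtain \<psi> where \<psi>: "\<And>u. u \<in> units \<Longrightarrow> sentence Lab Wei (\<psi> u)"
    "\<And>u w s S. u \<in> units \<Longrightarrow> w \<in> weighted_words Lab Wei \<Longrightarrow>
      sat w s S (\<psi> u) \<longleftrightarrow> Unbd u (path_lang u c) (profile_at Wei w) (fw Wei w)"
    by metis
  obtain \<chi> where \<chi>: "sentence Lab Wei \<chi>" "\<And>w s S. w \<in> weighted_words Lab Wei \<Longrightarrow>
      sat w s S \<chi> \<longleftrightarrow> Inf_often (inf_lang c) (profile_at Wei w)"
    using Unbd_definable[OF alph regular_marked_in[OF regular_inf_lang[of c]], of None]
    unfolding Unbd_marked_in by auto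
  have "finite units" using fin_Wei by (simp add: units_def)
  then obtain us where us: "set us = units" using finite_list by blast
  show ?thesis
  proof (rule that[of "Disj \<chi> (Disjs (map \<psi> us))"])
    show "sentence Lab Wei (Disj \<chi> (Disjs (map \<psi> us)))"
      using \<psi>(1) \<chi>(1) us by (auto simp: sentence_def)
    show "sat w s S (Disj \<chi> (Disjs (map \<psi> us))) \<longleftrightarrow> limsup (\<lambda>n. val_after Wei A w n c) = \<infinity>"
      if w: "w \<in> weighted_words Lab Wei" for w s S
      using \<psi>(2)[OF _ w] \<chi>(2)[OF w] limsup_counter[OF w c] us by auto
  qed
qed

lemma automaton_definable:
  obtains \<phi> where "sentence Lab Wei \<phi>"
    "\<And>w. w \<in> weighted_words Lab Wei \<Longrightarrow> satisfies w \<phi> \<longleftrightarrow> accepts Wei A w"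
proof -
  have "\<forall>c\<in>counters A. \<exists>\<phi>. sentence Lab Wei \<phi> \<and> (\<forall>w\<in>weighted_words Lab Wei. \<forall>s S.
     sat w s S \<phi> \<longleftrightarrow> limsup (\<lambda>n. val_after Wei A w n c) = \<infinity>)"
    using counter_definable by metis
  then obtain \<psi> where \<psi>: "\<And>c. c \<in> counters A \<Longrightarrow> sentence Lab Wei (\<psi> c)"
    "\<And>c w s S. c \<in> counters A \<Longrightarrow> w \<in> weighted_words Lab Wei \<Longrightarrow>
       sat w s S (\<psi> c) \<longleftrightarrow> limsup (\<lambda>n. val_after Wei A w n c) = \<infinity>"
    by metis
  obtain cs where cs: "set cs = counters A" using finite_list[OF fin_counters] by blast
  have "finite (acc A)" using acc_counters fin_counters by (meson finite_Pow_iff finite_subset)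
  then obtain Ss where Ss: "set Ss = acc A" using finite_list by blast
  define \<phi> where "\<phi> = Disjs (map (\<lambda>S. Conjs (map (\<lambda>c. if c \<in> S then \<psi> c else Neg (\<psi> c)) cs)) Ss)"
  show ?thesis
  proof (rule that[of \<phi>])
    show "sentence Lab Wei \<phi>"
      using \<psi>(1) cs by (auto simp: sentence_def \<phi>_def split: if_splits)
    show "satisfies w \<phi> \<longleftrightarrow> accepts Wei A w" if w: "w \<in> weighted_words Lab Wei" for w
    proof -
      let ?U = "{c \<in> counters A. limsup (\<lambda>n. val_after Wei A w n c) = \<infinity>}"
      have lit: "sat w s T (if c \<in> S then \<psi> c else Neg (\<psi> c)) \<longleftrightarrow> (c \<in> ?U \<longleftrightarrow> c \<in> S)"
        if "c \<in> counters A" for s T c S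
        using \<psi>(2)[OF that w] that by simp
      have "satisfies w \<phi> \<longleftrightarrow> (\<exists>S\<in>acc A. \<forall>c\<in>counters A. c \<in> ?U \<longleftrightarrow> c \<in> S)"
        unfolding satisfies_def \<phi>_def Disjs_simps(1) Conjs_simps(1) set_map Ss cs
        by (simp only: ball_simps bex_simps Conjs_simps(1) set_map cs lit cong: ball_cong)
      also have "\<dots> \<longleftrightarrow> (\<exists>S\<in>acc A. ?U = S)"
        using acc_counters by (intro bex_cong refl) blast
      also have "\<dots> \<longleftrightarrow> accepts Wei A w" by (auto simp: accepts_def)
      finally show ?thesis .
    qed
  qed
qed

end

theorem theorem5:
  fixes Lab Wei :: "'a set"
  assumes "weighted_alphabet Lab Wei"
  shows "(\<forall>\<phi>. sentence Lab Wei \<phi> \<longrightarrow>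
            (\<exists>A :: ('a, nat, nat) max_automaton. weighted_max_automaton Lab Wei A \<and>
               (\<forall>w\<in>weighted_words Lab Wei. accepts Wei A w \<longleftrightarrow> satisfies w \<phi>))) \<and>
         (\<forall>A :: ('a, 'q, 'c) max_automaton. weighted_max_automaton Lab Wei A \<longrightarrow>
            (\<exists>\<phi>. sentence Lab Wei \<phi> \<and>
               (\<forall>w\<in>weighted_words Lab Wei. satisfies w \<phi> \<longleftrightarrow> accepts Wei A w)))"
proof (intro conjI allI impI)
  fix \<phi> :: "'a formula" assume "sentence Lab Wei \<phi>"
  then have "over_alphabet Lab Wei \<phi>" by (simp add: sentence_def)
  then obtain P where P: "recog P"
    "\<And>w. w \<in> weighted_words Lab Wei \<Longrightarrow> satisfies w \<phi> \<longleftrightarrow> P (profile_at Wei w) (fw Wei w)"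
    using recog_sentence by blast
  obtain A :: "('a, nat, nat) max_automaton" where "weighted_max_automaton Lab Wei A"
    "\<And>w. w \<in> weighted_words Lab Wei \<Longrightarrow> accepts Wei A w \<longleftrightarrow> P (profile_at Wei w) (fw Wei w)"
    using recog_automaton[OF P(1), of Lab Wei] by blast
  then show "\<exists>A :: ('a, nat, nat) max_automaton. weighted_max_automaton Lab Wei A \<and>
      (\<forall>w\<in>weighted_words Lab Wei. accepts Wei A w \<longleftrightarrow> satisfies w \<phi>)"
    using P(2) by auto
next
  fix A :: "('a, 'q, 'c) max_automaton" assume "weighted_max_automaton Lab Wei A"
  then show "\<exists>\<phi>. sentence Lab Wei \<phi> \<and>
      (\<forall>w\<in>weighted_words Lab Wei. satisfies w \<phi> \<longleftrightarrow> accepts Wei A w)"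
    using automaton_definable[OF assms] by metis
qed

end
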